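(* (1) $\mathsf{LStoneFrm_{Sup}}$ is equivalent to $\mathsf{GBA_M}$ and dually equivalent to $\mathsf{PStone}$. (2) $\mathsf{LStoneFrm_{FInf}}$ is equivalent to $\mathsf{GBA}$ and dually equivalent to $\mathsf{PStone_S}$. (3) $\mathsf{LStoneFrm_{FInfB}}$ is equivalent to $\mathsf{GBA_B}$ and dually equivalent to $\mathsf{PStone_{ST}}$. (4) $\mathsf{LStoneFrm}$ is equivalent to $\mathsf{GBA_P}$ and dually equivalent to $\mathsf{PStone_P}$.
   Context: Frames. $\mathsf K(L)$ is the set of compact elements of a complete lattice $L$. In a frame, $a^*=\bigvee\{x\mid a\wedge x=0\}$ and $a$ is complemented if $a\vee a^*=1$; the frame is zero-dimensional if every element is a join of complemented elements, algebraic if every element is a join of compact elements, and compact if its top is compact. A locally Stone frame is an algebraic zero-dimensional frame. The following categories have locally Stone frames as objects. $\mathsf{LStoneFrm_{Sup}}$: maps preserving arbitrary joins and compact elements. $\mathsf{LStoneFrm_{FInf}}$: those $\mathsf{LStoneFrm_{Sup}}$-morphisms $\alpha\colon L_1\to L_2$ such that whenever $\varnothing\ne S\subseteq\mathsf K(L_1)$ is finite and $\bigwedge S\in\mathsf K(L_1)$, then $\alpha(\bigwedge S)=\bigwedge\alpha[S]$. $\mathsf{LStoneFrm_{FInfB}}$: those $\mathsf{LStoneFrm_{FInf}}$-morphisms $\alpha\colon L_1\to L_2$ that are bounded, meaning that whenever $L_1$ and $L_2$ are compact, then $\alpha(1)=1$. $\mathsf{LStoneFrm}$: frame homomorphisms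 preserving compact elements. Algebras. A generalized boolean algebra is (here) a distributive lattice $M$ with top $1$ (possibly without bottom) such that $[a,1]$ is a boolean algebra for each $a\in M$. The following categories have generalized boolean algebras as objects. $\mathsf{GBA_M}$: maps preserving all finite meets (including $1$). $\mathsf{GBA}$: maps preserving all finite meets (including $1$) and nonempty finite joins. $\mathsf{GBA_B}$: those $\mathsf{GBA}$-morphisms $\alpha\colon M_1\to M_2$ that are bounded, meaning that whenever $M_1$ and $M_2$ both have a bottom, then $\alpha(0)=0$. $\mathsf{GBA_P}$: maps $\alpha\colon M_1\to M_2$ preserving all finite meets (including $1$) such that for every finite (possibly empty) $S\subseteq M_1$ and every upper bound $x$ of $\alpha[S]$ there is an upper bound $c$ of $S$ with $\alpha(c)\le x$. Spaces. A Priestley space is a compact space with a partial order such that $x\not\le y$ implies there is a clopen upset containing $x$ and missing $y$. Given a subset $X_0$, a clopen upset $U$ is admissible if the maximal points of $X\setminus U$ lie in $X_0$; $\mathcal A(X)$ is the set of admissible clopen upsets and $\mathcal I_x=\{U\in\mathcal A(X)\mid x\notin U\}$. A pointed generalized Priestley space is a tuple $(X,\tau,\le,X_0,m)$ such that: $(X,\tau,\le)$ is a Priestley space; $m$ is the unique maximum of $X$; $X_0$ is a dense subset of $X\setminus\{m\}$; for each $x\ne m$ there is $y\in X_0$ with $x\le y$; $x\in X_0$ iff $\mathcal I_x$ is nonempty and directed under inclusion; $x\le y$ iff for all $U\in\mathcal A(X)$, $x\in U$ implies $y\in U$. A pointed Priestley space is one with $X_0=X\setminus\{m\}$. A pointed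 Stone space is a pointed Priestley space in which $\le$ restricts to the identity relation on $X\setminus\{m\}$. The following categories have pointed Stone spaces as objects. $\mathsf{PStone}$: generalized Priestley morphisms, i.e. relations $R\subseteq X\times Y$ such that, with $R[x]=\{y\mid x\mathrel Ry\}$ and $\Box_RU=\{x\mid R[x]\subseteq U\}$: (i) if $x\not\mathrel Ry$ there is $U\in\mathcal A(Y)$ with $R[x]\subseteq U$, $y\notin U$; (ii) $U\in\mathcal A(Y)$ implies $\Box_RU\in\mathcal A(X)$; identities are $\le$ and $x\mathrel{(S*R)}z$ iff for all $U\in\mathcal A(Z)$, $x\in\Box_R\Box_SU$ implies $z\in U$. $\mathsf{PStone_S}$: order-preserving maps $f\colon X\to Y$ such that $U\in\mathcal A(Y)$ implies $f^{-1}(U)\in\mathcal A(X)$ (usual composition of functions). $\mathsf{PStone_{ST}}$: those $\mathsf{PStone_S}$-morphisms $f\colon(X,m)\to(Y,n)$ that additionally satisfy $f[X\setminus\{m\}]\subseteq Y\setminus\{n\}$ provided $m$ and $n$ are isolated points (of $X$ and $Y$ respectively). $\mathsf{PStone_P}$: those $\mathsf{PStone_S}$-morphisms with $f[X_0]\subseteq Y_0$.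
   Formalization: In (3) the structures with bounded maps are not closed under composition (P({0})→P(N)→P({0,1})), so are not categories; equivalence there means functors and natural isomorphisms on the objects, maps, identities and composites. Objects are small relative to an arbitrary family of sets. *)

theory Defs
  imports
    "HOL-Algebra.Complete_Lattice"
    "HOL-Analysis.Abstract_Topology"
    "HOL-Library.Equipollence"
    "HOL-Library.FuncSet"
begin

section \<open>Categories, functors and equivalence\<close>

text \<open>
  A \<open>precategory\<close> only carries the data of a category; the axioms are stated by
  \<open>category\<close>. Hom-sets are indexed by objects, so one map may belong to several of them, and
  all operations take the objects as arguments (\<open>Comp C a b c g f\<close> is the composite of
  \<open>f : a \<rightarrow> b\<close> and \<open>g : b \<rightarrow> c\<close>).

  Functors and equivalences are defined on the data, without assuming the axioms, because the
  three structures with ``bounded'' morphisms below are not closed under composition: the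
  inclusion \<open>Pow {0} \<rightarrow> Pow \<nat>\<close> and the map \<open>Pow \<nat> \<rightarrow> Pow {0, 1}\<close>, \<open>A \<mapsto> A \<inter> {0}\<close>, are bounded
  (because the frame \<open>Pow \<nat>\<close> is not compact), but their composite does not preserve the top.
  For such structures \<open>is_functor\<close> still asks for preservation of all composites of morphisms.
\<close>

record ('o, 'm) precategory =
  Ob :: "'o set"
  Hom :: "'o \<Rightarrow> 'o \<Rightarrow> 'm set"
  Idm :: "'o \<Rightarrow> 'm"
  Comp :: "'o \<Rightarrow> 'o \<Rightarrow> 'o \<Rightarrow> 'm \<Rightarrow> 'm \<Rightarrow> 'm"

definition category :: "('o, 'm) precategory \<Rightarrow> bool" where
  "category C \<longleftrightarrow>
     (\<forall>a\<in>Ob C. Idm C a \<in> Hom C a a) \<and>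
     (\<forall>a\<in>Ob C. \<forall>b\<in>Ob C. \<forall>c\<in>Ob C. \<forall>f\<in>Hom C a b. \<forall>g\<in>Hom C b c. Comp C a b c g f \<in> Hom C a c) \<and>
     (\<forall>a\<in>Ob C. \<forall>b\<in>Ob C. \<forall>f\<in>Hom C a b.
        Comp C a a b f (Idm C a) = f \<and> Comp C a b b (Idm C b) f = f) \<and>
     (\<forall>a\<in>Ob C. \<forall>b\<in>Ob C. \<forall>c\<in>Ob C. \<forall>d\<in>Ob C. \<forall>f\<in>Hom C a b. \<forall>g\<in>Hom C b c. \<forall>h\<in>Hom C c d.
        Comp C a b d (Comp C b c d h g) f = Comp C a c d h (Comp C a b c g f))"

definition opposite :: "('o, 'm) precategory \<Rightarrow> ('o, 'm) precategory" where
  "opposite C =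
     \<lparr>Ob = Ob C, Hom = (\<lambda>a b. Hom C b a), Idm = Idm C, Comp = (\<lambda>a b c g f. Comp C c b a f g)\<rparr>"

definition is_functor ::
  "('o, 'm) precategory \<Rightarrow> ('p, 'n) precategory \<Rightarrow> ('o \<Rightarrow> 'p) \<Rightarrow> ('o \<Rightarrow> 'o \<Rightarrow> 'm \<Rightarrow> 'n) \<Rightarrow> bool"
where
  "is_functor C D Fo Fm \<longleftrightarrow>
     (\<forall>a\<in>Ob C. Fo a \<in> Ob D) \<and>
     (\<forall>a\<in>Ob C. \<forall>b\<in>Ob C. \<forall>f\<in>Hom C a b. Fm a b f \<in> Hom D (Fo a) (Fo b)) \<and>
     (\<forall>a\<in>Ob C. Fm a a (Idm C a) = Idm D (Fo a)) \<and>
     (\<forall>a\<in>Ob C. \<forall>b\<in>Ob C. \<forall>c\<in>Ob C. \<forall>f\<in>Hom C a b. \<forall>g\<in>Hom C b c.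
        Fm a c (Comp C a b c g f) = Comp D (Fo a) (Fo b) (Fo c) (Fm b c g) (Fm a b f))"

definition isos :: "('o, 'm) precategory \<Rightarrow> 'o \<Rightarrow> 'o \<Rightarrow> 'm set" where
  "isos C a b = {f \<in> Hom C a b. \<exists>g\<in>Hom C b a. Comp C a b a g f = Idm C a \<and> Comp C b a b f g = Idm C b}"

definition natural_iso ::
  "('o, 'm) precategory \<Rightarrow> ('p, 'n) precategory \<Rightarrow>
   ('o \<Rightarrow> 'p) \<Rightarrow> ('o \<Rightarrow> 'o \<Rightarrow> 'm \<Rightarrow> 'n) \<Rightarrow> ('o \<Rightarrow> 'p) \<Rightarrow> ('o \<Rightarrow> 'o \<Rightarrow> 'm \<Rightarrow> 'n) \<Rightarrow> ('o \<Rightarrow> 'n) \<Rightarrow> bool"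
where
  "natural_iso C D Fo Fm Go Gm \<eta> \<longleftrightarrow>
     (\<forall>a\<in>Ob C. \<eta> a \<in> isos D (Fo a) (Go a)) \<and>
     (\<forall>a\<in>Ob C. \<forall>b\<in>Ob C. \<forall>f\<in>Hom C a b.
        Comp D (Fo a) (Go a) (Go b) (Gm a b f) (\<eta> a) = Comp D (Fo a) (Fo b) (Go b) (\<eta> b) (Fm a b f))"

definition equivalent :: "('o, 'm) precategory \<Rightarrow> ('p, 'n) precategory \<Rightarrow> bool" where
  "equivalent C D \<longleftrightarrow>
     (\<exists>Fo Fm Go Gm \<eta> \<epsilon>.
        is_functor C D Fo Fm \<and> is_functor D C Go Gm \<and>
        natural_iso C C (\<lambda>a. a) (\<lambda>a b f. f) (\<lambda>a. Go (Fo a)) (\<lambda>a b f. Gm (Fo a) (Fo b) (Fm a b f)) \<eta> \<and>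
        natural_iso D D (\<lambda>a. Fo (Go a)) (\<lambda>a b f. Fm (Go a) (Go b) (Gm a b f)) (\<lambda>a. a) (\<lambda>a b f. f) \<epsilon>)"

definition dually_equivalent :: "('o, 'm) precategory \<Rightarrow> ('p, 'n) precategory \<Rightarrow> bool" where
  "dually_equivalent C D \<longleftrightarrow> equivalent C (opposite D)"

text \<open>Objects with an underlying set, and maps between these sets. Maps are taken to be
  extensional functions, so that equality of morphisms is equality on the underlying set.\<close>

definition concrete ::
  "'o set \<Rightarrow> ('o \<Rightarrow> 'a set) \<Rightarrow> ('o \<Rightarrow> 'o \<Rightarrow> ('a \<Rightarrow> 'a) \<Rightarrow> bool) \<Rightarrow> ('o, 'a \<Rightarrow> 'a) precategory"
where
  "concrete Obs car P =
     \<lparr>Ob = Obs,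
      Hom = (\<lambda>A B. {f \<in> car A \<rightarrow>\<^sub>E car B. P A B f}),
      Idm = (\<lambda>A. \<lambda>x\<in>car A. x),
      Comp = (\<lambda>A B C g f. compose (car A) g f)\<rparr>"

definition wide_sub ::
  "('o, 'm) precategory \<Rightarrow> ('o \<Rightarrow> 'o \<Rightarrow> 'm \<Rightarrow> bool) \<Rightarrow> ('o, 'm) precategory"
where
  "wide_sub C P = C\<lparr>Hom := (\<lambda>a b. {f \<in> Hom C a b. P a b f})\<rparr>"

definition full_sub :: "('o, 'm) precategory \<Rightarrow> ('o \<Rightarrow> bool) \<Rightarrow> ('o, 'm) precategory" where
  "full_sub C P = C\<lparr>Ob := {a \<in> Ob C. P a}\<rparr>"


section \<open>Locally Stone frames\<close>

definition frame :: "'a gorder \<Rightarrow> bool" where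
  "frame L \<longleftrightarrow> complete_lattice L \<and>
     (\<forall>a\<in>carrier L. \<forall>A\<subseteq>carrier L. a \<sqinter>\<^bsub>L\<^esub> (\<Squnion>\<^bsub>L\<^esub>A) = \<Squnion>\<^bsub>L\<^esub>((\<lambda>x. a \<sqinter>\<^bsub>L\<^esub> x) ` A))"

definition compacts :: "'a gorder \<Rightarrow> 'a set" where
  "compacts L = {k \<in> carrier L. \<forall>A\<subseteq>carrier L. k \<sqsubseteq>\<^bsub>L\<^esub> \<Squnion>\<^bsub>L\<^esub>A \<longrightarrow> (\<exists>B\<subseteq>A. finite B \<and> k \<sqsubseteq>\<^bsub>L\<^esub> \<Squnion>\<^bsub>L\<^esub>B)}"

definition pseudocomplement :: "'a gorder \<Rightarrow> 'a \<Rightarrow> 'a" where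
  "pseudocomplement L a = \<Squnion>\<^bsub>L\<^esub>{x \<in> carrier L. a \<sqinter>\<^bsub>L\<^esub> x = \<bottom>\<^bsub>L\<^esub>}"

definition complementeds :: "'a gorder \<Rightarrow> 'a set" where
  "complementeds L = {a \<in> carrier L. a \<squnion>\<^bsub>L\<^esub> pseudocomplement L a = \<top>\<^bsub>L\<^esub>}"

definition zero_dimensional :: "'a gorder \<Rightarrow> bool" where
  "zero_dimensional L \<longleftrightarrow> (\<forall>a\<in>carrier L. \<exists>A\<subseteq>complementeds L. a = \<Squnion>\<^bsub>L\<^esub>A)"

definition algebraic :: "'a gorder \<Rightarrow> bool" where
  "algebraic L \<longleftrightarrow> (\<forall>a\<in>carrier L. \<exists>A\<subseteq>compacts L. a = \<Squnion>\<^bsub>L\<^esub>A)"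

definition compact_frame :: "'a gorder \<Rightarrow> bool" where
  "compact_frame L \<longleftrightarrow> \<top>\<^bsub>L\<^esub> \<in> compacts L"

definition locally_Stone_frame :: "'a gorder \<Rightarrow> bool" where
  "locally_Stone_frame L \<longleftrightarrow> frame L \<and> algebraic L \<and> zero_dimensional L"

definition preserves_joins :: "'a gorder \<Rightarrow> 'a gorder \<Rightarrow> ('a \<Rightarrow> 'a) \<Rightarrow> bool" where
  "preserves_joins L1 L2 \<alpha> \<longleftrightarrow> (\<forall>A\<subseteq>carrier L1. \<alpha> (\<Squnion>\<^bsub>L1\<^esub>A) = \<Squnion>\<^bsub>L2\<^esub>(\<alpha> ` A))"

text \<open>The empty meet is the top, so this includes preservation of the top.\<close>

definition preserves_finite_meets :: "'a gorder \<Rightarrow> 'a gorder \<Rightarrow> ('a \<Rightarrow> 'a) \<Rightarrow> bool" where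
  "preserves_finite_meets L1 L2 \<alpha> \<longleftrightarrow>
     (\<forall>A\<subseteq>carrier L1. finite A \<longrightarrow> \<alpha> (\<Sqinter>\<^bsub>L1\<^esub>A) = \<Sqinter>\<^bsub>L2\<^esub>(\<alpha> ` A))"

definition preserves_compacts :: "'a gorder \<Rightarrow> 'a gorder \<Rightarrow> ('a \<Rightarrow> 'a) \<Rightarrow> bool" where
  "preserves_compacts L1 L2 \<alpha> \<longleftrightarrow> \<alpha> ` compacts L1 \<subseteq> compacts L2"

definition LStoneFrm_Sup :: "('a gorder, 'a \<Rightarrow> 'a) precategory" where
  "LStoneFrm_Sup = concrete {L. locally_Stone_frame L} carrier
     (\<lambda>L1 L2 \<alpha>. preserves_joins L1 L2 \<alpha> \<and> preserves_compacts L1 L2 \<alpha>)"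

definition LStoneFrm_FInf :: "('a gorder, 'a \<Rightarrow> 'a) precategory" where
  "LStoneFrm_FInf = wide_sub LStoneFrm_Sup
     (\<lambda>L1 L2 \<alpha>. \<forall>S\<subseteq>compacts L1. finite S \<and> S \<noteq> {} \<and> \<Sqinter>\<^bsub>L1\<^esub>S \<in> compacts L1 \<longrightarrow>
        \<alpha> (\<Sqinter>\<^bsub>L1\<^esub>S) = \<Sqinter>\<^bsub>L2\<^esub>(\<alpha> ` S))"

definition LStoneFrm_FInfB :: "('a gorder, 'a \<Rightarrow> 'a) precategory" where
  "LStoneFrm_FInfB = wide_sub LStoneFrm_FInf
     (\<lambda>L1 L2 \<alpha>. compact_frame L1 \<and> compact_frame L2 \<longrightarrow> \<alpha> \<top>\<^bsub>L1\<^esub> = \<top>\<^bsub>L2\<^esub>)"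

definition LStoneFrm :: "('a gorder, 'a \<Rightarrow> 'a) precategory" where
  "LStoneFrm = concrete {L. locally_Stone_frame L} carrier
     (\<lambda>L1 L2 \<alpha>. preserves_joins L1 L2 \<alpha> \<and> preserves_finite_meets L1 L2 \<alpha> \<and>
        preserves_compacts L1 L2 \<alpha>)"


section \<open>Generalized boolean algebras\<close>

definition distributive_lattice :: "'a gorder \<Rightarrow> bool" where
  "distributive_lattice M \<longleftrightarrow> lattice M \<and>
     (\<forall>x\<in>carrier M. \<forall>y\<in>carrier M. \<forall>z\<in>carrier M.
        x \<sqinter>\<^bsub>M\<^esub> (y \<squnion>\<^bsub>M\<^esub> z) = (x \<sqinter>\<^bsub>M\<^esub> y) \<squnion>\<^bsub>M\<^esub> (x \<sqinter>\<^bsub>M\<^esub> z))"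

definition boolean_lattice :: "'a gorder \<Rightarrow> bool" where
  "boolean_lattice B \<longleftrightarrow> distributive_lattice B \<and> bounded_lattice B \<and>
     (\<forall>x\<in>carrier B. \<exists>y\<in>carrier B. x \<sqinter>\<^bsub>B\<^esub> y = \<bottom>\<^bsub>B\<^esub> \<and> x \<squnion>\<^bsub>B\<^esub> y = \<top>\<^bsub>B\<^esub>)"

definition generalized_boolean_algebra :: "'a gorder \<Rightarrow> bool" where
  "generalized_boolean_algebra M \<longleftrightarrow> distributive_lattice M \<and> weak_partial_order_top M \<and>
     (\<forall>a\<in>carrier M. boolean_lattice (M\<lparr>carrier := \<lbrace>a..\<top>\<^bsub>M\<^esub>\<rbrace>\<^bsub>M\<^esub>\<rparr>))"

definition preserves_nonempty_finite_joins :: "'a gorder \<Rightarrow> 'a gorder \<Rightarrow> ('a \<Rightarrow> 'a) \<Rightarrow> bool" where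
  "preserves_nonempty_finite_joins M1 M2 \<alpha> \<longleftrightarrow>
     (\<forall>S\<subseteq>carrier M1. finite S \<and> S \<noteq> {} \<longrightarrow> \<alpha> (\<Squnion>\<^bsub>M1\<^esub>S) = \<Squnion>\<^bsub>M2\<^esub>(\<alpha> ` S))"

definition GBA_M :: "('a gorder, 'a \<Rightarrow> 'a) precategory" where
  "GBA_M = concrete {M. generalized_boolean_algebra M} carrier preserves_finite_meets"

definition GBA :: "('a gorder, 'a \<Rightarrow> 'a) precategory" where
  "GBA = concrete {M. generalized_boolean_algebra M} carrier
     (\<lambda>M1 M2 \<alpha>. preserves_finite_meets M1 M2 \<alpha> \<and> preserves_nonempty_finite_joins M1 M2 \<alpha>)"

definition GBA_B :: "('a gorder, 'a \<Rightarrow> 'a) precategory" where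
  "GBA_B = wide_sub GBA
     (\<lambda>M1 M2 \<alpha>. weak_partial_order_bottom M1 \<and> weak_partial_order_bottom M2 \<longrightarrow>
        \<alpha> \<bottom>\<^bsub>M1\<^esub> = \<bottom>\<^bsub>M2\<^esub>)"

definition GBA_P :: "('a gorder, 'a \<Rightarrow> 'a) precategory" where
  "GBA_P = concrete {M. generalized_boolean_algebra M} carrier
     (\<lambda>M1 M2 \<alpha>. preserves_finite_meets M1 M2 \<alpha> \<and>
        (\<forall>S\<subseteq>carrier M1. finite S \<longrightarrow>
           (\<forall>x\<in>Upper M2 (\<alpha> ` S). \<exists>c\<in>Upper M1 S. \<alpha> c \<sqsubseteq>\<^bsub>M2\<^esub> x)))"


section \<open>Pointed Stone spaces\<close>

text \<open>The tuples $(X,\tau,\le,X_0,m)$; the set $X$ is the \<open>topspace\<close> of \<open>topo\<close>.\<close>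

record 'x pointed_ospace =
  topo :: "'x topology"
  leq :: "('x \<times> 'x) set"
  core :: "'x set"
  pt :: 'x

abbreviation pts :: "'x pointed_ospace \<Rightarrow> 'x set" where
  "pts X \<equiv> topspace (topo X)"

definition clopen_upsets :: "'x topology \<Rightarrow> ('x \<times> 'x) set \<Rightarrow> 'x set set" where
  "clopen_upsets T r = {U. openin T U \<and> closedin T U \<and> (\<forall>x\<in>U. \<forall>y. (x, y) \<in> r \<longrightarrow> y \<in> U)}"

definition Priestley_space :: "'x topology \<Rightarrow> ('x \<times> 'x) set \<Rightarrow> bool" where
  "Priestley_space T r \<longleftrightarrow> compact_space T \<and> partial_order_on (topspace T) r \<and>
     (\<forall>x\<in>topspace T. \<forall>y\<in>topspace T. (x, y) \<notin> r \<longrightarrow> (\<exists>U\<in>clopen_upsets T r. x \<in> U \<and> y \<notin> U))"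

definition maximal_points :: "('x \<times> 'x) set \<Rightarrow> 'x set \<Rightarrow> 'x set" where
  "maximal_points r A = {x \<in> A. \<forall>y\<in>A. (x, y) \<in> r \<longrightarrow> y = x}"

definition admissible :: "'x pointed_ospace \<Rightarrow> 'x set set" where
  "admissible X = {U \<in> clopen_upsets (topo X) (leq X). maximal_points (leq X) (pts X - U) \<subseteq> core X}"

definition admissible_missing :: "'x pointed_ospace \<Rightarrow> 'x \<Rightarrow> 'x set set" where
  "admissible_missing X x = {U \<in> admissible X. x \<notin> U}"

definition directed :: "'x set set \<Rightarrow> bool" where
  "directed \<U> \<longleftrightarrow> (\<forall>U\<in>\<U>. \<forall>V\<in>\<U>. \<exists>W\<in>\<U>. U \<subseteq> W \<and> V \<subseteq> W)"

definition pointed_generalized_Priestley_space :: "'x pointed_ospace \<Rightarrow> bool" where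
  "pointed_generalized_Priestley_space X \<longleftrightarrow>
     Priestley_space (topo X) (leq X) \<and>
     pt X \<in> pts X \<and> (\<forall>x\<in>pts X. (x, pt X) \<in> leq X) \<and>
     core X \<subseteq> pts X - {pt X} \<and>
     subtopology (topo X) (pts X - {pt X}) closure_of core X = pts X - {pt X} \<and>
     (\<forall>x\<in>pts X - {pt X}. \<exists>y\<in>core X. (x, y) \<in> leq X) \<and>
     (\<forall>x\<in>pts X. x \<in> core X \<longleftrightarrow> admissible_missing X x \<noteq> {} \<and> directed (admissible_missing X x)) \<and>
     (\<forall>x\<in>pts X. \<forall>y\<in>pts X. (x, y) \<in> leq X \<longleftrightarrow> (\<forall>U\<in>admissible X. x \<in> U \<longrightarrow> y \<in> U))"

definition pointed_Priestley_space :: "'x pointed_ospace \<Rightarrow> bool" where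
  "pointed_Priestley_space X \<longleftrightarrow>
     pointed_generalized_Priestley_space X \<and> core X = pts X - {pt X}"

definition pointed_Stone_space :: "'x pointed_ospace \<Rightarrow> bool" where
  "pointed_Stone_space X \<longleftrightarrow> pointed_Priestley_space X \<and>
     (\<forall>x\<in>pts X - {pt X}. \<forall>y\<in>pts X - {pt X}. (x, y) \<in> leq X \<longleftrightarrow> x = y)"

definition box :: "'x pointed_ospace \<Rightarrow> ('x \<times> 'x) set \<Rightarrow> 'x set \<Rightarrow> 'x set" where
  "box X R U = {x \<in> pts X. R `` {x} \<subseteq> U}"

definition generalized_Priestley_morphism ::
  "'x pointed_ospace \<Rightarrow> 'x pointed_ospace \<Rightarrow> ('x \<times> 'x) set \<Rightarrow> bool"
where
  "generalized_Priestley_morphism X Y R \<longleftrightarrow> R \<subseteq> pts X \<times> pts Y \<and>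
     (\<forall>x\<in>pts X. \<forall>y\<in>pts Y. (x, y) \<notin> R \<longrightarrow> (\<exists>U\<in>admissible Y. R `` {x} \<subseteq> U \<and> y \<notin> U)) \<and>
     (\<forall>U\<in>admissible Y. box X R U \<in> admissible X)"

definition star_comp ::
  "'x pointed_ospace \<Rightarrow> 'x pointed_ospace \<Rightarrow> 'x pointed_ospace \<Rightarrow>
   ('x \<times> 'x) set \<Rightarrow> ('x \<times> 'x) set \<Rightarrow> ('x \<times> 'x) set"
where
  "star_comp X Y Z S R =
     {(x, z) \<in> pts X \<times> pts Z. \<forall>U\<in>admissible Z. x \<in> box X R (box Y S U) \<longrightarrow> z \<in> U}"

definition PStone :: "('x pointed_ospace, ('x \<times> 'x) set) precategory" where
  "PStone =
     \<lparr>Ob = {X. pointed_Stone_space X},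
      Hom = (\<lambda>X Y. {R. generalized_Priestley_morphism X Y R}),
      Idm = leq,
      Comp = star_comp\<rparr>"

definition PStone_S :: "('x pointed_ospace, 'x \<Rightarrow> 'x) precategory" where
  "PStone_S = concrete {X. pointed_Stone_space X} pts
     (\<lambda>X Y f. (\<forall>x\<in>pts X. \<forall>y\<in>pts X. (x, y) \<in> leq X \<longrightarrow> (f x, f y) \<in> leq Y) \<and>
        (\<forall>U\<in>admissible Y. {x \<in> pts X. f x \<in> U} \<in> admissible X))"

definition PStone_ST :: "('x pointed_ospace, 'x \<Rightarrow> 'x) precategory" where
  "PStone_ST = wide_sub PStone_S
     (\<lambda>X Y f. openin (topo X) {pt X} \<and> openin (topo Y) {pt Y} \<longrightarrow>
        f ` (pts X - {pt X}) \<subseteq> pts Y - {pt Y})"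

definition PStone_P :: "('x pointed_ospace, 'x \<Rightarrow> 'x) precategory" where
  "PStone_P = wide_sub PStone_S (\<lambda>X Y f. f ` core X \<subseteq> core Y)"


section \<open>Size\<close>

text \<open>
  The constructions relating the three kinds of objects involve power sets, so no choice of
  carrier types makes the objects on them closed under all of these constructions. As usual, one
  has to fix which objects are small. Here this is done by a family \<open>S\<close> of sets: small
  means that the set of compact elements, the carrier, and the set of admissible clopen upsets,
  respectively, embeds into a member of \<open>S\<close>. The only requirement on the carrier types is
  then that those of frames and spaces have room for the power sets of the members of \<open>S\<close>.
  \<^item> With \<open>S = {UNIV :: 'a set set}\<close> and carrier types \<open>'a set\<close> one gets the objects of size at
    most that of \<open>'a\<close>. Since \<open>'a\<close> is arbitrary, every object of every type occurs
    (up to isomorphism) for some \<open>'a\<close>.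
  \<^item> If \<open>S\<close> consists of sets over one type and is a universe (closed under subsets and, up to
    bijection, under power sets), taking all three carrier types equal gives exactly the frames,
    algebras and spaces whose carriers embed into a member of that universe.
\<close>

definition embeds_into_member :: "'b set \<Rightarrow> 'a set set \<Rightarrow> bool" where
  "embeds_into_member B S \<longleftrightarrow> (\<exists>A\<in>S. B \<lesssim> A)"

definition small_frames :: "'a set set \<Rightarrow> ('f gorder, 'm) precategory \<Rightarrow> ('f gorder, 'm) precategory" where
  "small_frames S C = full_sub C (\<lambda>L. embeds_into_member (compacts L) S)"

definition small_algebras :: "'a set set \<Rightarrow> ('b gorder, 'm) precategory \<Rightarrow> ('b gorder, 'm) precategory" where
  "small_algebras S C = full_sub C (\<lambda>M. embeds_into_member (carrier M) S)"

definition small_spaces ::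
  "'a set set \<Rightarrow> ('x pointed_ospace, 'm) precategory \<Rightarrow> ('x pointed_ospace, 'm) precategory"
where
  "small_spaces S C = full_sub C (\<lambda>X. embeds_into_member (admissible X) S)"

end

theory Submission
  imports Defs "HOL-Analysis.Function_Topology"
begin

text \<open>
  All three kinds of objects carry a generalized boolean algebra, and everything is reduced to these
  algebras. For a locally Stone frame it consists of the compact elements under the reversed order
  (\<open>algebra_of_frame\<close>), for a pointed Stone space of the admissible sets, which turn out to be the
  clopen sets containing the point at infinity (\<open>algebra_of_space\<close>, \<open>admissible_iff\<close>).

  Morphisms correspond bijectively to homomorphisms of a suitable kind between the algebras; the
  locale \<open>representation\<close> records this. For frames, the homomorphisms are the restrictions to compact
  elements: as every element is a join of compact ones, a join-preserving map is determined by its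
  restriction (\<open>sup_homs_equal\<close>), and compactness lets every map preserving finite joins of
  compact elements extend (\<open>extend_from_compacts\<close>). For spaces, the homomorphisms run backwards. By
  compactness, those preserving finite meets are the box operators of generalized Priestley
  morphisms (\<open>box_relation_of_hom\<close>), and those that also preserve binary joins are the preimage
  operators of maps (\<open>point_of_lattice_hom\<close>).

  The additional conditions on morphisms match as well. Preservation of meets of compact elements
  amounts to a lattice homomorphism. Preservation of all finite meets of the frame, the inclusion
  \<open>f ` core X \<subseteq> core Y\<close>, and the lifting of upper bounds all amount to a lattice homomorphism with
  coinitial image. The algebra has a bottom iff the frame is compact, or iff the point at infinity
  is isolated, and each of the three notions of boundedness says that bottoms are preserved.

  Every generalized boolean algebra occurs on each side: its prime filters together with the
  improper filter are the points of a pointed Stone space whose admissible sets form the given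
  algebra (\<open>order_iso_\<phi>\<close>), and the open sets of a pointed Stone space that avoid the point at infinity
  form a locally Stone frame with the same algebra (\<open>order_iso_L\<close>). Points of the first are sets of
  elements, and open sets are determined by sets of admissible sets, so carrier types with room for
  the power sets of small algebras accommodate these constructions.

  As the carriers are of unrelated types, the objects are not compared by functors but matched by
  isomorphisms of their algebras, and morphisms are matched by commuting squares. From such a
  matching \<open>equivalent_wide_subs\<close> obtains an equivalence by choice. It also applies to the bounded
  morphisms, which are not closed under composition, because the components of the unit and the
  counit are matched with identities.
\<close>

section \<open>Equivalences from matched morphisms\<close>

lemma categoryD:
  assumes "category C"
  shows Idm_in_Hom: "a \<in> Ob C \<Longrightarrow> Idm C a \<in> Hom C a a"
    and Comp_in_Hom: "\<lbrakk>a \<in> Ob C; b \<in> Ob C; c \<in> Ob C; f \<in> Hom C a b; g \<in> Hom C b c\<rbrakk>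
      \<Longrightarrow> Comp C a b c g f \<in> Hom C a c"
    and Comp_Idm: "\<lbrakk>a \<in> Ob C; b \<in> Ob C; f \<in> Hom C a b\<rbrakk> \<Longrightarrow> Comp C a a b f (Idm C a) = f"
    and Idm_Comp: "\<lbrakk>a \<in> Ob C; b \<in> Ob C; f \<in> Hom C a b\<rbrakk> \<Longrightarrow> Comp C a b b (Idm C b) f = f"
  using assms unfolding category_def by blast+

lemma opposite_opposite [simp]: "opposite (opposite C) = C"
  by (simp add: opposite_def)

lemma category_opposite:
  assumes "category C"
  shows "category (opposite C)"
  unfolding category_def
proof (intro conjI ballI)
  fix a b c d f g h
  assume "a \<in> Ob (opposite C)" "b \<in> Ob (opposite C)" "c \<in> Ob (opposite C)" "d \<in> Ob (opposite C)"
    "f \<in> Hom (opposite C) a b" "g \<in> Hom (opposite C) b c" "h \<in> Hom (opposite C) c d"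
  then show "Comp (opposite C) a b d (Comp (opposite C) b c d h g) f
      = Comp (opposite C) a c d h (Comp (opposite C) a b c g f)"
    using assms unfolding category_def by (simp add: opposite_def)
qed (use assms in \<open>auto simp: opposite_def category_def\<close>)

lemma category_full_sub: "category C \<Longrightarrow> category (full_sub C P)"
  unfolding category_def full_sub_def by simp

lemma category_concrete:
  assumes "\<And>A. A \<in> Obs \<Longrightarrow> P A A (\<lambda>x\<in>car A. x)"
    and "\<And>A B C f g. \<lbrakk>A \<in> Obs; B \<in> Obs; C \<in> Obs; f \<in> car A \<rightarrow>\<^sub>E car B; g \<in> car B \<rightarrow>\<^sub>E car C;
           P A B f; P B C g\<rbrakk> \<Longrightarrow> P A C (compose (car A) g f)"
  shows "category (concrete Obs car P)"
  unfolding category_def concrete_def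
  using assms
  by (auto simp: compose_def restrict_def PiE_def Pi_def extensional_def fun_eq_iff)

text \<open>
  A bridge matches objects and morphisms of two categories without a functor in either direction:
  \<open>W a x w\<close> says that the witness \<open>w\<close> matches \<open>a\<close> with \<open>x\<close>, and \<open>M a b x y w v f g\<close> that
  \<open>f : a \<rightarrow> b\<close> and \<open>g : x \<rightarrow> y\<close> are mates with respect to the witnesses \<open>w\<close> and \<open>v\<close>. In the
  application the objects live on different types but carry isomorphic algebras, witnesses are
  such isomorphisms, and mates are two opposite sides of a commuting square.
\<close>

locale bridge =
  fixes C :: "('o, 'm) precategory" and E :: "('p, 'n) precategory"
    and W :: "'o \<Rightarrow> 'p \<Rightarrow> 'w \<Rightarrow> bool"
    and M :: "'o \<Rightarrow> 'o \<Rightarrow> 'p \<Rightarrow> 'p \<Rightarrow> 'w \<Rightarrow> 'w \<Rightarrow> 'm \<Rightarrow> 'n \<Rightarrow> bool"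
  assumes catC: "category C" and catE: "category E"
    and exE: "a \<in> Ob C \<Longrightarrow> \<exists>x\<in>Ob E. \<exists>w. W a x w"
    and exC: "x \<in> Ob E \<Longrightarrow> \<exists>a\<in>Ob C. \<exists>w. W a x w"
    and mateE: "\<lbrakk>a \<in> Ob C; b \<in> Ob C; x \<in> Ob E; y \<in> Ob E; W a x w; W b y v; f \<in> Hom C a b\<rbrakk>
      \<Longrightarrow> \<exists>!g. g \<in> Hom E x y \<and> M a b x y w v f g"
    and mateC: "\<lbrakk>a \<in> Ob C; b \<in> Ob C; x \<in> Ob E; y \<in> Ob E; W a x w; W b y v; g \<in> Hom E x y\<rbrakk>
      \<Longrightarrow> \<exists>!f. f \<in> Hom C a b \<and> M a b x y w v f g"
    and mate_Idm: "\<lbrakk>a \<in> Ob C; x \<in> Ob E; W a x w\<rbrakk> \<Longrightarrow> M a a x x w w (Idm C a) (Idm E x)"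
    and mate_Comp: "\<lbrakk>a \<in> Ob C; b \<in> Ob C; c \<in> Ob C; x \<in> Ob E; y \<in> Ob E; z \<in> Ob E;
        W a x w; W b y v; W c z u; f \<in> Hom C a b; f' \<in> Hom C b c; g \<in> Hom E x y; g' \<in> Hom E y z;
        M a b x y w v f g; M b c y z v u f' g'\<rbrakk>
      \<Longrightarrow> M a c x z w u (Comp C a b c f' f) (Comp E x y z g' g)"
begin

definition "mate a b x y w v f = (THE g. g \<in> Hom E x y \<and> M a b x y w v f g)"

definition "obj a = (SOME x. x \<in> Ob E \<and> (\<exists>w. W a x w))"

definition "wit a = (SOME w. W a (obj a) w)"

definition "mor a b f = mate a b (obj a) (obj b) (wit a) (wit b) f"

lemma mate:
  assumes "a \<in> Ob C" "b \<in> Ob C" "x \<in> Ob E" "y \<in> Ob E" "W a x w" "W b y v" "f \<in> Hom C a b"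
  shows "mate a b x y w v f \<in> Hom E x y" "M a b x y w v f (mate a b x y w v f)"
  using theI'[OF mateE[OF assms]] unfolding mate_def by auto

lemma mate_eqI:
  assumes "a \<in> Ob C" "b \<in> Ob C" "x \<in> Ob E" "y \<in> Ob E" "W a x w" "W b y v" "f \<in> Hom C a b"
    "g \<in> Hom E x y" "M a b x y w v f g"
  shows "mate a b x y w v f = g"
  unfolding mate_def by (rule the1_equality[OF mateE[OF assms(1-7)]]) (use assms in simp)

lemma mate_of_Idm: "\<lbrakk>a \<in> Ob C; x \<in> Ob E; W a x w\<rbrakk> \<Longrightarrow> mate a a x x w w (Idm C a) = Idm E x"
  by (rule mate_eqI) (simp_all add: Idm_in_Hom[OF catC] Idm_in_Hom[OF catE] mate_Idm)

lemma mate_of_Comp: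
  assumes "a \<in> Ob C" "b \<in> Ob C" "c \<in> Ob C" "x \<in> Ob E" "y \<in> Ob E" "z \<in> Ob E"
    "W a x w" "W b y v" "W c z u" "f \<in> Hom C a b" "f' \<in> Hom C b c"
  shows "mate a c x z w u (Comp C a b c f' f)
    = Comp E x y z (mate b c y z v u f') (mate a b x y w v f)"
  by (rule mate_eqI)
    (use assms in \<open>simp_all add: Comp_in_Hom[OF catC] Comp_in_Hom[OF catE, of x y z] mate
        mate_Comp[of a b c x y z w v u]\<close>)

lemma obj: "a \<in> Ob C \<Longrightarrow> obj a \<in> Ob E" "a \<in> Ob C \<Longrightarrow> W a (obj a) (wit a)"
proof -
  assume "a \<in> Ob C"
  then have "\<exists>x. x \<in> Ob E \<and> (\<exists>w. W a x w)" using exE by blast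
  then have *: "obj a \<in> Ob E \<and> (\<exists>w. W a (obj a) w)"
    unfolding obj_def by (rule someI_ex)
  then show "obj a \<in> Ob E" by simp
  from * have "\<exists>w. W a (obj a) w" by simp
  then show "W a (obj a) (wit a)" unfolding wit_def by (rule someI_ex)
qed

lemma functor_wide_sub:
  assumes PR: "\<And>a b x y w v f g. \<lbrakk>a \<in> Ob C; b \<in> Ob C; x \<in> Ob E; y \<in> Ob E; W a x w; W b y v;
      f \<in> Hom C a b; g \<in> Hom E x y; M a b x y w v f g\<rbrakk> \<Longrightarrow> P a b f \<longleftrightarrow> R x y g"
  shows "is_functor (wide_sub C P) (wide_sub E R) obj mor"
  unfolding is_functor_def
proof (intro conjI ballI)
  fix a b f assume "a \<in> Ob (wide_sub C P)" "b \<in> Ob (wide_sub C P)" "f \<in> Hom (wide_sub C P) a b"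
  then have *: "a \<in> Ob C" "b \<in> Ob C" "f \<in> Hom C a b" "P a b f"
    by (auto simp: wide_sub_def)
  note m = mate[OF *(1,2) obj(1) obj(1) obj(2) obj(2) *(3)]
  show "mor a b f \<in> Hom (wide_sub E R) (obj a) (obj b)"
    using PR[OF *(1,2) obj(1) obj(1) obj(2) obj(2) *(3) m] m(1) * by (simp add: wide_sub_def mor_def)
next
  fix a b c f g assume "a \<in> Ob (wide_sub C P)" "b \<in> Ob (wide_sub C P)" "c \<in> Ob (wide_sub C P)"
    "f \<in> Hom (wide_sub C P) a b" "g \<in> Hom (wide_sub C P) b c"
  then show "mor a c (Comp (wide_sub C P) a b c g f)
      = Comp (wide_sub E R) (obj a) (obj b) (obj c) (mor b c g) (mor a b f)"
    unfolding mor_def by (simp add: wide_sub_def obj mate_of_Comp[where y = "obj b" and v = "wit b"])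
qed (simp_all add: wide_sub_def obj mor_def mate_of_Idm)

text \<open>Two objects matched with the same \<open>a\<close> are isomorphic through the mates of its identity.\<close>

lemma comparison_isos:
  assumes PR: "\<And>a b x y w v f g. \<lbrakk>a \<in> Ob C; b \<in> Ob C; x \<in> Ob E; y \<in> Ob E; W a x w; W b y v;
      f \<in> Hom C a b; g \<in> Hom E x y; M a b x y w v f g\<rbrakk> \<Longrightarrow> P a b f \<longleftrightarrow> R x y g"
    and P: "P a a (Idm C a)" and a: "a \<in> Ob C"
    and xy: "x \<in> Ob E" "y \<in> Ob E" "W a x w" "W a y v"
  shows "mate a a x y w v (Idm C a) \<in> isos (wide_sub E R) x y"
proof -
  note I = Idm_in_Hom[OF catC a] and II = Comp_Idm[OF catC a a Idm_in_Hom[OF catC a]]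
  have "Comp E x y x (mate a a y x v w (Idm C a)) (mate a a x y w v (Idm C a)) = Idm E x"
    using mate_of_Comp[OF a a a xy(1,2,1) xy(3,4,3) I I] a xy by (simp add: II mate_of_Idm)
  moreover have "Comp E y x y (mate a a x y w v (Idm C a)) (mate a a y x v w (Idm C a)) = Idm E y"
    using mate_of_Comp[OF a a a xy(2,1,2) xy(4,3,4) I I] a xy by (simp add: II mate_of_Idm)
  moreover note m = mate[OF a a xy I] mate[OF a a xy(2,1,4,3) I]
  moreover have "R x y (mate a a x y w v (Idm C a))" "R y x (mate a a y x v w (Idm C a))"
    using PR[OF a a xy I m(1,2)] PR[OF a a xy(2,1,4,3) I m(3,4)] P by simp_all
  ultimately show ?thesis unfolding isos_def wide_sub_def by auto
qed

text \<open>Both composites are the mate of \<open>f\<close> with respect to \<open>w\<close> and \<open>v'\<close>.\<close>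

lemma comparison_natural:
  assumes "a \<in> Ob C" "b \<in> Ob C" "f \<in> Hom C a b"
    and "x \<in> Ob E" "x' \<in> Ob E" "W a x w" "W a x' w'" "y \<in> Ob E" "y' \<in> Ob E" "W b y v" "W b y' v'"
    and "g \<in> Hom E x y" "M a b x y w v f g" "g' \<in> Hom E x' y'" "M a b x' y' w' v' f g'"
  shows "Comp E x x' y' g' (mate a a x x' w w' (Idm C a)) = Comp E x y y' (mate b b y y' v v' (Idm C b)) g"
proof -
  have "mate a b x y w v f = g" "mate a b x' y' w' v' f = g'"
    by (rule mate_eqI; use assms in simp)+
  moreover have "Comp E x x' y' (mate a b x' y' w' v' f) (mate a a x x' w w' (Idm C a)) = mate a b x y' w v' f"
    using mate_of_Comp[of a a b x x' y' w w' v' "Idm C a" f] assms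
    by (simp add: Idm_in_Hom[OF catC] Comp_Idm[OF catC])
  moreover have "Comp E x y y' (mate b b y y' v v' (Idm C b)) (mate a b x y w v f) = mate a b x y' w v' f"
    using mate_of_Comp[of a b b x y y' w v v' f "Idm C b"] assms
    by (simp add: Idm_in_Hom[OF catC] Idm_Comp[OF catC])
  ultimately show ?thesis by simp
qed

lemma swap: "bridge E C (\<lambda>x a. W a x) (\<lambda>x y a b w v g f. M a b x y w v f g)"
  by unfold_locales (simp_all add: catC catE exC exE mateC mateE mate_Idm mate_Comp)

text \<open>
  Passing to wide substructures only requires that mates lie in them simultaneously; these need not
  be closed under composition. The unit and the counit are mates of identities, and so are their
  inverses, so they belong to the substructures as soon as the identities do.
\<close>

theorem equivalent_wide_subs:
  assumes PR: "\<And>a b x y w v f g. \<lbrakk>a \<in> Ob C; b \<in> Ob C; x \<in> Ob E; y \<in> Ob E; W a x w; W b y v;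
      f \<in> Hom C a b; g \<in> Hom E x y; M a b x y w v f g\<rbrakk> \<Longrightarrow> P a b f \<longleftrightarrow> R x y g"
    and RI: "\<And>x. x \<in> Ob E \<Longrightarrow> R x x (Idm E x)"
  shows "equivalent (wide_sub C P) (wide_sub E R)"
proof -
  interpret S: bridge E C "\<lambda>x a. W a x" "\<lambda>x y a b w v g f. M a b x y w v f g" by (rule swap)
  have RP: "R x y g \<longleftrightarrow> P a b f" if "x \<in> Ob E" "y \<in> Ob E" "a \<in> Ob C" "b \<in> Ob C" "W a x w" "W b y v"
      "g \<in> Hom E x y" "f \<in> Hom C a b" "M a b x y w v f g" for a b x y w v f g
    using PR[OF that(3,4,1,2,5,6,8,7,9)] by simp
  have PI: "P a a (Idm C a)" if a: "a \<in> Ob C" for a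
    using PR[OF a a obj(1,1)[OF a] obj(2,2)[OF a] Idm_in_Hom[OF catC a] Idm_in_Hom[OF catE obj(1)[OF a]]
        mate_Idm[OF a obj[OF a]]] RI[OF obj(1)[OF a]] by simp
  let ?\<eta> = "\<lambda>a. S.mate (obj a) (obj a) a (S.obj (obj a)) (wit a) (S.wit (obj a)) (Idm E (obj a))"
  let ?\<epsilon> = "\<lambda>x. mate (S.obj x) (S.obj x) (obj (S.obj x)) x (wit (S.obj x)) (S.wit x) (Idm C (S.obj x))"
  have "is_functor (wide_sub C P) (wide_sub E R) obj mor"
    by (rule functor_wide_sub[OF PR])
  moreover have "is_functor (wide_sub E R) (wide_sub C P) S.obj S.mor"
    by (rule S.functor_wide_sub[OF RP])
  moreover have "natural_iso (wide_sub C P) (wide_sub C P) (\<lambda>a. a) (\<lambda>a b f. f)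
      (\<lambda>a. S.obj (obj a)) (\<lambda>a b f. S.mor (obj a) (obj b) (mor a b f)) ?\<eta>"
    unfolding natural_iso_def
  proof (intro conjI ballI)
    fix a assume "a \<in> Ob (wide_sub C P)"
    then have a: "a \<in> Ob C" by (simp add: wide_sub_def)
    then show "?\<eta> a \<in> isos (wide_sub C P) a (S.obj (obj a))"
      using obj[OF a] S.obj[OF obj(1)[OF a]] RI by (intro S.comparison_isos[OF RP]) auto
  next
    fix a b f assume "a \<in> Ob (wide_sub C P)" "b \<in> Ob (wide_sub C P)" "f \<in> Hom (wide_sub C P) a b"
    then have *: "a \<in> Ob C" "b \<in> Ob C" "f \<in> Hom C a b" by (simp_all add: wide_sub_def)
    note o = obj[OF *(1)] obj[OF *(2)]
    note m = mate[OF *(1,2) o(1,3,2,4) *(3), folded mor_def]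
    note n = S.mate[OF o(1,3) S.obj(1)[OF o(1)] S.obj(1)[OF o(3)] S.obj(2)[OF o(1)] S.obj(2)[OF o(3)] m(1),
        folded S.mor_def]
    show "Comp (wide_sub C P) a (S.obj (obj a)) (S.obj (obj b)) (S.mor (obj a) (obj b) (mor a b f)) (?\<eta> a)
        = Comp (wide_sub C P) a b (S.obj (obj b)) (?\<eta> b) f"
      using S.comparison_natural[OF o(1,3) m(1) *(1) S.obj(1)[OF o(1)] o(2) S.obj(2)[OF o(1)]
          *(2) S.obj(1)[OF o(3)] o(4) S.obj(2)[OF o(3)] *(3) m(2) n]
      by (simp add: wide_sub_def)
  qed
  moreover have "natural_iso (wide_sub E R) (wide_sub E R) (\<lambda>x. obj (S.obj x))
      (\<lambda>x y g. mor (S.obj x) (S.obj y) (S.mor x y g)) (\<lambda>x. x) (\<lambda>x y g. g) ?\<epsilon>"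
    unfolding natural_iso_def
  proof (intro conjI ballI)
    fix x assume "x \<in> Ob (wide_sub E R)"
    then have x: "x \<in> Ob E" by (simp add: wide_sub_def)
    then show "?\<epsilon> x \<in> isos (wide_sub E R) (obj (S.obj x)) x"
      using S.obj[OF x] obj[OF S.obj(1)[OF x]] PI by (intro comparison_isos[OF PR]) auto
  next
    fix x y g assume "x \<in> Ob (wide_sub E R)" "y \<in> Ob (wide_sub E R)" "g \<in> Hom (wide_sub E R) x y"
    then have *: "x \<in> Ob E" "y \<in> Ob E" "g \<in> Hom E x y" by (simp_all add: wide_sub_def)
    note o = S.obj[OF *(1)] S.obj[OF *(2)]
    note m = S.mate[OF *(1,2) o(1,3,2,4) *(3), folded S.mor_def]
    note n = mate[OF o(1,3) obj(1)[OF o(1)] obj(1)[OF o(3)] obj(2)[OF o(1)] obj(2)[OF o(3)] m(1),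
        folded mor_def]
    show "Comp (wide_sub E R) (obj (S.obj x)) x y g (?\<epsilon> x)
        = Comp (wide_sub E R) (obj (S.obj x)) (obj (S.obj y)) y (?\<epsilon> y)
            (mor (S.obj x) (S.obj y) (S.mor x y g))"
      using comparison_natural[OF o(1,3) m(1) obj(1)[OF o(1)] *(1) obj(2)[OF o(1)] o(2)
          obj(1)[OF o(3)] *(2) obj(2)[OF o(3)] o(4) n *(3) m(2)]
      by (simp add: wide_sub_def)
  qed
  ultimately show ?thesis unfolding equivalent_def by (intro exI conjI)
qed

end


section \<open>Generalized boolean algebras\<close>

lemma partial_orderI:
  fixes M :: "'a gorder"
  assumes "eq M = (=)"
    and "\<And>x. x \<in> carrier M \<Longrightarrow> x \<sqsubseteq>\<^bsub>M\<^esub> x"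
    and "\<And>x y. \<lbrakk>x \<in> carrier M; y \<in> carrier M; x \<sqsubseteq>\<^bsub>M\<^esub> y; y \<sqsubseteq>\<^bsub>M\<^esub> x\<rbrakk> \<Longrightarrow> x = y"
    and tr: "\<And>x y z. \<lbrakk>x \<in> carrier M; y \<in> carrier M; z \<in> carrier M; x \<sqsubseteq>\<^bsub>M\<^esub> y; y \<sqsubseteq>\<^bsub>M\<^esub> z\<rbrakk> \<Longrightarrow> x \<sqsubseteq>\<^bsub>M\<^esub> z"
  shows "partial_order M"
proof unfold_locales
  fix x y z assume "x \<sqsubseteq>\<^bsub>M\<^esub> y" "y \<sqsubseteq>\<^bsub>M\<^esub> z" "x \<in> carrier M" "y \<in> carrier M" "z \<in> carrier M"
  then show "x \<sqsubseteq>\<^bsub>M\<^esub> z" using tr[of x y z] by simp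
qed (use assms(1-3) in simp_all)

text \<open>The operations of an abstract lattice are choices of bounds. Naming them as parameters lets
  concrete algebras be recognized by their known operations.\<close>

locale lattice_operations = partial_order M for M :: "'a gorder" (structure) +
  fixes m j :: "'a \<Rightarrow> 'a \<Rightarrow> 'a"
  assumes m: "\<lbrakk>x \<in> carrier M; y \<in> carrier M\<rbrakk> \<Longrightarrow> m x y \<in> carrier M \<and> m x y \<sqsubseteq> x \<and> m x y \<sqsubseteq> y"
    and m_greatest: "\<lbrakk>x \<in> carrier M; y \<in> carrier M; z \<in> carrier M; z \<sqsubseteq> x; z \<sqsubseteq> y\<rbrakk> \<Longrightarrow> z \<sqsubseteq> m x y"
    and j: "\<lbrakk>x \<in> carrier M; y \<in> carrier M\<rbrakk> \<Longrightarrow> j x y \<in> carrier M \<and> x \<sqsubseteq> j x y \<and> y \<sqsubseteq> j x y"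
    and j_least: "\<lbrakk>x \<in> carrier M; y \<in> carrier M; z \<in> carrier M; x \<sqsubseteq> z; y \<sqsubseteq> z\<rbrakk> \<Longrightarrow> j x y \<sqsubseteq> z"
begin

lemma glb: "\<lbrakk>x \<in> carrier M; y \<in> carrier M\<rbrakk> \<Longrightarrow> is_glb M (m x y) {x, y}"
  using m[of x y] m_greatest[of x y] by (auto simp: greatest_def Lower_def)

lemma lub: "\<lbrakk>x \<in> carrier M; y \<in> carrier M\<rbrakk> \<Longrightarrow> is_lub M (j x y) {x, y}"
  using j[of x y] j_least[of x y] by (auto simp: least_def Upper_def)

sublocale lattice M
  by unfold_locales (use glb lub in blast)+

lemma meet_eq: "\<lbrakk>x \<in> carrier M; y \<in> carrier M\<rbrakk> \<Longrightarrow> x \<sqinter> y = m x y"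
  unfolding meet_def by (rule greatest_unique[OF inf_of_two_greatest glb])

lemma join_eq: "\<lbrakk>x \<in> carrier M; y \<in> carrier M\<rbrakk> \<Longrightarrow> x \<squnion> y = j x y"
  unfolding join_def by (rule least_unique[OF sup_of_two_least lub])

text \<open>Complements in a generalized boolean algebra are computed in intervals. That these share the
  operations of the whole lattice lets complements pass from one to the other.\<close>

lemma interval:
  assumes "a \<in> carrier M" "b \<in> carrier M"
  shows "lattice_operations (M\<lparr>carrier := \<lbrace>a..b\<rbrace>\<rparr>) m j"
proof -
  let ?I = "M\<lparr>carrier := \<lbrace>a..b\<rbrace>\<rparr>"
  have "partial_order ?I"
  proof (rule partial_orderI)
    fix x y z assume "x \<in> carrier ?I" "y \<in> carrier ?I" "z \<in> carrier ?I" "x \<sqsubseteq>\<^bsub>?I\<^esub> y" "y \<sqsubseteq>\<^bsub>?I\<^esub> z"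
    then show "x \<sqsubseteq>\<^bsub>?I\<^esub> z" using le_trans[of x y z] by (simp add: at_least_at_most_def)
  qed (auto simp: eq_is_equal at_least_at_most_def)
  moreover have "a \<sqsubseteq> m x y \<and> m x y \<sqsubseteq> b \<and> a \<sqsubseteq> j x y \<and> j x y \<sqsubseteq> b"
    if "x \<in> carrier M" "y \<in> carrier M" "a \<sqsubseteq> x" "a \<sqsubseteq> y" "x \<sqsubseteq> b" "y \<sqsubseteq> b" for x y
    using le_trans[of "m x y" x b] le_trans[of a x "j x y"] m[of x y] j[of x y]
      m_greatest[of x y a] j_least[of x y b] that assms by simp
  ultimately show ?thesis
    unfolding lattice_operations_def lattice_operations_axioms_def
    using m j m_greatest j_least by (simp add: at_least_at_most_def)
qed

end

locale gba =
  fixes M :: "'a gorder" (structure)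
  assumes gba: "generalized_boolean_algebra M"

locale gba_operations = lattice_operations +
  fixes t
  assumes t: "t \<in> carrier M" "x \<in> carrier M \<Longrightarrow> x \<sqsubseteq> t"
    and m_j_distrib: "\<lbrakk>x \<in> carrier M; y \<in> carrier M; z \<in> carrier M\<rbrakk> \<Longrightarrow> m x (j y z) = j (m x y) (m x z)"
    and complement: "\<lbrakk>a \<in> carrier M; x \<in> carrier M; a \<sqsubseteq> x\<rbrakk> \<Longrightarrow> \<exists>y\<in>carrier M. m x y = a \<and> j x y = t"
begin

lemma greatest_t: "greatest M t (carrier M)"
  using t by (auto simp: greatest_def)

lemma top_eq: "\<top> = t"
  using greatest_t unfolding top_def by (metis (no_types, lifting) greatest_unique someI_ex)

lemma interval_boolean:
  assumes a: "a \<in> carrier M"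
  shows "boolean_lattice (M\<lparr>carrier := \<lbrace>a..t\<rbrace>\<rparr>)" (is "boolean_lattice ?I")
proof -
  interpret I: lattice_operations ?I m j by (rule interval[OF a t(1)])
  have sub: "carrier ?I \<subseteq> carrier M" by (auto simp: at_least_at_most_def)
  have aI: "least ?I a (carrier ?I)" and tI: "greatest ?I t (carrier ?I)"
    using a t by (auto simp: at_least_at_most_def least_def greatest_def)
  have bl: "bounded_lattice ?I" by unfold_locales (use aI tI in blast)+
  have bot: "\<bottom>\<^bsub>?I\<^esub> = a" and top: "\<top>\<^bsub>?I\<^esub> = t"
    using aI tI unfolding bottom_def top_def
    by (metis (no_types, lifting) I.least_unique someI_ex,
        metis (no_types, lifting) I.greatest_unique someI_ex)
  have "distributive_lattice ?I"
    unfolding distributive_lattice_def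
  proof (intro conjI ballI)
    fix x y z assume *: "x \<in> carrier ?I" "y \<in> carrier ?I" "z \<in> carrier ?I"
    then have c: "j y z \<in> carrier ?I" "m x y \<in> carrier ?I" "m x z \<in> carrier ?I"
      using I.j I.m by blast+
    show "x \<sqinter>\<^bsub>?I\<^esub> (y \<squnion>\<^bsub>?I\<^esub> z) = x \<sqinter>\<^bsub>?I\<^esub> y \<squnion>\<^bsub>?I\<^esub> (x \<sqinter>\<^bsub>?I\<^esub> z)"
      using m_j_distrib[of x y z] * sub
      unfolding I.join_eq[OF *(2,3)] I.meet_eq[OF *(1,2)] I.meet_eq[OF *(1,3)] I.meet_eq[OF *(1) c(1)]
        I.join_eq[OF c(2,3)] by blast
  qed (rule I.lattice_axioms)
  moreover have "\<exists>y\<in>carrier ?I. x \<sqinter>\<^bsub>?I\<^esub> y = \<bottom>\<^bsub>?I\<^esub> \<and> x \<squnion>\<^bsub>?I\<^esub> y = \<top>\<^bsub>?I\<^esub>" if x: "x \<in> carrier ?I" for x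
  proof -
    have xM: "x \<in> carrier M" "a \<sqsubseteq> x" using x by (auto simp: at_least_at_most_def)
    then obtain y where y: "y \<in> carrier M" "m x y = a" "j x y = t"
      using complement[OF a] by blast
    then have "y \<in> carrier ?I"
      using m[of x y] t xM by (simp add: at_least_at_most_def)
    then show ?thesis using x y I.meet_eq[of x y] I.join_eq[of x y] unfolding bot top by auto
  qed
  ultimately show ?thesis unfolding boolean_lattice_def using bl by blast
qed

lemma gba_axioms: "gba M"
proof
  have "distributive_lattice M"
    unfolding distributive_lattice_def
    using meet_eq join_eq m j m_j_distrib lattice_axioms by simp
  moreover have "weak_partial_order_top M"
    by unfold_locales (use greatest_t in blast)
  ultimately show "generalized_boolean_algebra M"
    unfolding generalized_boolean_algebra_def top_eq using interval_boolean by blast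
qed

end

sublocale gba \<subseteq> lattice M
  using gba by (simp add: generalized_boolean_algebra_def distributive_lattice_def)

sublocale gba \<subseteq> weak_partial_order_top M
  using gba by (simp add: generalized_boolean_algebra_def)

context gba
begin

lemma distrib:
  "\<lbrakk>x \<in> carrier M; y \<in> carrier M; z \<in> carrier M\<rbrakk> \<Longrightarrow> x \<sqinter> (y \<squnion> z) = (x \<sqinter> y) \<squnion> (x \<sqinter> z)"
  using gba by (simp add: generalized_boolean_algebra_def distributive_lattice_def)

lemma relative_complement:
  assumes a: "a \<in> carrier M" and x: "x \<in> carrier M" "a \<sqsubseteq> x"
  obtains y where "y \<in> carrier M" "x \<sqinter> y = a" "x \<squnion> y = \<top>"
proof -
  let ?I = "M\<lparr>carrier := \<lbrace>a..\<top>\<rbrace>\<rparr>"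
  interpret M: lattice_operations M "meet M" "join M"
    by unfold_locales (simp_all add: meet_left meet_right meet_le join_left join_right join_le)
  interpret O: lattice_operations ?I "meet M" "join M" by (rule M.interval[OF a top_closed])
  have B: "boolean_lattice ?I"
    using gba a unfolding generalized_boolean_algebra_def by blast
  interpret I: bounded_lattice ?I using B unfolding boolean_lattice_def by blast
  have xI: "x \<in> carrier ?I" using x by (auto simp: at_least_at_most_def)
  then obtain y where y: "y \<in> carrier ?I" "x \<sqinter>\<^bsub>?I\<^esub> y = \<bottom>\<^bsub>?I\<^esub>" "x \<squnion>\<^bsub>?I\<^esub> y = \<top>\<^bsub>?I\<^esub>"
    using B unfolding boolean_lattice_def by blast
  have "\<bottom>\<^bsub>?I\<^esub> = a"
    by (rule I.bottom_eq[symmetric]) (use a in \<open>auto simp: at_least_at_most_def\<close>)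
  moreover have "\<top>\<^bsub>?I\<^esub> = \<top>"
    by (rule I.top_eq[symmetric]) (use a in \<open>auto simp: at_least_at_most_def\<close>)
  moreover have "y \<in> carrier M" using y by (auto simp: at_least_at_most_def)
  ultimately show ?thesis using that[of y] y O.meet_eq[OF xI y(1)] O.join_eq[OF xI y(1)] by simp
qed

lemma meet_eqI:
  "\<lbrakk>x \<in> carrier M; y \<in> carrier M; z \<in> carrier M; z \<sqsubseteq> x; z \<sqsubseteq> y;
    \<And>w. \<lbrakk>w \<in> carrier M; w \<sqsubseteq> x; w \<sqsubseteq> y\<rbrakk> \<Longrightarrow> w \<sqsubseteq> z\<rbrakk> \<Longrightarrow> x \<sqinter> y = z"
  by (rule le_antisym) (simp_all add: meet_le meet_left meet_right)

lemma join_eqI: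
  "\<lbrakk>x \<in> carrier M; y \<in> carrier M; z \<in> carrier M; x \<sqsubseteq> z; y \<sqsubseteq> z;
    \<And>w. \<lbrakk>w \<in> carrier M; x \<sqsubseteq> w; y \<sqsubseteq> w\<rbrakk> \<Longrightarrow> z \<sqsubseteq> w\<rbrakk> \<Longrightarrow> x \<squnion> y = z"
  by (rule le_antisym) (simp_all add: join_le join_left join_right)

lemma meet_mono:
  "\<lbrakk>x \<in> carrier M; y \<in> carrier M; x' \<in> carrier M; y' \<in> carrier M; x \<sqsubseteq> x'; y \<sqsubseteq> y'\<rbrakk>
   \<Longrightarrow> x \<sqinter> y \<sqsubseteq> x' \<sqinter> y'"
  using le_trans[OF meet_left[of x y], of x'] le_trans[OF meet_right[of x y], of y']
  by (simp add: meet_le)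

lemma top_eqI: "\<lbrakk>t \<in> carrier M; \<And>x. x \<in> carrier M \<Longrightarrow> x \<sqsubseteq> t\<rbrakk> \<Longrightarrow> \<top> = t"
  by (rule le_antisym) auto

lemma le_iff_meet_eq: "\<lbrakk>x \<in> carrier M; y \<in> carrier M\<rbrakk> \<Longrightarrow> x \<sqsubseteq> y \<longleftrightarrow> x \<sqinter> y = x"
  using le_iff_join by metis

lemma has_bottom_iff:
  "weak_partial_order_bottom M \<longleftrightarrow> (\<exists>b\<in>carrier M. \<forall>x\<in>carrier M. b \<sqsubseteq> x)"
proof
  assume "weak_partial_order_bottom M"
  then interpret weak_partial_order_bottom M .
  show "\<exists>b\<in>carrier M. \<forall>x\<in>carrier M. b \<sqsubseteq> x" using bottom_closed bottom_lower by auto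
next
  assume "\<exists>b\<in>carrier M. \<forall>x\<in>carrier M. b \<sqsubseteq> x"
  then have "\<exists>b. least M b (carrier M)" by (auto simp: least_def)
  then show "weak_partial_order_bottom M" by unfold_locales
qed

lemma bottom_eqI:
  assumes "b \<in> carrier M" "\<And>x. x \<in> carrier M \<Longrightarrow> b \<sqsubseteq> x"
  shows "\<bottom> = b"
proof -
  interpret weak_partial_order_bottom M using assms has_bottom_iff by auto
  show ?thesis by (rule le_antisym) (simp_all add: assms)
qed

lemma inf_empty: "\<Sqinter>{} = \<top>"
  by (simp add: inf_def top_def)

lemma finite_inf:
  assumes "finite A" "A \<subseteq> carrier M"
  shows "is_glb M (\<Sqinter>A) A"
  using finite_inf_greatest[OF assms] top_greatest inf_empty by (cases "A = {}") auto

lemma finite_inf_insert: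
  assumes "finite A" "A \<subseteq> carrier M" "x \<in> carrier M"
  shows "\<Sqinter>insert x A = x \<sqinter> \<Sqinter>A"
proof -
  note A = finite_inf[OF assms(1,2)]
  have xA: "is_glb M (\<Sqinter>insert x A) (insert x A)" using finite_inf[of "insert x A"] assms by simp
  have c: "\<Sqinter>A \<in> carrier M" "\<Sqinter>insert x A \<in> carrier M" using A xA by auto
  show ?thesis
  proof (rule meet_eqI[symmetric])
    show "\<Sqinter>insert x A \<sqsubseteq> x" using greatest_Lower_below[OF xA, of x] assms by simp
    show "\<Sqinter>insert x A \<sqsubseteq> \<Sqinter>A"
      by (rule greatest_le[OF A]) (use greatest_Lower_below[OF xA] assms c in \<open>auto simp: Lower_def\<close>)
    fix w assume w: "w \<in> carrier M" "w \<sqsubseteq> x" "w \<sqsubseteq> \<Sqinter>A"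
    then have "w \<sqsubseteq> y" if "y \<in> A" for y
      using greatest_Lower_below[OF A that] assms(2) that le_trans[of w "\<Sqinter>A" y] c by blast
    then show "w \<sqsubseteq> \<Sqinter>insert x A"
      by (intro greatest_le[OF xA]) (use w in \<open>auto simp: Lower_def\<close>)
  qed (use c assms in auto)
qed

lemma finite_sup_insert:
  assumes "finite A" "A \<subseteq> carrier M" "A \<noteq> {}" "x \<in> carrier M"
  shows "\<Squnion>insert x A = x \<squnion> \<Squnion>A"
proof -
  note A = finite_sup_least[OF assms(1-3)]
  have xA: "is_lub M (\<Squnion>insert x A) (insert x A)"
    using finite_sup_least[of "insert x A"] assms by simp
  have c: "\<Squnion>A \<in> carrier M" "\<Squnion>insert x A \<in> carrier M" using A xA by auto
  show ?thesis
  proof (rule join_eqI[symmetric])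
    show "x \<sqsubseteq> \<Squnion>insert x A" using least_Upper_above[OF xA, of x] assms by simp
    show "\<Squnion>A \<sqsubseteq> \<Squnion>insert x A"
      by (rule least_le[OF A]) (use least_Upper_above[OF xA] assms c in \<open>auto simp: Upper_def\<close>)
    fix w assume w: "w \<in> carrier M" "x \<sqsubseteq> w" "\<Squnion>A \<sqsubseteq> w"
    then have "y \<sqsubseteq> w" if "y \<in> A" for y
      using least_Upper_above[OF A that] assms(2) that le_trans[of y "\<Squnion>A" w] c by blast
    then show "\<Squnion>insert x A \<sqsubseteq> w"
      by (intro least_le[OF xA]) (use w in \<open>auto simp: Upper_def\<close>)
  qed (use c assms in auto)
qed

end


section \<open>Morphisms of generalized boolean algebras\<close>

definition meet_hom :: "'a gorder \<Rightarrow> 'b gorder \<Rightarrow> ('a \<Rightarrow> 'b) \<Rightarrow> bool" where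
  "meet_hom M N h \<longleftrightarrow> h \<top>\<^bsub>M\<^esub> = \<top>\<^bsub>N\<^esub> \<and>
     (\<forall>x\<in>carrier M. \<forall>y\<in>carrier M. h (x \<sqinter>\<^bsub>M\<^esub> y) = h x \<sqinter>\<^bsub>N\<^esub> h y)"

definition lattice_hom :: "'a gorder \<Rightarrow> 'b gorder \<Rightarrow> ('a \<Rightarrow> 'b) \<Rightarrow> bool" where
  "lattice_hom M N h \<longleftrightarrow> meet_hom M N h \<and>
     (\<forall>x\<in>carrier M. \<forall>y\<in>carrier M. h (x \<squnion>\<^bsub>M\<^esub> y) = h x \<squnion>\<^bsub>N\<^esub> h y)"

definition coinitial_hom :: "'a gorder \<Rightarrow> 'b gorder \<Rightarrow> ('a \<Rightarrow> 'b) \<Rightarrow> bool" where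
  "coinitial_hom M N h \<longleftrightarrow> lattice_hom M N h \<and> (\<forall>x\<in>carrier N. \<exists>c\<in>carrier M. h c \<sqsubseteq>\<^bsub>N\<^esub> x)"

definition bounded_hom :: "'a gorder \<Rightarrow> 'b gorder \<Rightarrow> ('a \<Rightarrow> 'b) \<Rightarrow> bool" where
  "bounded_hom M N h \<longleftrightarrow>
     (weak_partial_order_bottom M \<and> weak_partial_order_bottom N \<longrightarrow> h \<bottom>\<^bsub>M\<^esub> = \<bottom>\<^bsub>N\<^esub>)"

locale gba_map = M: gba M + N: gba N for M N :: "'a gorder" +
  fixes h :: "'a \<Rightarrow> 'a"
  assumes closed: "h \<in> carrier M \<rightarrow> carrier N"
begin

lemma map_in [simp]: "x \<in> carrier M \<Longrightarrow> h x \<in> carrier N"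
  using closed by (rule funcset_mem)

lemma mono:
  assumes "meet_hom M N h" "x \<in> carrier M" "y \<in> carrier M" "x \<sqsubseteq>\<^bsub>M\<^esub> y"
  shows "h x \<sqsubseteq>\<^bsub>N\<^esub> h y"
proof -
  have "h (x \<sqinter>\<^bsub>M\<^esub> y) = h x \<sqinter>\<^bsub>N\<^esub> h y" using assms by (simp add: meet_hom_def)
  moreover have "x \<sqinter>\<^bsub>M\<^esub> y = x" using assms M.le_iff_meet_eq[of x y] by simp
  ultimately have "h x = h x \<sqinter>\<^bsub>N\<^esub> h y" by simp
  then show ?thesis using N.le_iff_join[of "h x" "h y"] assms by simp
qed

end

text \<open>Applied to two elements and the join of their images, the lifting of upper bounds says that
  the join is preserved; applied to the empty set it is coinitiality of the image. Conversely, once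
  some \<open>h c\<close> lies below a given upper bound, it stays below when elements are joined to \<open>c\<close>.\<close>

lemma (in gba_map) upper_bound_lifting_iff:
  assumes h: "meet_hom M N h"
  shows "(\<forall>S\<subseteq>carrier M. finite S \<longrightarrow> (\<forall>x\<in>Upper N (h ` S). \<exists>c\<in>Upper M S. h c \<sqsubseteq>\<^bsub>N\<^esub> x)) \<longleftrightarrow>
    coinitial_hom M N h" (is "?L \<longleftrightarrow> _")
proof
  assume L: ?L
  have "\<exists>c\<in>carrier M. h c \<sqsubseteq>\<^bsub>N\<^esub> x" if "x \<in> carrier N" for x
    using L[rule_format, of "{}"] that by simp
  moreover have "h (x \<squnion>\<^bsub>M\<^esub> y) = h x \<squnion>\<^bsub>N\<^esub> h y" if xy: "x \<in> carrier M" "y \<in> carrier M" for x y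
  proof (rule N.join_eqI[symmetric])
    fix w assume w: "w \<in> carrier N" "h x \<sqsubseteq>\<^bsub>N\<^esub> w" "h y \<sqsubseteq>\<^bsub>N\<^esub> w"
    then have "w \<in> Upper N (h ` {x, y})" by (auto simp: Upper_def)
    then have "\<exists>c\<in>Upper M {x, y}. h c \<sqsubseteq>\<^bsub>N\<^esub> w"
      using xy by (intro L[rule_format]) simp_all
    then obtain c where c: "c \<in> Upper M {x, y}" "h c \<sqsubseteq>\<^bsub>N\<^esub> w" by auto
    then have c': "c \<in> carrier M" "x \<sqsubseteq>\<^bsub>M\<^esub> c" "y \<sqsubseteq>\<^bsub>M\<^esub> c" using xy by (auto simp: Upper_def)
    then have "h (x \<squnion>\<^bsub>M\<^esub> y) \<sqsubseteq>\<^bsub>N\<^esub> h c" using xy by (simp add: mono[OF h] M.join_le)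
    then show "h (x \<squnion>\<^bsub>M\<^esub> y) \<sqsubseteq>\<^bsub>N\<^esub> w" using c c' w xy N.le_trans[of "h (x \<squnion>\<^bsub>M\<^esub> y)" "h c" w] by simp
  qed (use xy in \<open>simp_all add: mono[OF h] M.join_left M.join_right\<close>)
  ultimately show "coinitial_hom M N h" unfolding coinitial_hom_def lattice_hom_def using h by simp
next
  assume R: "coinitial_hom M N h"
  have "\<exists>c\<in>Upper M S. h c \<sqsubseteq>\<^bsub>N\<^esub> x" if "finite S" "S \<subseteq> carrier M" "x \<in> Upper N (h ` S)" for S x
    using that
  proof (induction S)
    case empty
    then show ?case using R unfolding coinitial_hom_def by simp
  next
    case (insert s S)
    then have "x \<in> Upper N (h ` S)" by (auto simp: Upper_def)
    then obtain c where c: "c \<in> Upper M S" "h c \<sqsubseteq>\<^bsub>N\<^esub> x" using insert by auto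
    have x: "x \<in> carrier N" "h s \<sqsubseteq>\<^bsub>N\<^esub> x" using insert.prems by (auto simp: Upper_def)
    have s: "s \<in> carrier M" "c \<in> carrier M" using insert.prems c by (auto simp: Upper_def)
    have "h (c \<squnion>\<^bsub>M\<^esub> s) = h c \<squnion>\<^bsub>N\<^esub> h s" using R s by (simp add: coinitial_hom_def lattice_hom_def)
    also have "\<dots> \<sqsubseteq>\<^bsub>N\<^esub> x" using c x s by (simp add: N.join_le)
    finally have 1: "h (c \<squnion>\<^bsub>M\<^esub> s) \<sqsubseteq>\<^bsub>N\<^esub> x" .
    have "y \<sqsubseteq>\<^bsub>M\<^esub> c \<squnion>\<^bsub>M\<^esub> s" if "y \<in> insert s S" for y
      using that insert.prems s c M.join_left[OF s(2,1)] M.join_right[OF s(2,1)]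
        M.le_trans[of y c "c \<squnion>\<^bsub>M\<^esub> s"] by (auto simp: Upper_def)
    then have "c \<squnion>\<^bsub>M\<^esub> s \<in> Upper M (insert s S)" using s by (auto simp: Upper_def)
    then show ?case using 1 by blast
  qed
  then show ?L by blast
qed

context gba_map
begin

lemma preserves_finite_meets_iff: "preserves_finite_meets M N h \<longleftrightarrow> meet_hom M N h"
proof
  assume "preserves_finite_meets M N h"
  then have *: "h (\<Sqinter>\<^bsub>M\<^esub>A) = \<Sqinter>\<^bsub>N\<^esub>(h ` A)" if "A \<subseteq> carrier M" "finite A" for A
    unfolding preserves_finite_meets_def using that by simp
  show "meet_hom M N h"
    using *[of "{}"] *[of "{_, _}"]
    unfolding meet_hom_def meet_def by (simp add: M.inf_empty N.inf_empty)
next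
  assume h: "meet_hom M N h"
  have "h (\<Sqinter>\<^bsub>M\<^esub>A) = \<Sqinter>\<^bsub>N\<^esub>(h ` A)" if "finite A" "A \<subseteq> carrier M" for A
    using that
  proof (induction A)
    case empty
    then show ?case using h by (simp add: M.inf_empty N.inf_empty meet_hom_def)
  next
    case (insert x A)
    then have "\<Sqinter>\<^bsub>M\<^esub>A \<in> carrier M" using M.finite_inf by auto
    with insert show ?case
      using h by (simp add: M.finite_inf_insert meet_hom_def) (subst N.finite_inf_insert, auto)
  qed
  then show "preserves_finite_meets M N h" unfolding preserves_finite_meets_def by simp
qed

lemma GBA_hom_iff:
  "preserves_finite_meets M N h \<and> preserves_nonempty_finite_joins M N h \<longleftrightarrow> lattice_hom M N h"
proof -
  have "preserves_nonempty_finite_joins M N h \<longleftrightarrow>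
    (\<forall>x\<in>carrier M. \<forall>y\<in>carrier M. h (x \<squnion>\<^bsub>M\<^esub> y) = h x \<squnion>\<^bsub>N\<^esub> h y)" (is "_ \<longleftrightarrow> ?R")
  proof
    assume "preserves_nonempty_finite_joins M N h"
    then have *: "h (\<Squnion>\<^bsub>M\<^esub>A) = \<Squnion>\<^bsub>N\<^esub>(h ` A)" if "A \<subseteq> carrier M" "finite A" "A \<noteq> {}" for A
      unfolding preserves_nonempty_finite_joins_def using that by simp
    show ?R using *[of "{_, _}"] unfolding join_def by simp
  next
    assume h: ?R
    have "h (\<Squnion>\<^bsub>M\<^esub>A) = \<Squnion>\<^bsub>N\<^esub>(h ` A)" if "finite A" "A \<noteq> {}" "A \<subseteq> carrier M" for A
      using that
    proof (induction A rule: finite_ne_induct)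
      case (insert x A)
      then have "\<Squnion>\<^bsub>M\<^esub>A \<in> carrier M" using M.finite_sup_closed by auto
      with insert show ?case
        using h by (simp add: M.finite_sup_insert) (subst N.finite_sup_insert, auto)
    qed simp
    then show "preserves_nonempty_finite_joins M N h"
      unfolding preserves_nonempty_finite_joins_def by simp
  qed
  then show ?thesis unfolding lattice_hom_def preserves_finite_meets_iff by simp
qed

lemma GBA_P_hom_iff:
  "preserves_finite_meets M N h \<and>
    (\<forall>S\<subseteq>carrier M. finite S \<longrightarrow> (\<forall>x\<in>Upper N (h ` S). \<exists>c\<in>Upper M S. h c \<sqsubseteq>\<^bsub>N\<^esub> x)) \<longleftrightarrow> coinitial_hom M N h"
  unfolding preserves_finite_meets_iff
  using upper_bound_lifting_iff by (auto simp: coinitial_hom_def lattice_hom_def)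

end

lemma lattice_hom_meet: "lattice_hom M N h \<Longrightarrow> meet_hom M N h"
  by (simp add: lattice_hom_def)

lemma coinitial_hom_lattice: "coinitial_hom M N h \<Longrightarrow> lattice_hom M N h"
  by (simp add: coinitial_hom_def)

context gba
begin

lemma meet_hom_id: "meet_hom M M (\<lambda>x\<in>carrier M. x)"
  by (simp add: meet_hom_def)

lemma lattice_hom_id: "lattice_hom M M (\<lambda>x\<in>carrier M. x)"
  by (simp add: lattice_hom_def meet_hom_id)

lemma coinitial_hom_id: "coinitial_hom M M (\<lambda>x\<in>carrier M. x)"
  unfolding coinitial_hom_def using lattice_hom_id by auto

lemma bounded_hom_id: "bounded_hom M M (\<lambda>x\<in>carrier M. x)"
  by (auto simp: bounded_hom_def weak_partial_order_bottom.bottom_closed)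

end

lemma
  assumes f: "gba_map M1 M2 f" and g: "gba_map M2 M3 g"
  shows meet_hom_compose: "\<lbrakk>meet_hom M1 M2 f; meet_hom M2 M3 g\<rbrakk> \<Longrightarrow> meet_hom M1 M3 (compose (carrier M1) g f)"
    and lattice_hom_compose: "\<lbrakk>lattice_hom M1 M2 f; lattice_hom M2 M3 g\<rbrakk>
      \<Longrightarrow> lattice_hom M1 M3 (compose (carrier M1) g f)"
    and coinitial_hom_compose: "\<lbrakk>coinitial_hom M1 M2 f; coinitial_hom M2 M3 g\<rbrakk>
      \<Longrightarrow> coinitial_hom M1 M3 (compose (carrier M1) g f)"
proof -
  interpret f: gba_map M1 M2 f by (rule f)
  interpret g: gba_map M2 M3 g by (rule g)
  show m: "meet_hom M1 M3 (compose (carrier M1) g f)" if "meet_hom M1 M2 f" "meet_hom M2 M3 g"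
    using that by (simp add: meet_hom_def compose_def)
  show l: "lattice_hom M1 M3 (compose (carrier M1) g f)" if "lattice_hom M1 M2 f" "lattice_hom M2 M3 g"
    using that m by (simp add: lattice_hom_def) (simp add: compose_def)
  show "coinitial_hom M1 M3 (compose (carrier M1) g f)"
    if h: "coinitial_hom M1 M2 f" "coinitial_hom M2 M3 g"
    unfolding coinitial_hom_def
  proof (intro conjI ballI)
    show "lattice_hom M1 M3 (compose (carrier M1) g f)" using l h by (simp add: coinitial_hom_def)
    fix x assume x: "x \<in> carrier M3"
    then obtain y where y: "y \<in> carrier M2" "g y \<sqsubseteq>\<^bsub>M3\<^esub> x" using h(2) by (auto simp: coinitial_hom_def)
    then obtain c where c: "c \<in> carrier M1" "f c \<sqsubseteq>\<^bsub>M2\<^esub> y" using h(1) by (auto simp: coinitial_hom_def)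
    have "g (f c) \<sqsubseteq>\<^bsub>M3\<^esub> g y"
      by (rule g.mono) (use h(2) c y in \<open>simp_all add: coinitial_hom_def lattice_hom_def\<close>)
    then have "g (f c) \<sqsubseteq>\<^bsub>M3\<^esub> x" using g.N.le_trans[OF _ y(2)] c y(1) x by simp
    then show "\<exists>c\<in>carrier M1. compose (carrier M1) g f c \<sqsubseteq>\<^bsub>M3\<^esub> x"
      using c by (intro bexI[of _ c]) (simp_all add: compose_def)
  qed
qed


section \<open>Transfer along isomorphisms between algebras on different types\<close>

definition order_iso :: "'a gorder \<Rightarrow> 'b gorder \<Rightarrow> ('a \<Rightarrow> 'b) \<Rightarrow> bool" where
  "order_iso M N \<phi> \<longleftrightarrow> bij_betw \<phi> (carrier M) (carrier N) \<and>
     (\<forall>x\<in>carrier M. \<forall>y\<in>carrier M. \<phi> x \<sqsubseteq>\<^bsub>N\<^esub> \<phi> y \<longleftrightarrow> x \<sqsubseteq>\<^bsub>M\<^esub> y)"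

lemma order_iso_in: "order_iso M N \<phi> \<Longrightarrow> x \<in> carrier M \<Longrightarrow> \<phi> x \<in> carrier N"
  by (auto simp: order_iso_def bij_betw_def)

lemma order_iso_le:
  "\<lbrakk>order_iso M N \<phi>; x \<in> carrier M; y \<in> carrier M\<rbrakk> \<Longrightarrow> \<phi> x \<sqsubseteq>\<^bsub>N\<^esub> \<phi> y \<longleftrightarrow> x \<sqsubseteq>\<^bsub>M\<^esub> y"
  by (simp add: order_iso_def)

lemma order_iso_eq:
  "\<lbrakk>order_iso M N \<phi>; x \<in> carrier M; y \<in> carrier M\<rbrakk> \<Longrightarrow> \<phi> x = \<phi> y \<longleftrightarrow> x = y"
  by (auto simp: order_iso_def bij_betw_def dest: inj_onD)

lemma order_iso_image: "order_iso M N \<phi> \<Longrightarrow> carrier N = \<phi> ` carrier M"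
  by (simp add: order_iso_def bij_betw_def)

lemma order_iso_surj:
  assumes "order_iso M N \<phi>" "y \<in> carrier N"
  obtains x where "x \<in> carrier M" "y = \<phi> x"
  using assms(2) unfolding order_iso_image[OF assms(1)] by auto

lemma order_iso_inv:
  assumes "order_iso M N \<phi>"
  shows "order_iso N M (inv_into (carrier M) \<phi>)"
  unfolding order_iso_def
proof (intro conjI ballI)
  have b: "bij_betw \<phi> (carrier M) (carrier N)" using assms by (simp add: order_iso_def)
  then show "bij_betw (inv_into (carrier M) \<phi>) (carrier N) (carrier M)" by (rule bij_betw_inv_into)
  fix x y assume "x \<in> carrier N" "y \<in> carrier N"
  then show "inv_into (carrier M) \<phi> x \<sqsubseteq>\<^bsub>M\<^esub> inv_into (carrier M) \<phi> y \<longleftrightarrow> x \<sqsubseteq>\<^bsub>N\<^esub> y"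
    using order_iso_le[OF assms, of "inv_into (carrier M) \<phi> x" "inv_into (carrier M) \<phi> y"]
    by (simp add: bij_betw_inv_into_right[OF b] bij_betwE[OF bij_betw_inv_into[OF b]])
qed

lemma order_iso_comp:
  assumes "order_iso M N \<phi>" "order_iso N K \<psi>"
  shows "order_iso M K (\<psi> \<circ> \<phi>)"
  unfolding order_iso_def
proof (intro conjI ballI)
  show "bij_betw (\<psi> \<circ> \<phi>) (carrier M) (carrier K)"
    using assms by (auto simp: order_iso_def intro: bij_betw_trans)
qed (simp add: order_iso_le[OF assms(2)] order_iso_le[OF assms(1)] order_iso_in[OF assms(1)])

locale gba_iso = M: gba M + N: gba N for M :: "'a gorder" and N :: "'b gorder" +
  fixes \<phi>
  assumes iso: "order_iso M N \<phi>"
begin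

lemmas [simp] = order_iso_in[OF iso] order_iso_le[OF iso] order_iso_eq[OF iso]

lemma map_top: "\<phi> \<top>\<^bsub>M\<^esub> = \<top>\<^bsub>N\<^esub>"
  by (rule N.top_eqI[symmetric]) (auto elim: order_iso_surj[OF iso])

lemma map_meet:
  assumes "x \<in> carrier M" "y \<in> carrier M"
  shows "\<phi> (x \<sqinter>\<^bsub>M\<^esub> y) = \<phi> x \<sqinter>\<^bsub>N\<^esub> \<phi> y"
proof (rule N.meet_eqI[symmetric])
  fix w assume "w \<in> carrier N" "w \<sqsubseteq>\<^bsub>N\<^esub> \<phi> x" "w \<sqsubseteq>\<^bsub>N\<^esub> \<phi> y"
  moreover from this(1) obtain u where "u \<in> carrier M" "w = \<phi> u" by (rule order_iso_surj[OF iso])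
  ultimately show "w \<sqsubseteq>\<^bsub>N\<^esub> \<phi> (x \<sqinter>\<^bsub>M\<^esub> y)" using assms by (simp add: M.meet_le)
qed (use assms in \<open>simp_all add: M.meet_left M.meet_right\<close>)

lemma map_join:
  assumes "x \<in> carrier M" "y \<in> carrier M"
  shows "\<phi> (x \<squnion>\<^bsub>M\<^esub> y) = \<phi> x \<squnion>\<^bsub>N\<^esub> \<phi> y"
proof (rule N.join_eqI[symmetric])
  fix w assume "w \<in> carrier N" "\<phi> x \<sqsubseteq>\<^bsub>N\<^esub> w" "\<phi> y \<sqsubseteq>\<^bsub>N\<^esub> w"
  moreover from this(1) obtain u where "u \<in> carrier M" "w = \<phi> u" by (rule order_iso_surj[OF iso])
  ultimately show "\<phi> (x \<squnion>\<^bsub>M\<^esub> y) \<sqsubseteq>\<^bsub>N\<^esub> w" using assms by (simp add: M.join_le)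
qed (use assms in \<open>simp_all add: M.join_left M.join_right\<close>)

lemma has_bottom: "weak_partial_order_bottom N \<longleftrightarrow> weak_partial_order_bottom M"
  unfolding M.has_bottom_iff N.has_bottom_iff order_iso_image[OF iso] by simp

lemma map_bottom:
  assumes "weak_partial_order_bottom M"
  shows "\<phi> \<bottom>\<^bsub>M\<^esub> = \<bottom>\<^bsub>N\<^esub>"
proof -
  interpret weak_partial_order_bottom M by (rule assms)
  show ?thesis
    by (rule N.bottom_eqI[symmetric]) (auto simp: order_iso_image[OF iso])
qed

end

text \<open>The maps \<open>h\<close> and \<open>g\<close> are the same up to the identification of the algebras, so they have the same
  order-theoretic properties. This is how morphisms over algebras on different types are compared.\<close>

locale iso_square = w: gba_iso M1 N1 w + v: gba_iso M2 N2 v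
  for M1 M2 :: "'a gorder" and N1 N2 :: "'b gorder" and w v +
  fixes h :: "'a \<Rightarrow> 'a" and g :: "'b \<Rightarrow> 'b"
  assumes h: "h \<in> carrier M1 \<rightarrow> carrier M2" and g: "g \<in> carrier N1 \<rightarrow> carrier N2"
    and square: "k \<in> carrier M1 \<Longrightarrow> g (w k) = v (h k)"
begin

interpretation h: gba_map M1 M2 h by unfold_locales (rule h)

interpretation g: gba_map N1 N2 g by unfold_locales (rule g)

lemma meet_hom_iff: "meet_hom M1 M2 h \<longleftrightarrow> meet_hom N1 N2 g"
proof -
  have "g (w x \<sqinter>\<^bsub>N1\<^esub> w y) = g (w x) \<sqinter>\<^bsub>N2\<^esub> g (w y) \<longleftrightarrow> h (x \<sqinter>\<^bsub>M1\<^esub> y) = h x \<sqinter>\<^bsub>M2\<^esub> h y"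
    if "x \<in> carrier M1" "y \<in> carrier M1" for x y
    using that by (simp add: square flip: w.map_meet v.map_meet)
  then show ?thesis
    unfolding meet_hom_def order_iso_image[OF w.iso] by (simp add: square flip: w.map_top v.map_top)
qed

lemma preserves_finite_meets_iff: "preserves_finite_meets M1 M2 h \<longleftrightarrow> preserves_finite_meets N1 N2 g"
  by (simp add: h.preserves_finite_meets_iff g.preserves_finite_meets_iff meet_hom_iff)

lemma lattice_hom_iff: "lattice_hom M1 M2 h \<longleftrightarrow> lattice_hom N1 N2 g"
proof -
  have "g (w x \<squnion>\<^bsub>N1\<^esub> w y) = g (w x) \<squnion>\<^bsub>N2\<^esub> g (w y) \<longleftrightarrow> h (x \<squnion>\<^bsub>M1\<^esub> y) = h x \<squnion>\<^bsub>M2\<^esub> h y"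
    if "x \<in> carrier M1" "y \<in> carrier M1" for x y
    using that by (simp add: square flip: w.map_join v.map_join)
  then show ?thesis
    unfolding lattice_hom_def meet_hom_iff order_iso_image[OF w.iso] by simp
qed

lemma coinitial_hom_iff: "coinitial_hom M1 M2 h \<longleftrightarrow> coinitial_hom N1 N2 g"
  unfolding coinitial_hom_def lattice_hom_iff order_iso_image[OF w.iso] order_iso_image[OF v.iso]
  by (simp add: square)

lemma bounded_hom_iff: "bounded_hom M1 M2 h \<longleftrightarrow> bounded_hom N1 N2 g"
proof (cases "weak_partial_order_bottom M1 \<and> weak_partial_order_bottom M2")
  case True
  then interpret m1: weak_partial_order_bottom M1 by simp
  interpret m2: weak_partial_order_bottom M2 using True by simp
  show ?thesis
    unfolding bounded_hom_def w.has_bottom v.has_bottom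
    using True by (simp add: square flip: w.map_bottom v.map_bottom)
next
  case False
  then show ?thesis unfolding bounded_hom_def w.has_bottom v.has_bottom by auto
qed

end

text \<open>The algebra of a frame lives on the carrier type of frames and has to be moved to the type
  of the algebras that the frames are compared with.\<close>

lemma gba_copy:
  fixes M :: "'a gorder" and e :: "'a \<Rightarrow> 'b"
  assumes "gba M" and e: "inj_on e (carrier M)"
  obtains N :: "'b gorder" where "gba N" "order_iso M N e" "carrier N = e ` carrier M"
proof -
  interpret M: gba M by (rule assms(1))
  define d where "d = inv_into (carrier M) e"
  have d [simp]: "x \<in> carrier M \<Longrightarrow> d (e x) = x" for x unfolding d_def using e by simp
  define N :: "'b gorder" where
    "N = \<lparr>carrier = e ` carrier M, eq = (=), le = (\<lambda>x y. d x \<sqsubseteq>\<^bsub>M\<^esub> d y)\<rparr>"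
  have "partial_order N"
  proof (rule partial_orderI)
    fix x y z
    assume "x \<in> carrier N" "y \<in> carrier N" "z \<in> carrier N" "x \<sqsubseteq>\<^bsub>N\<^esub> y" "y \<sqsubseteq>\<^bsub>N\<^esub> z"
    then show "x \<sqsubseteq>\<^bsub>N\<^esub> z" using M.le_trans[of "d x" "d y" "d z"] by (auto simp: N_def)
  next
    fix x y
    assume "x \<in> carrier N" "y \<in> carrier N" "x \<sqsubseteq>\<^bsub>N\<^esub> y" "y \<sqsubseteq>\<^bsub>N\<^esub> x"
    then show "x = y" using M.le_antisym[of "d x" "d y"] by (auto simp: N_def)
  qed (auto simp: N_def)
  then interpret N: partial_order N .
  interpret N: gba_operations N "\<lambda>x y. e (d x \<sqinter>\<^bsub>M\<^esub> d y)" "\<lambda>x y. e (d x \<squnion>\<^bsub>M\<^esub> d y)" "e \<top>\<^bsub>M\<^esub>"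
  proof
    fix a x assume "a \<in> carrier N" "x \<in> carrier N" "a \<sqsubseteq>\<^bsub>N\<^esub> x"
    then obtain a' x' where *: "a' \<in> carrier M" "x' \<in> carrier M" "a = e a'" "x = e x'" "a' \<sqsubseteq>\<^bsub>M\<^esub> x'"
      by (auto simp: N_def)
    then obtain y' where "y' \<in> carrier M" "x' \<sqinter>\<^bsub>M\<^esub> y' = a'" "x' \<squnion>\<^bsub>M\<^esub> y' = \<top>\<^bsub>M\<^esub>"
      using M.relative_complement[of a' x'] by auto
    then show "\<exists>y\<in>carrier N. e (d x \<sqinter>\<^bsub>M\<^esub> d y) = a \<and> e (d x \<squnion>\<^bsub>M\<^esub> d y) = e \<top>\<^bsub>M\<^esub>"
      using * by (intro bexI[of _ "e y'"]) (auto simp: N_def)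
  qed (auto simp: N_def M.distrib M.meet_left M.meet_right M.meet_le M.join_left M.join_right M.join_le)
  have "order_iso M N e"
    using e by (simp add: order_iso_def N_def bij_betw_def)
  then show ?thesis using that[OF N.gba_axioms] by (simp add: N_def)
qed


section \<open>Categories lying fully faithfully over algebras\<close>

text \<open>A fully faithful functor to the algebras with the maps satisfying \<open>Q\<close> as morphisms. The target
  stays implicit, as only the represented maps matter.\<close>

locale representation =
  fixes C :: "('o, 'm) precategory" and Q :: "'u gorder \<Rightarrow> 'u gorder \<Rightarrow> ('u \<Rightarrow> 'u) \<Rightarrow> bool"
    and Fo :: "'o \<Rightarrow> 'u gorder" and Fm :: "'o \<Rightarrow> 'o \<Rightarrow> 'm \<Rightarrow> 'u \<Rightarrow> 'u"
  assumes gba: "a \<in> Ob C \<Longrightarrow> gba (Fo a)"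
    and map: "\<lbrakk>a \<in> Ob C; b \<in> Ob C; f \<in> Hom C a b\<rbrakk> \<Longrightarrow> Fm a b f \<in> carrier (Fo a) \<rightarrow>\<^sub>E carrier (Fo b)"
    and hom: "\<lbrakk>a \<in> Ob C; b \<in> Ob C; f \<in> Hom C a b\<rbrakk> \<Longrightarrow> Q (Fo a) (Fo b) (Fm a b f)"
    and full: "\<lbrakk>a \<in> Ob C; b \<in> Ob C; h \<in> carrier (Fo a) \<rightarrow>\<^sub>E carrier (Fo b); Q (Fo a) (Fo b) h\<rbrakk>
      \<Longrightarrow> \<exists>f\<in>Hom C a b. Fm a b f = h"
    and faithful: "\<lbrakk>a \<in> Ob C; b \<in> Ob C; f \<in> Hom C a b; g \<in> Hom C a b; Fm a b f = Fm a b g\<rbrakk> \<Longrightarrow> f = g"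
    and Idm: "a \<in> Ob C \<Longrightarrow> Fm a a (Idm C a) = (\<lambda>x\<in>carrier (Fo a). x)"
    and Comp: "\<lbrakk>a \<in> Ob C; b \<in> Ob C; c \<in> Ob C; f \<in> Hom C a b; g \<in> Hom C b c\<rbrakk>
      \<Longrightarrow> Fm a c (Comp C a b c g f) = compose (carrier (Fo a)) (Fm b c g) (Fm a b f)"
begin

lemma map_fun: "\<lbrakk>a \<in> Ob C; b \<in> Ob C; f \<in> Hom C a b\<rbrakk> \<Longrightarrow> Fm a b f \<in> carrier (Fo a) \<rightarrow> carrier (Fo b)"
  using map by (simp add: PiE_def)

lemma gba_map: "\<lbrakk>a \<in> Ob C; b \<in> Ob C; f \<in> Hom C a b\<rbrakk> \<Longrightarrow> gba_map (Fo a) (Fo b) (Fm a b f)"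
  by (simp add: gba_map_def gba_map_axioms_def gba map_fun)

text \<open>The laws of a category hold for the represented maps and are reflected by faithfulness.\<close>

lemma category:
  assumes Id: "\<And>a. a \<in> Ob C \<Longrightarrow> Idm C a \<in> Hom C a a"
    and Co: "\<And>a b c f g. \<lbrakk>a \<in> Ob C; b \<in> Ob C; c \<in> Ob C; f \<in> Hom C a b; g \<in> Hom C b c\<rbrakk>
           \<Longrightarrow> Comp C a b c g f \<in> Hom C a c"
  shows "category C"
  unfolding category_def
proof (intro conjI ballI)
  fix a b f assume *: "a \<in> Ob C" "b \<in> Ob C" "f \<in> Hom C a b"
  have "Fm a b f \<in> extensional (carrier (Fo a))" using map[OF *] by (simp add: PiE_def)
  then show "Comp C a a b f (Idm C a) = f" "Comp C a b b (Idm C b) f = f"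
    using * compose_Id[OF map_fun[OF *]] Id_compose[OF map_fun[OF *]]
    by (auto intro!: faithful[of a b] simp: Id Co Comp Idm)
next
  fix a b c d f g h
  assume *: "a \<in> Ob C" "b \<in> Ob C" "c \<in> Ob C" "d \<in> Ob C" "f \<in> Hom C a b" "g \<in> Hom C b c" "h \<in> Hom C c d"
  then show "Comp C a b d (Comp C b c d h g) f = Comp C a c d h (Comp C a b c g f)"
    by (intro faithful[of a d]) (simp_all add: Co Comp compose_assoc[OF map_fun[OF *(1,2,5)]])
qed (use Id Co in auto)

lemma full_sub: "representation (full_sub C P) Q Fo Fm"
proof (rule representation.intro)
  fix a b f g
  assume "a \<in> Ob (full_sub C P)" "b \<in> Ob (full_sub C P)" "f \<in> Hom (full_sub C P) a b"
    "g \<in> Hom (full_sub C P) a b" "Fm a b f = Fm a b g"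
  then show "f = g" using faithful[of a b f g] by (simp add: full_sub_def)
qed (simp_all add: full_sub_def gba map hom full Idm Comp)

end

text \<open>The closure conditions under which algebras and the maps satisfying \<open>Q\<close> form a category.\<close>

definition hom_class :: "('a gorder \<Rightarrow> 'a gorder \<Rightarrow> ('a \<Rightarrow> 'a) \<Rightarrow> bool) \<Rightarrow> bool" where
  "hom_class Q \<longleftrightarrow> (\<forall>M. gba M \<longrightarrow> Q M M (\<lambda>x\<in>carrier M. x)) \<and>
     (\<forall>M1 M2 M3 f g. gba_map M1 M2 f \<longrightarrow> gba_map M2 M3 g \<longrightarrow> Q M1 M2 f \<longrightarrow> Q M2 M3 g \<longrightarrow>
        Q M1 M3 (compose (carrier M1) g f))"

lemma hom_class_lattice_hom: "hom_class lattice_hom"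
  by (simp add: hom_class_def gba.lattice_hom_id lattice_hom_compose)

lemma hom_class_coinitial_hom: "hom_class coinitial_hom"
  by (simp add: hom_class_def gba.coinitial_hom_id coinitial_hom_compose)

text \<open>Closure of a substructure under identities and composition is inherited from the class of
  homomorphisms that describes it.\<close>

lemma representation_sub:
  assumes "representation C Q Fo Fm" and catC: "category C" and Q': "hom_class Q'"
    and eq: "Ob C' = Ob C" "Idm C' = Idm C" "Comp C' = Comp C"
    and Hom: "\<And>a b f. \<lbrakk>a \<in> Ob C; b \<in> Ob C\<rbrakk> \<Longrightarrow> f \<in> Hom C' a b \<longleftrightarrow> f \<in> Hom C a b \<and> P a b f"
    and P: "\<And>a b f. \<lbrakk>a \<in> Ob C; b \<in> Ob C; f \<in> Hom C a b\<rbrakk> \<Longrightarrow> P a b f \<longleftrightarrow> Q' (Fo a) (Fo b) (Fm a b f)"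
    and Q: "\<And>M N h. gba_map M N h \<Longrightarrow> Q' M N h \<Longrightarrow> Q M N h"
  shows "category C' \<and> representation C' Q' Fo Fm"
proof
  interpret F: representation C Q Fo Fm by (rule assms(1))
  interpret F': representation C' Q' Fo Fm
  proof (rule representation.intro)
    fix a b f assume "a \<in> Ob C'" "b \<in> Ob C'" "f \<in> Hom C' a b"
    then show "Q' (Fo a) (Fo b) (Fm a b f)" using Hom[of a b f] P[of a b f] by (simp add: eq)
  next
    fix a b h assume *: "a \<in> Ob C'" "b \<in> Ob C'" "h \<in> carrier (Fo a) \<rightarrow>\<^sub>E carrier (Fo b)" "Q' (Fo a) (Fo b) h"
    then have "gba_map (Fo a) (Fo b) h"
      by (simp add: gba_map_def gba_map_axioms_def F.gba eq PiE_def)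
    then have "\<exists>f\<in>Hom C a b. Fm a b f = h" using * Q by (intro F.full) (simp_all add: eq)
    then show "\<exists>f\<in>Hom C' a b. Fm a b f = h" using * Hom P by (auto simp: eq)
  next
    fix a b f g assume "a \<in> Ob C'" "b \<in> Ob C'" "f \<in> Hom C' a b" "g \<in> Hom C' a b" "Fm a b f = Fm a b g"
    then show "f = g" using Hom by (intro F.faithful[of a b]) (simp_all add: eq)
  qed (simp_all add: eq Hom P F.gba F.map F.Idm F.Comp)
  show "representation C' Q' Fo Fm" by unfold_locales
  show "category C'"
  proof (rule F'.category)
    fix a assume "a \<in> Ob C'"
    then have a: "a \<in> Ob C" by (simp add: eq)
    have "Q' (Fo a) (Fo a) (Fm a a (Idm C a))"
      using Q' F.gba[OF a] by (simp add: F.Idm[OF a] hom_class_def)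
    then show "Idm C' a \<in> Hom C' a a"
      using Idm_in_Hom[OF catC a] Hom[OF a a] P[OF a a] by (simp add: eq)
  next
    fix a b c f g assume *: "a \<in> Ob C'" "b \<in> Ob C'" "c \<in> Ob C'" "f \<in> Hom C' a b" "g \<in> Hom C' b c"
    then have o: "a \<in> Ob C" "b \<in> Ob C" "c \<in> Ob C" by (simp_all add: eq)
    have fg: "f \<in> Hom C a b" "g \<in> Hom C b c" using * Hom o by simp_all
    have "Q' (Fo a) (Fo c) (compose (carrier (Fo a)) (Fm b c g) (Fm a b f))"
      using Q' F.gba_map[OF o(1,2) fg(1)] F.gba_map[OF o(2,3) fg(2)] F'.hom[OF *(1,2,4)] F'.hom[OF *(2,3,5)]
      by (simp add: hom_class_def)
    then show "Comp C' a b c g f \<in> Hom C' a c"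
      using Hom[OF o(1,3)] Comp_in_Hom[OF catC o fg] P[OF o(1,3)] by (simp add: eq F.Comp[OF o fg])
  qed
qed

text \<open>A missing side of a square is found by going around it.\<close>

lemma iso_square_mate:
  assumes "gba_iso M1 N1 w" "gba_iso M2 N2 v" and h: "h \<in> carrier M1 \<rightarrow> carrier M2"
  obtains g where "g \<in> carrier N1 \<rightarrow>\<^sub>E carrier N2" "iso_square M1 M2 N1 N2 w v h g"
proof
  interpret w: gba_iso M1 N1 w by fact
  interpret v: gba_iso M2 N2 v by fact
  have b: "bij_betw w (carrier M1) (carrier N1)" using w.iso by (simp add: order_iso_def)
  let ?g = "\<lambda>z\<in>carrier N1. v (h (inv_into (carrier M1) w z))"
  show g: "?g \<in> carrier N1 \<rightarrow>\<^sub>E carrier N2"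
    using funcset_mem[OF h] bij_betwE[OF bij_betw_inv_into[OF b]] by simp
  show "iso_square M1 M2 N1 N2 w v h ?g"
    by unfold_locales (use h g in \<open>auto simp: bij_betw_inv_into_left[OF b]\<close>)
qed

lemma iso_square_comate:
  assumes "gba_iso M1 N1 w" "gba_iso M2 N2 v" and g: "g \<in> carrier N1 \<rightarrow> carrier N2"
  obtains h where "h \<in> carrier M1 \<rightarrow>\<^sub>E carrier M2" "iso_square M1 M2 N1 N2 w v h g"
proof
  interpret w: gba_iso M1 N1 w by fact
  interpret v: gba_iso M2 N2 v by fact
  have b: "bij_betw v (carrier M2) (carrier N2)" using v.iso by (simp add: order_iso_def)
  let ?h = "\<lambda>z\<in>carrier M1. inv_into (carrier M2) v (g (w z))"
  show h: "?h \<in> carrier M1 \<rightarrow>\<^sub>E carrier M2"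
    using funcset_mem[OF g] bij_betwE[OF bij_betw_inv_into[OF b]] by simp
  show "iso_square M1 M2 N1 N2 w v ?h g"
    by unfold_locales (use h g funcset_mem[OF g] in \<open>auto simp: bij_betw_inv_into_right[OF b]\<close>)
qed

text \<open>
  Isomorphisms of represented algebras are the witnesses of a bridge, and its mates are the
  morphisms whose represented maps form a square with them. That mates exist is fullness, that they
  are unique is faithfulness. The predicates \<open>B\<close> and \<open>B'\<close> describe the substructures by the
  represented maps.
\<close>

theorem equivalent_over_algebras:
  assumes catC: "category C" and catE: "category E"
    and "representation C Q Fo Fm" and "representation E Q' Ho Hm"
    and exE: "\<And>a. a \<in> Ob C \<Longrightarrow> \<exists>x\<in>Ob E. \<exists>w. order_iso (Fo a) (Ho x) w"
    and exC: "\<And>x. x \<in> Ob E \<Longrightarrow> \<exists>a\<in>Ob C. \<exists>w. order_iso (Fo a) (Ho x) w"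
    and Q: "\<And>M1 M2 N1 N2 w v h g. iso_square M1 M2 N1 N2 w v h g \<Longrightarrow> Q M1 M2 h \<longleftrightarrow> Q' N1 N2 g"
    and P: "\<And>a b f. \<lbrakk>a \<in> Ob C; b \<in> Ob C; f \<in> Hom C a b\<rbrakk> \<Longrightarrow> P a b f \<longleftrightarrow> B (Fo a) (Fo b) (Fm a b f)"
    and R: "\<And>x y g. \<lbrakk>x \<in> Ob E; y \<in> Ob E; g \<in> Hom E x y\<rbrakk> \<Longrightarrow> R x y g \<longleftrightarrow> B' (Ho x) (Ho y) (Hm x y g)"
    and B: "\<And>M1 M2 N1 N2 w v h g. iso_square M1 M2 N1 N2 w v h g \<Longrightarrow> B M1 M2 h \<longleftrightarrow> B' N1 N2 g"
    and BI: "\<And>N. gba N \<Longrightarrow> B' N N (\<lambda>x\<in>carrier N. x)"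
  shows "equivalent (wide_sub C P) (wide_sub E R)"
proof -
  interpret F: representation C Q Fo Fm by fact
  interpret H: representation E Q' Ho Hm by fact
  define W where "W = (\<lambda>a x w. order_iso (Fo a) (Ho x) w)"
  define M where "M = (\<lambda>a b x y w v f g. \<forall>k\<in>carrier (Fo a). Hm x y g (w k) = v (Fm a b f k))"
  have iso: "gba_iso (Fo a) (Ho x) w" if "a \<in> Ob C" "x \<in> Ob E" "W a x w" for a x w
    using that by (simp add: gba_iso_def gba_iso_axioms_def F.gba H.gba W_def)
  have sq: "iso_square (Fo a) (Fo b) (Ho x) (Ho y) w v (Fm a b f) (Hm x y g)"
    if "a \<in> Ob C" "b \<in> Ob C" "x \<in> Ob E" "y \<in> Ob E" "W a x w" "W b y v"
      "f \<in> Hom C a b" "g \<in> Hom E x y" "M a b x y w v f g" for a b x y w v f g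
    using that by (simp add: iso_square_def iso_square_axioms_def iso F.map_fun H.map_fun M_def)
  interpret bridge C E W M
  proof
    fix a b x y w v f
    assume *: "a \<in> Ob C" "b \<in> Ob C" "x \<in> Ob E" "y \<in> Ob E" "W a x w" "W b y v" "f \<in> Hom C a b"
    note wv = *(5,6)[unfolded W_def]
    obtain g' where g': "g' \<in> carrier (Ho x) \<rightarrow>\<^sub>E carrier (Ho y)"
      "iso_square (Fo a) (Fo b) (Ho x) (Ho y) w v (Fm a b f) g'"
      by (rule iso_square_mate[OF iso[OF *(1,3,5)] iso[OF *(2,4,6)] F.map_fun[OF *(1,2,7)]])
    obtain g where g: "g \<in> Hom E x y" "Hm x y g = g'"
      using H.full[OF *(3,4) g'(1)] Q[OF g'(2)] F.hom[OF *(1,2,7)] by auto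
    show "\<exists>!g. g \<in> Hom E x y \<and> M a b x y w v f g"
    proof (rule ex1I)
      show "g \<in> Hom E x y \<and> M a b x y w v f g"
        using g iso_square.square[OF g'(2)] by (simp add: M_def)
      fix k assume k: "k \<in> Hom E x y \<and> M a b x y w v f k"
      have "Hm x y k = Hm x y g"
      proof (rule PiE_ext)
        show "Hm x y k \<in> carrier (Ho x) \<rightarrow>\<^sub>E carrier (Ho y)" "Hm x y g \<in> carrier (Ho x) \<rightarrow>\<^sub>E carrier (Ho y)"
          using H.map[OF *(3,4), of k] H.map[OF *(3,4), of g] k g(1) by simp_all
        fix z assume "z \<in> carrier (Ho x)"
        then obtain u where "u \<in> carrier (Fo a)" "z = w u" by (rule order_iso_surj[OF wv(1)])
        then show "Hm x y k z = Hm x y g z"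
          using k g iso_square.square[OF g'(2)] by (simp add: M_def)
      qed
      then show "k = g" using H.faithful[OF *(3,4)] k g by simp
    qed
  next
    fix a b x y w v g
    assume *: "a \<in> Ob C" "b \<in> Ob C" "x \<in> Ob E" "y \<in> Ob E" "W a x w" "W b y v" "g \<in> Hom E x y"
    note wv = *(5,6)[unfolded W_def]
    obtain f' where f': "f' \<in> carrier (Fo a) \<rightarrow>\<^sub>E carrier (Fo b)"
      "iso_square (Fo a) (Fo b) (Ho x) (Ho y) w v f' (Hm x y g)"
      by (rule iso_square_comate[OF iso[OF *(1,3,5)] iso[OF *(2,4,6)] H.map_fun[OF *(3,4,7)]])
    obtain f where f: "f \<in> Hom C a b" "Fm a b f = f'"
      using F.full[OF *(1,2) f'(1)] Q[OF f'(2)] H.hom[OF *(3,4,7)] by auto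
    show "\<exists>!f. f \<in> Hom C a b \<and> M a b x y w v f g"
    proof (rule ex1I)
      show "f \<in> Hom C a b \<and> M a b x y w v f g"
        using f iso_square.square[OF f'(2)] by (simp add: M_def)
      fix k assume k: "k \<in> Hom C a b \<and> M a b x y w v k g"
      have "Fm a b k = Fm a b f"
      proof (rule PiE_ext)
        show 1: "Fm a b k \<in> carrier (Fo a) \<rightarrow>\<^sub>E carrier (Fo b)" "Fm a b f \<in> carrier (Fo a) \<rightarrow>\<^sub>E carrier (Fo b)"
          using F.map[OF *(1,2), of k] F.map[OF *(1,2), of f] k f(1) by simp_all
        fix z assume z: "z \<in> carrier (Fo a)"
        then have "v (Fm a b k z) = v (Fm a b f z)"
          using k f iso_square.square[OF f'(2)] by (simp add: M_def)
        then show "Fm a b k z = Fm a b f z"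
          using order_iso_eq[OF wv(2)] PiE_mem[OF 1(1) z] PiE_mem[OF 1(2) z] by simp
      qed
      then show "k = f" using F.faithful[OF *(1,2)] k f by simp
    qed
  next
    fix a x w assume "a \<in> Ob C" "x \<in> Ob E" "W a x w"
    then show "M a a x x w w (Idm C a) (Idm E x)"
      by (simp add: M_def W_def F.Idm H.Idm order_iso_in)
  next
    fix a b c x y z w v u f f' g g'
    assume *: "a \<in> Ob C" "b \<in> Ob C" "c \<in> Ob C" "x \<in> Ob E" "y \<in> Ob E" "z \<in> Ob E"
        "W a x w" "W b y v" "W c z u" "f \<in> Hom C a b" "f' \<in> Hom C b c" "g \<in> Hom E x y" "g' \<in> Hom E y z"
        "M a b x y w v f g" "M b c y z v u f' g'"
    then show "M a c x z w u (Comp C a b c f' f) (Comp E x y z g' g)"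
      using PiE_mem[OF F.map[OF *(1,2,10)]]
      by (simp add: M_def W_def F.Comp H.Comp compose_def order_iso_in)
  qed (use catC catE exE exC in \<open>simp_all add: W_def\<close>)
  show ?thesis
  proof (rule equivalent_wide_subs)
    fix a b x y w v f g
    assume *: "a \<in> Ob C" "b \<in> Ob C" "x \<in> Ob E" "y \<in> Ob E" "W a x w" "W b y v"
      "f \<in> Hom C a b" "g \<in> Hom E x y" "M a b x y w v f g"
    show "P a b f \<longleftrightarrow> R x y g"
      using P[OF *(1,2,7)] R[OF *(3,4,8)] B[OF sq[OF *]] by simp
  next
    fix x assume x: "x \<in> Ob E"
    then show "R x x (Idm E x)"
      using R[OF x x Idm_in_Hom[OF catE x]] BI[OF H.gba[OF x]] H.Idm[OF x] by simp
  qed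
qed

lemma wide_sub_True: "wide_sub C (\<lambda>_ _ _. True) = C"
  by (simp add: wide_sub_def)


section \<open>Locally Stone frames and their compact elements\<close>

locale lsf =
  fixes L :: "'f gorder" (structure)
  assumes lsf: "locally_Stone_frame L"

sublocale lsf \<subseteq> complete_lattice L
  using lsf by (simp add: locally_Stone_frame_def frame_def)

context lsf
begin

lemma frame_distrib:
  "\<lbrakk>a \<in> carrier L; A \<subseteq> carrier L\<rbrakk> \<Longrightarrow> a \<sqinter> \<Squnion>A = \<Squnion>((\<lambda>x. a \<sqinter> x) ` A)"
  using lsf by (simp add: locally_Stone_frame_def frame_def)

lemma sup_empty: "\<Squnion>{} = \<bottom>"
  by (simp add: sup_def bottom_def)

lemma inf_empty: "\<Sqinter>{} = \<top>"
  by (simp add: inf_def top_def)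

lemma sup_insert: "\<lbrakk>a \<in> carrier L; A \<subseteq> carrier L\<rbrakk> \<Longrightarrow> \<Squnion>insert a A = a \<squnion> \<Squnion>A"
  using weak_sup_insert by (simp add: eq_is_equal)

lemma inf_insert: "\<lbrakk>a \<in> carrier L; A \<subseteq> carrier L\<rbrakk> \<Longrightarrow> \<Sqinter>insert a A = a \<sqinter> \<Sqinter>A"
  using weak_inf_insert by (simp add: eq_is_equal)

lemma sup_mono:
  assumes "B \<subseteq> carrier L" "\<And>a. a \<in> A \<Longrightarrow> a \<in> carrier L \<and> (\<exists>b\<in>B. a \<sqsubseteq> b)"
  shows "\<Squnion>A \<sqsubseteq> \<Squnion>B"
proof (rule sup_least)
  fix a assume "a \<in> A"
  from assms(2)[OF this] obtain b where b: "a \<in> carrier L" "b \<in> B" "a \<sqsubseteq> b" by auto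
  then show "a \<sqsubseteq> \<Squnion>B"
    using sup_upper[OF assms(1) b(2)] le_trans[of a b "\<Squnion>B"] assms(1) by auto
qed (use assms in auto)

lemma sup_subset: "\<lbrakk>A \<subseteq> B; B \<subseteq> carrier L\<rbrakk> \<Longrightarrow> \<Squnion>A \<sqsubseteq> \<Squnion>B"
  by (rule sup_least) (auto intro: sup_upper)

lemma meet_join_distrib:
  assumes "x \<in> carrier L" "y \<in> carrier L" "z \<in> carrier L"
  shows "x \<sqinter> (y \<squnion> z) = (x \<sqinter> y) \<squnion> (x \<sqinter> z)"
  using frame_distrib[of x "{y, z}"] assms by (simp add: join_def)

lemma join_meet_distrib:
  assumes x: "x \<in> carrier L" and y: "y \<in> carrier L" and z: "z \<in> carrier L"
  shows "x \<squnion> (y \<sqinter> z) = (x \<squnion> y) \<sqinter> (x \<squnion> z)"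
proof (rule le_antisym)
  have yz: "y \<sqinter> z \<sqsubseteq> y" "y \<sqinter> z \<sqsubseteq> z" using y z by (simp_all add: meet_left meet_right)
  have "y \<sqinter> z \<sqsubseteq> x \<squnion> y" "y \<sqinter> z \<sqsubseteq> x \<squnion> z"
    using le_trans[OF yz(1) join_right[OF x y]] le_trans[OF yz(2) join_right[OF x z]] x y z by simp_all
  then show "x \<squnion> (y \<sqinter> z) \<sqsubseteq> (x \<squnion> y) \<sqinter> (x \<squnion> z)"
    using x y z by (simp add: meet_le join_le join_left)
  have 1: "x \<sqsubseteq> x \<squnion> (y \<sqinter> z)" "y \<sqinter> z \<sqsubseteq> x \<squnion> (y \<sqinter> z)"
    using x y z by (simp_all add: join_left join_right)
  have "(x \<squnion> y) \<sqinter> (x \<squnion> z) = ((x \<squnion> y) \<sqinter> x) \<squnion> ((x \<squnion> y) \<sqinter> z)"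
    using x y z by (simp add: meet_join_distrib)
  also have "(x \<squnion> y) \<sqinter> z = (z \<sqinter> x) \<squnion> (z \<sqinter> y)"
    using x y z by (simp add: meet_join_distrib meet_comm[of L "x \<squnion> y" z])
  finally have 2: "(x \<squnion> y) \<sqinter> (x \<squnion> z) = ((x \<squnion> y) \<sqinter> x) \<squnion> ((z \<sqinter> x) \<squnion> (z \<sqinter> y))" .
  have "(x \<squnion> y) \<sqinter> x \<sqsubseteq> x \<squnion> (y \<sqinter> z)" "z \<sqinter> x \<sqsubseteq> x \<squnion> (y \<sqinter> z)"
    using le_trans[OF meet_right[of "x \<squnion> y" x] 1(1)] le_trans[OF meet_right[of z x] 1(1)] x y z
    by simp_all
  moreover have "z \<sqinter> y \<sqsubseteq> x \<squnion> (y \<sqinter> z)" using 1(2) by (simp add: meet_comm[of L z y])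
  ultimately show "(x \<squnion> y) \<sqinter> (x \<squnion> z) \<sqsubseteq> x \<squnion> (y \<sqinter> z)"
    unfolding 2 using x y z by (simp add: join_le)
qed (use assms in simp_all)

lemma compact_in_carrier: "k \<in> compacts L \<Longrightarrow> k \<in> carrier L"
  by (simp add: compacts_def)

lemma compactD:
  assumes "k \<in> compacts L" "A \<subseteq> carrier L" "k \<sqsubseteq> \<Squnion>A"
  obtains B where "B \<subseteq> A" "finite B" "k \<sqsubseteq> \<Squnion>B"
  using assms by (auto simp: compacts_def)

lemma finite_sup_compact:
  assumes "finite B" "B \<subseteq> compacts L"
  shows "\<Squnion>B \<in> compacts L"
proof -
  have Bc: "B \<subseteq> carrier L" using assms by (auto dest: compact_in_carrier)
  have "\<exists>D\<subseteq>A. finite D \<and> \<Squnion>B \<sqsubseteq> \<Squnion>D" if A: "A \<subseteq> carrier L" "\<Squnion>B \<sqsubseteq> \<Squnion>A" for A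
  proof -
    have "\<exists>D. D \<subseteq> A \<and> finite D \<and> b \<sqsubseteq> \<Squnion>D" if b: "b \<in> B" for b
    proof -
      have "b \<sqsubseteq> \<Squnion>A" using le_trans[OF sup_upper[OF Bc b] A(2)] b Bc A(1) by auto
      moreover have "b \<in> compacts L" using b assms(2) by auto
      ultimately obtain D where "D \<subseteq> A" "finite D" "b \<sqsubseteq> \<Squnion>D"
        using A(1) by (meson compactD)
      then show ?thesis by auto
    qed
    then obtain D where D: "\<And>b. b \<in> B \<Longrightarrow> D b \<subseteq> A \<and> finite (D b) \<and> b \<sqsubseteq> \<Squnion>(D b)" by metis
    have "\<Squnion>B \<sqsubseteq> \<Squnion>(\<Union>(D ` B))"
    proof (rule sup_least[OF Bc])
      have Dc: "\<Union>(D ` B) \<subseteq> carrier L" using D A(1) by blast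
      then show "\<Squnion>(\<Union>(D ` B)) \<in> carrier L" by simp
      fix b assume b: "b \<in> B"
      have "\<Squnion>(D b) \<sqsubseteq> \<Squnion>(\<Union>(D ` B))" by (rule sup_subset) (use Dc b in auto)
      moreover have "D b \<subseteq> carrier L" using D[OF b] A(1) by auto
      ultimately show "b \<sqsubseteq> \<Squnion>(\<Union>(D ` B))"
        using D[OF b] le_trans[of b "\<Squnion>(D b)" "\<Squnion>(\<Union>(D ` B))"] b Bc Dc by auto
    qed
    moreover have "\<Union>(D ` B) \<subseteq> A" "finite (\<Union>(D ` B))" using D assms(1) by auto
    ultimately show ?thesis by blast
  qed
  then show ?thesis using Bc by (simp add: compacts_def)
qed

lemma bottom_compact: "\<bottom> \<in> compacts L"
  using finite_sup_compact[of "{}"] by (simp add: sup_empty)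

lemma join_compact: "\<lbrakk>k \<in> compacts L; l \<in> compacts L\<rbrakk> \<Longrightarrow> k \<squnion> l \<in> compacts L"
  using finite_sup_compact[of "{k, l}"] by (simp add: join_def)

lemma compact_sup_compacts:
  assumes "k \<in> compacts L" "A \<subseteq> compacts L" "k \<sqsubseteq> \<Squnion>A"
  obtains B where "B \<subseteq> A" "finite B" "\<Squnion>B \<in> compacts L" "k \<sqsubseteq> \<Squnion>B"
proof -
  have "A \<subseteq> carrier L" using assms(2) by (auto dest: compact_in_carrier)
  then obtain B where B: "B \<subseteq> A" "finite B" "k \<sqsubseteq> \<Squnion>B" by (rule compactD[OF assms(1) _ assms(3)])
  then have "\<Squnion>B \<in> compacts L" using assms(2) by (intro finite_sup_compact) auto
  then show ?thesis using that B by auto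
qed

lemma sup_compacts_below:
  assumes x: "x \<in> carrier L"
  shows "\<Squnion>{k \<in> compacts L. k \<sqsubseteq> x} = x"
proof -
  have c: "{k \<in> compacts L. k \<sqsubseteq> x} \<subseteq> carrier L" by (auto dest: compact_in_carrier)
  obtain A where A: "A \<subseteq> compacts L" "x = \<Squnion>A"
    using lsf x by (auto simp: locally_Stone_frame_def algebraic_def)
  then have Ac: "A \<subseteq> carrier L" by (auto dest: compact_in_carrier)
  have "A \<subseteq> {k \<in> compacts L. k \<sqsubseteq> x}" using A sup_upper[OF Ac] by auto
  then have "x \<sqsubseteq> \<Squnion>{k \<in> compacts L. k \<sqsubseteq> x}"
    using sup_subset[OF _ c] by (subst A(2)) simp
  moreover have "\<Squnion>{k \<in> compacts L. k \<sqsubseteq> x} \<sqsubseteq> x"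
    by (rule sup_least[OF c x]) simp
  ultimately show ?thesis using x c by (intro le_antisym) auto
qed

lemma le_if_compacts_le:
  assumes "x \<in> carrier L" "y \<in> carrier L" "\<And>k. \<lbrakk>k \<in> compacts L; k \<sqsubseteq> x\<rbrakk> \<Longrightarrow> k \<sqsubseteq> y"
  shows "x \<sqsubseteq> y"
proof -
  have "\<Squnion>{k \<in> compacts L. k \<sqsubseteq> x} \<sqsubseteq> y"
    by (rule sup_least) (use assms in \<open>auto dest: compact_in_carrier\<close>)
  then show ?thesis using sup_compacts_below[OF assms(1)] by simp
qed

definition complements :: "'f \<Rightarrow> 'f \<Rightarrow> bool" where
  "complements a b \<longleftrightarrow> a \<in> carrier L \<and> b \<in> carrier L \<and> a \<sqinter> b = \<bottom> \<and> a \<squnion> b = \<top>"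

text \<open>The pseudocomplement of \<open>a\<close> is disjoint from \<open>a\<close> because meets distribute over all joins.\<close>

lemma complemented_has_complement:
  assumes "a \<in> complementeds L"
  shows "\<exists>b. complements a b"
proof -
  let ?X = "{x \<in> carrier L. a \<sqinter> x = \<bottom>}"
  have a: "a \<in> carrier L" "a \<squnion> \<Squnion>?X = \<top>"
    using assms by (simp_all add: complementeds_def pseudocomplement_def)
  have "a \<sqinter> \<Squnion>?X = \<Squnion>((\<lambda>x. a \<sqinter> x) ` ?X)" by (rule frame_distrib) (use a in auto)
  also have "\<dots> \<sqsubseteq> \<bottom>" by (rule sup_least) auto
  finally have "a \<sqinter> \<Squnion>?X = \<bottom>" using a by (intro le_antisym) auto
  then have "complements a (\<Squnion>?X)" using a by (auto simp: complements_def)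
  then show ?thesis ..
qed

lemma complements_join:
  assumes "complements a b" "complements a' b'"
  shows "complements (a \<squnion> a') (b \<sqinter> b')"
proof -
  have c: "a \<in> carrier L" "b \<in> carrier L" "a' \<in> carrier L" "b' \<in> carrier L"
    and ab: "a \<sqinter> b = \<bottom>" "a \<squnion> b = \<top>" "a' \<sqinter> b' = \<bottom>" "a' \<squnion> b' = \<top>"
    using assms by (simp_all add: complements_def)
  let ?m = "b \<sqinter> b'"
  have m: "?m \<sqsubseteq> b" "?m \<sqsubseteq> b'" using c by (simp_all add: meet_left meet_right)
  have "?m \<sqinter> a \<sqsubseteq> b" "?m \<sqinter> a \<sqsubseteq> a" "?m \<sqinter> a' \<sqsubseteq> b'" "?m \<sqinter> a' \<sqsubseteq> a'"
    using le_trans[OF meet_left[of ?m a] m(1)] le_trans[OF meet_left[of ?m a'] m(2)] c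
    by (simp_all add: meet_right)
  then have "?m \<sqinter> a \<sqsubseteq> \<bottom>" "?m \<sqinter> a' \<sqsubseteq> \<bottom>"
    using c meet_le[of "?m \<sqinter> a" a b] meet_le[of "?m \<sqinter> a'" a' b'] ab by simp_all
  then have "?m \<sqinter> (a \<squnion> a') \<sqsubseteq> \<bottom>" using c by (simp add: meet_join_distrib join_le)
  then have 1: "(a \<squnion> a') \<sqinter> ?m = \<bottom>"
    using c by (intro le_antisym) (simp_all add: meet_comm[of L "a \<squnion> a'"])
  have j: "a \<sqsubseteq> a \<squnion> a'" "a' \<sqsubseteq> a \<squnion> a'" using c by (simp_all add: join_left join_right)
  have "a \<squnion> b \<sqsubseteq> (a \<squnion> a') \<squnion> b" "a' \<squnion> b' \<sqsubseteq> (a \<squnion> a') \<squnion> b'"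
    using le_trans[OF j(1) join_left[of "a \<squnion> a'" b]] le_trans[OF j(2) join_left[of "a \<squnion> a'" b']] c
    by (simp_all add: join_le join_right)
  then have "\<top> \<sqsubseteq> ((a \<squnion> a') \<squnion> b) \<sqinter> ((a \<squnion> a') \<squnion> b')" using ab c by (simp add: meet_le)
  then have "\<top> \<sqsubseteq> (a \<squnion> a') \<squnion> ?m" using c by (simp add: join_meet_distrib)
  then have "(a \<squnion> a') \<squnion> ?m = \<top>" using c by (intro le_antisym) simp_all
  then show ?thesis using 1 c by (simp add: complements_def)
qed

lemma finite_sup_complemented:
  assumes "finite B" "B \<subseteq> complementeds L"
  shows "\<exists>b. complements (\<Squnion>B) b"
  using assms
proof (induction B)
  case empty
  have "complements \<bottom> \<top>"
    unfolding complements_def using bottom_meet[of \<top>] bottom_join[of \<top>] by (simp add: eq_is_equal)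
  then show ?case by (auto simp: sup_empty)
next
  case (insert a B)
  then have "\<exists>b. complements (\<Squnion>B) b" "\<exists>b'. complements a b'"
    using complemented_has_complement by simp_all
  then obtain b b' where "complements (\<Squnion>B) b" "complements a b'" by auto
  moreover have "insert a B \<subseteq> carrier L" using insert.prems by (auto simp: complementeds_def)
  ultimately show ?case using complements_join[of a b' "\<Squnion>B" b] by (auto simp: sup_insert)
qed

text \<open>A compact element is the join of finitely many of the complemented elements below it.\<close>

lemma compact_has_complement:
  assumes k: "k \<in> compacts L"
  obtains b where "complements k b"
proof -
  obtain A where A: "A \<subseteq> complementeds L" "k = \<Squnion>A"
    using lsf compact_in_carrier[OF k] by (auto simp: locally_Stone_frame_def zero_dimensional_def)
  then have Ac: "A \<subseteq> carrier L" by (auto simp: complementeds_def)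
  have "k \<sqsubseteq> \<Squnion>A" using A compact_in_carrier[OF k] by simp
  then obtain B where B: "B \<subseteq> A" "finite B" "k \<sqsubseteq> \<Squnion>B" by (rule compactD[OF k Ac])
  have "\<Squnion>B \<sqsubseteq> \<Squnion>A" by (rule sup_subset[OF B(1) Ac])
  moreover have "B \<subseteq> carrier L" using B Ac by auto
  ultimately have "k = \<Squnion>B" using B A compact_in_carrier[OF k] by (intro le_antisym) auto
  moreover have "\<exists>b. complements (\<Squnion>B) b" using finite_sup_complemented[of B] A B by auto
  ultimately show ?thesis using that by auto
qed

text \<open>A cover of \<open>k \<sqinter> a\<close> becomes a cover of \<open>k\<close> by adding the complement of \<open>a\<close>, whose share of
  a finite subcover can be dropped again.\<close>

lemma compact_meet_complemented:
  assumes k: "k \<in> compacts L" and ab: "complements a b"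
  shows "k \<sqinter> a \<in> compacts L"
proof -
  have c: "k \<in> carrier L" "a \<in> carrier L" "b \<in> carrier L" "a \<sqinter> b = \<bottom>" "a \<squnion> b = \<top>"
    using ab compact_in_carrier[OF k] by (simp_all add: complements_def)
  have "\<exists>D\<subseteq>A. finite D \<and> k \<sqinter> a \<sqsubseteq> \<Squnion>D" if A: "A \<subseteq> carrier L" "k \<sqinter> a \<sqsubseteq> \<Squnion>A" for A
  proof -
    have "k = k \<sqinter> \<top>" using c le_iff_join[of k \<top>] by simp
    also have "\<dots> = (k \<sqinter> a) \<squnion> (k \<sqinter> b)" using c by (simp add: meet_join_distrib flip: c(5))
    also have "\<dots> \<sqsubseteq> b \<squnion> \<Squnion>A"
      using A c le_trans[OF A(2) join_right[of b "\<Squnion>A"]] le_trans[OF meet_right[of k b] join_left[of b "\<Squnion>A"]]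
      by (simp add: join_le)
    also have "b \<squnion> \<Squnion>A = \<Squnion>insert b A" using A c by (simp add: sup_insert)
    finally obtain D where D: "D \<subseteq> insert b A" "finite D" "k \<sqsubseteq> \<Squnion>D"
      using compactD[OF k, of "insert b A"] A c by auto
    have Dc: "D \<subseteq> carrier L" using D A c by auto
    then have Dbc: "D - {b} \<subseteq> carrier L" and "(\<lambda>x. a \<sqinter> x) ` D \<subseteq> carrier L" using c by auto
    then have aD: "\<Squnion>((\<lambda>x. a \<sqinter> x) ` D) \<in> carrier L" by simp
    have "k \<sqinter> a \<sqsubseteq> a \<sqinter> \<Squnion>D"
      using c Dc D le_trans[OF meet_left[of k a] D(3)] by (simp add: meet_le meet_right)
    also have "a \<sqinter> \<Squnion>D = \<Squnion>((\<lambda>x. a \<sqinter> x) ` D)" using c Dc by (simp add: frame_distrib)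
    also have "\<dots> \<sqsubseteq> \<Squnion>(D - {b})"
    proof (rule sup_least)
      fix y assume "y \<in> (\<lambda>x. a \<sqinter> x) ` D"
      then obtain x where x: "x \<in> D" "y = a \<sqinter> x" by auto
      show "y \<sqsubseteq> \<Squnion>(D - {b})"
      proof (cases "x = b")
        case True
        have "D - {b} \<subseteq> carrier L" using Dc by auto
        then show ?thesis using True x c by simp
      next
        case False
        then have "x \<sqsubseteq> \<Squnion>(D - {b})" using sup_upper[of "D - {b}" x] x Dc by auto
        moreover have "D - {b} \<subseteq> carrier L" "x \<in> carrier L" using Dc x by auto
        ultimately show ?thesis using le_trans[OF meet_right[of a x]] x c by simp
      qed
    qed (use c Dc Dbc in auto)
    finally have "k \<sqinter> a \<sqsubseteq> \<Squnion>(D - {b})" using c Dbc aD by simp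
    moreover have "D - {b} \<subseteq> A" "finite (D - {b})" using D by auto
    ultimately show ?thesis by blast
  qed
  then show ?thesis using c by (simp add: compacts_def)
qed

lemma meet_compact:
  assumes "k \<in> compacts L" "l \<in> compacts L"
  shows "k \<sqinter> l \<in> compacts L"
proof -
  obtain b where "complements l b" by (rule compact_has_complement[OF assms(2)])
  then show ?thesis by (rule compact_meet_complemented[OF assms(1)])
qed

end

text \<open>The least element of the frame is always compact whereas the greatest need not be, so the order
  is reversed to obtain a top.\<close>

definition algebra_of_frame :: "'f gorder \<Rightarrow> 'f gorder" where
  "algebra_of_frame L = \<lparr>carrier = compacts L, eq = (=), le = (\<lambda>x y. y \<sqsubseteq>\<^bsub>L\<^esub> x)\<rparr>"

lemma carrier_algebra_of_frame [simp]: "carrier (algebra_of_frame L) = compacts L"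
  by (simp add: algebra_of_frame_def)

lemma le_algebra_of_frame [simp]: "x \<sqsubseteq>\<^bsub>algebra_of_frame L\<^esub> y \<longleftrightarrow> y \<sqsubseteq>\<^bsub>L\<^esub> x"
  by (simp add: algebra_of_frame_def)

context lsf
begin

text \<open>For compact \<open>x \<sqsubseteq> a\<close>, the complement of \<open>x\<close> in the interval between \<open>a\<close> and \<open>\<bottom>\<close> is the meet of \<open>a\<close>
  with the complement of \<open>x\<close> in the whole frame.\<close>

lemma gba_operations_algebra_of_frame: "gba_operations (algebra_of_frame L) (\<squnion>) (\<sqinter>) \<bottom>"
proof -
  note [simp] = compact_in_carrier join_compact meet_compact bottom_compact
  have "partial_order (algebra_of_frame L)"
  proof (rule partial_orderI)
    fix x y z assume "x \<in> carrier (algebra_of_frame L)" "y \<in> carrier (algebra_of_frame L)"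
      "z \<in> carrier (algebra_of_frame L)" "x \<sqsubseteq>\<^bsub>algebra_of_frame L\<^esub> y" "y \<sqsubseteq>\<^bsub>algebra_of_frame L\<^esub> z"
    then show "x \<sqsubseteq>\<^bsub>algebra_of_frame L\<^esub> z" using le_trans[of z y x] by simp
  next
    fix x y assume "x \<in> carrier (algebra_of_frame L)" "y \<in> carrier (algebra_of_frame L)"
      "x \<sqsubseteq>\<^bsub>algebra_of_frame L\<^esub> y" "y \<sqsubseteq>\<^bsub>algebra_of_frame L\<^esub> x"
    then show "x = y" using le_antisym[of x y] by simp
  qed (simp_all add: algebra_of_frame_def)
  then interpret A: partial_order "algebra_of_frame L" .
  show ?thesis
  proof unfold_locales
    fix a x assume "a \<in> carrier (algebra_of_frame L)" "x \<in> carrier (algebra_of_frame L)"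
      "a \<sqsubseteq>\<^bsub>algebra_of_frame L\<^esub> x"
    then have ax: "a \<in> compacts L" "x \<in> compacts L" "x \<sqsubseteq> a" by simp_all
    obtain b where b: "complements x b" by (rule compact_has_complement[OF ax(2)])
    then have b': "complements b x" and c: "b \<in> carrier L" "x \<sqinter> b = \<bottom>" "x \<squnion> b = \<top>"
      by (simp_all add: complements_def meet_comm[of L b] join_comm[of L b])
    have "a \<sqinter> b \<in> compacts L" by (rule compact_meet_complemented[OF ax(1) b'])
    moreover have "x \<squnion> (a \<sqinter> b) = a"
    proof -
      have "x \<squnion> (a \<sqinter> b) = (x \<squnion> a) \<sqinter> \<top>" using ax c by (simp add: join_meet_distrib)
      also have "x \<squnion> a = a" using ax le_iff_meet[of x a] by simp
      also have "a \<sqinter> \<top> = a" using ax le_iff_join[of a \<top>] by simp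
      finally show ?thesis .
    qed
    moreover have "x \<sqinter> (a \<sqinter> b) = \<bottom>"
    proof (rule le_antisym)
      have "x \<sqinter> (a \<sqinter> b) \<sqsubseteq> b" "x \<sqinter> (a \<sqinter> b) \<sqsubseteq> x"
        using le_trans[OF meet_right[of x "a \<sqinter> b"] meet_right[of a b]] ax c by (simp_all add: meet_left)
      then show "x \<sqinter> (a \<sqinter> b) \<sqsubseteq> \<bottom>"
        using meet_le[of "x \<sqinter> (a \<sqinter> b)" x b] ax c by simp
    qed (use ax c in simp_all)
    ultimately show "\<exists>y\<in>carrier (algebra_of_frame L). x \<squnion> y = a \<and> x \<sqinter> y = \<bottom>" by auto
  qed (simp_all add: join_left join_right join_le meet_left meet_right meet_le join_meet_distrib)
qed

lemma gba_algebra_of_frame: "gba (algebra_of_frame L)"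
  by (rule gba_operations.gba_axioms[OF gba_operations_algebra_of_frame])

lemma algebra_of_frame_operations:
  "\<top>\<^bsub>algebra_of_frame L\<^esub> = \<bottom>"
  "\<lbrakk>x \<in> compacts L; y \<in> compacts L\<rbrakk> \<Longrightarrow> x \<sqinter>\<^bsub>algebra_of_frame L\<^esub> y = x \<squnion> y"
  "\<lbrakk>x \<in> compacts L; y \<in> compacts L\<rbrakk> \<Longrightarrow> x \<squnion>\<^bsub>algebra_of_frame L\<^esub> y = x \<sqinter> y"
proof -
  interpret A: gba_operations "algebra_of_frame L" "(\<squnion>)" "(\<sqinter>)" \<bottom>
    by (rule gba_operations_algebra_of_frame)
  show "\<top>\<^bsub>algebra_of_frame L\<^esub> = \<bottom>" by (rule A.top_eq)
  show "x \<sqinter>\<^bsub>algebra_of_frame L\<^esub> y = x \<squnion> y" "x \<squnion>\<^bsub>algebra_of_frame L\<^esub> y = x \<sqinter> y"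
    if "x \<in> compacts L" "y \<in> compacts L"
    using that A.meet_eq[of x y] A.join_eq[of x y] by simp_all
qed

text \<open>A greatest compact element lies above all joins of compact elements, that is, above everything.\<close>

lemma algebra_of_frame_bottom:
  "weak_partial_order_bottom (algebra_of_frame L) \<longleftrightarrow> compact_frame L"
  "compact_frame L \<Longrightarrow> \<bottom>\<^bsub>algebra_of_frame L\<^esub> = \<top>"
proof -
  interpret A: gba "algebra_of_frame L" by (rule gba_algebra_of_frame)
  show "\<bottom>\<^bsub>algebra_of_frame L\<^esub> = \<top>" if "compact_frame L"
    by (rule A.bottom_eqI) (use that in \<open>auto simp: compact_frame_def compact_in_carrier\<close>)
  show "weak_partial_order_bottom (algebra_of_frame L) \<longleftrightarrow> compact_frame L"
    unfolding A.has_bottom_iff compact_frame_def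
  proof
    assume "\<exists>b\<in>carrier (algebra_of_frame L). \<forall>x\<in>carrier (algebra_of_frame L). b \<sqsubseteq>\<^bsub>algebra_of_frame L\<^esub> x"
    then obtain b where b: "b \<in> compacts L" "\<And>x. x \<in> compacts L \<Longrightarrow> x \<sqsubseteq> b" by auto
    have "\<top> \<sqsubseteq> b" by (rule le_if_compacts_le) (use b compact_in_carrier in auto)
    then have "\<top> = b" using b compact_in_carrier by (intro le_antisym) auto
    then show "\<top> \<in> compacts L" using b by simp
  next
    assume "\<top> \<in> compacts L"
    then show "\<exists>b\<in>carrier (algebra_of_frame L). \<forall>x\<in>carrier (algebra_of_frame L). b \<sqsubseteq>\<^bsub>algebra_of_frame L\<^esub> x"
      by (intro bexI[of _ \<top>]) (auto simp: compact_in_carrier)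
  qed
qed

end


locale lsf_sup_hom = L1: lsf L1 + L2: lsf L2 for L1 L2 :: "'f gorder" +
  fixes \<alpha> :: "'f \<Rightarrow> 'f"
  assumes closed: "\<alpha> \<in> carrier L1 \<rightarrow> carrier L2"
    and joins: "preserves_joins L1 L2 \<alpha>"
    and compact: "preserves_compacts L1 L2 \<alpha>"
begin

lemma map_in [simp]: "x \<in> carrier L1 \<Longrightarrow> \<alpha> x \<in> carrier L2"
  using closed by (rule funcset_mem)

lemma map_compact [simp]: "k \<in> compacts L1 \<Longrightarrow> \<alpha> k \<in> compacts L2"
  using compact by (auto simp: preserves_compacts_def)

lemma map_sup: "A \<subseteq> carrier L1 \<Longrightarrow> \<alpha> (\<Squnion>\<^bsub>L1\<^esub>A) = \<Squnion>\<^bsub>L2\<^esub>(\<alpha> ` A)"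
  using joins by (simp add: preserves_joins_def)

lemma map_bottom: "\<alpha> \<bottom>\<^bsub>L1\<^esub> = \<bottom>\<^bsub>L2\<^esub>"
  using map_sup[of "{}"] by (simp add: L1.sup_empty L2.sup_empty)

lemma map_join: "\<lbrakk>x \<in> carrier L1; y \<in> carrier L1\<rbrakk> \<Longrightarrow> \<alpha> (x \<squnion>\<^bsub>L1\<^esub> y) = \<alpha> x \<squnion>\<^bsub>L2\<^esub> \<alpha> y"
  using map_sup[of "{x, y}"] by (simp add: join_def)

lemma mono:
  assumes "x \<in> carrier L1" "y \<in> carrier L1" "x \<sqsubseteq>\<^bsub>L1\<^esub> y"
  shows "\<alpha> x \<sqsubseteq>\<^bsub>L2\<^esub> \<alpha> y"
proof -
  have "\<alpha> (x \<squnion>\<^bsub>L1\<^esub> y) = \<alpha> x \<squnion>\<^bsub>L2\<^esub> \<alpha> y" using assms by (simp add: map_join)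
  moreover have "x \<squnion>\<^bsub>L1\<^esub> y = y" using assms L1.le_iff_meet by simp
  ultimately show ?thesis using assms L2.join_left[of "\<alpha> x" "\<alpha> y"] by simp
qed

text \<open>A compact element below \<open>\<alpha> a\<close> is below the image of a single compact element below \<open>a\<close>: the
  compact elements below \<open>a\<close> have join \<open>a\<close> and are closed under finite joins.\<close>

lemma compact_below_image:
  assumes k: "k \<in> compacts L2" and a: "a \<in> carrier L1" and le: "k \<sqsubseteq>\<^bsub>L2\<^esub> \<alpha> a"
  obtains l where "l \<in> compacts L1" "l \<sqsubseteq>\<^bsub>L1\<^esub> a" "k \<sqsubseteq>\<^bsub>L2\<^esub> \<alpha> l"
proof -
  let ?A = "{l \<in> compacts L1. l \<sqsubseteq>\<^bsub>L1\<^esub> a}"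
  have A: "?A \<subseteq> carrier L1" by (auto dest: L1.compact_in_carrier)
  have "\<alpha> a = \<Squnion>\<^bsub>L2\<^esub>(\<alpha> ` ?A)" using map_sup[OF A] L1.sup_compacts_below[OF a] by simp
  then have "k \<sqsubseteq>\<^bsub>L2\<^esub> \<Squnion>\<^bsub>L2\<^esub>(\<alpha> ` ?A)" using le by simp
  moreover have "\<alpha> ` ?A \<subseteq> compacts L2" by auto
  ultimately obtain B where B: "B \<subseteq> \<alpha> ` ?A" "finite B" "k \<sqsubseteq>\<^bsub>L2\<^esub> \<Squnion>\<^bsub>L2\<^esub>B"
    by (metis L2.compact_sup_compacts[OF k])
  then obtain D where D: "D \<subseteq> ?A" "finite D" "B = \<alpha> ` D" by (meson finite_subset_image)
  have Dc: "D \<subseteq> carrier L1" and Dk: "D \<subseteq> compacts L1" using D A by auto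
  show ?thesis
  proof (rule that[of "\<Squnion>\<^bsub>L1\<^esub>D"])
    show "\<Squnion>\<^bsub>L1\<^esub>D \<in> compacts L1" by (rule L1.finite_sup_compact[OF D(2) Dk])
    show "\<Squnion>\<^bsub>L1\<^esub>D \<sqsubseteq>\<^bsub>L1\<^esub> a" by (rule L1.sup_least[OF Dc a]) (use D in auto)
    show "k \<sqsubseteq>\<^bsub>L2\<^esub> \<alpha> (\<Squnion>\<^bsub>L1\<^esub>D)" using B D map_sup[OF Dc] by simp
  qed
qed

abbreviation restriction :: "'f \<Rightarrow> 'f" where "restriction \<equiv> restrict \<alpha> (compacts L1)"

lemma restriction_in: "restriction \<in> carrier (algebra_of_frame L1) \<rightarrow>\<^sub>E carrier (algebra_of_frame L2)"
  by simp

lemma meet_hom_restriction: "meet_hom (algebra_of_frame L1) (algebra_of_frame L2) restriction"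
  unfolding meet_hom_def
  by (simp add: L1.algebra_of_frame_operations L2.algebra_of_frame_operations L1.bottom_compact
      L1.join_compact map_bottom map_join L1.compact_in_carrier)

lemma lattice_hom_restriction_iff:
  "lattice_hom (algebra_of_frame L1) (algebra_of_frame L2) restriction \<longleftrightarrow>
   (\<forall>x\<in>compacts L1. \<forall>y\<in>compacts L1. \<alpha> (x \<sqinter>\<^bsub>L1\<^esub> y) = \<alpha> x \<sqinter>\<^bsub>L2\<^esub> \<alpha> y)"
  unfolding lattice_hom_def
  by (simp add: meet_hom_restriction L1.algebra_of_frame_operations L2.algebra_of_frame_operations
      L1.meet_compact)

text \<open>Meets of compact elements are again compact, so an induction reduces nonempty finite meets to
  binary ones.\<close>

lemma preserves_compact_meets_iff:
  "(\<forall>S\<subseteq>compacts L1. finite S \<and> S \<noteq> {} \<and> \<Sqinter>\<^bsub>L1\<^esub>S \<in> compacts L1 \<longrightarrow> \<alpha> (\<Sqinter>\<^bsub>L1\<^esub>S) = \<Sqinter>\<^bsub>L2\<^esub>(\<alpha> ` S)) \<longleftrightarrow>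
   lattice_hom (algebra_of_frame L1) (algebra_of_frame L2) restriction" (is "?l \<longleftrightarrow> _")
  unfolding lattice_hom_restriction_iff
proof
  assume l: ?l
  show "\<forall>x\<in>compacts L1. \<forall>y\<in>compacts L1. \<alpha> (x \<sqinter>\<^bsub>L1\<^esub> y) = \<alpha> x \<sqinter>\<^bsub>L2\<^esub> \<alpha> y"
  proof (intro ballI)
    fix x y assume xy: "x \<in> compacts L1" "y \<in> compacts L1"
    then have "\<alpha> (\<Sqinter>\<^bsub>L1\<^esub>{x, y}) = \<Sqinter>\<^bsub>L2\<^esub>(\<alpha> ` {x, y})"
      using L1.meet_compact[OF xy] by (intro l[rule_format]) (simp_all add: meet_def)
    then show "\<alpha> (x \<sqinter>\<^bsub>L1\<^esub> y) = \<alpha> x \<sqinter>\<^bsub>L2\<^esub> \<alpha> y" by (simp add: meet_def)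
  qed
next
  assume r: "\<forall>x\<in>compacts L1. \<forall>y\<in>compacts L1. \<alpha> (x \<sqinter>\<^bsub>L1\<^esub> y) = \<alpha> x \<sqinter>\<^bsub>L2\<^esub> \<alpha> y"
  have "\<Sqinter>\<^bsub>L1\<^esub>S \<in> compacts L1 \<and> \<alpha> (\<Sqinter>\<^bsub>L1\<^esub>S) = \<Sqinter>\<^bsub>L2\<^esub>(\<alpha> ` S)"
    if "finite S" "S \<noteq> {}" "S \<subseteq> compacts L1" for S
    using that
  proof (induction S rule: finite_ne_induct)
    case (singleton x)
    then show ?case by (simp add: L1.compact_in_carrier)
  next
    case (insert x S)
    then have c: "x \<in> compacts L1" "S \<subseteq> compacts L1" "\<Sqinter>\<^bsub>L1\<^esub>S \<in> compacts L1"
      "\<alpha> (\<Sqinter>\<^bsub>L1\<^esub>S) = \<Sqinter>\<^bsub>L2\<^esub>(\<alpha> ` S)" by auto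
    then have "S \<subseteq> carrier L1" "\<alpha> ` S \<subseteq> carrier L2" by (auto simp: L1.compact_in_carrier subset_iff)
    then show ?case
      using c r by (simp add: L1.inf_insert L2.inf_insert L1.meet_compact L1.compact_in_carrier)
  qed
  then show ?l by blast
qed

text \<open>Preservation of the top says that every compact element lies below the image of a compact
  element, which is coinitiality for the reversed order. Binary meets are compared on the compact
  elements \<open>k\<close> below \<open>\<alpha> a \<sqinter> \<alpha> b\<close>: they lie below \<open>\<alpha> l\<close> and \<open>\<alpha> l'\<close> for compact \<open>l \<sqsubseteq> a\<close> and \<open>l' \<sqsubseteq> b\<close>,
  hence below \<open>\<alpha> (l \<sqinter> l')\<close>.\<close>

lemma preserves_finite_meets_iff:
  "preserves_finite_meets L1 L2 \<alpha> \<longleftrightarrow> coinitial_hom (algebra_of_frame L1) (algebra_of_frame L2) restriction"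
proof
  assume p: "preserves_finite_meets L1 L2 \<alpha>"
  then have *: "\<alpha> (\<Sqinter>\<^bsub>L1\<^esub>A) = \<Sqinter>\<^bsub>L2\<^esub>(\<alpha> ` A)" if "A \<subseteq> carrier L1" "finite A" for A
    unfolding preserves_finite_meets_def using that by simp
  have "\<alpha> (\<Sqinter>\<^bsub>L1\<^esub>{}) = \<Sqinter>\<^bsub>L2\<^esub>(\<alpha> ` {})" by (rule *) simp_all
  then have top: "\<alpha> \<top>\<^bsub>L1\<^esub> = \<top>\<^bsub>L2\<^esub>" by (simp add: L1.inf_empty L2.inf_empty)
  have "\<alpha> (\<Sqinter>\<^bsub>L1\<^esub>{x, y}) = \<Sqinter>\<^bsub>L2\<^esub>(\<alpha> ` {x, y})" if "x \<in> compacts L1" "y \<in> compacts L1" for x y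
    by (rule *) (use that in \<open>auto dest: L1.compact_in_carrier\<close>)
  then have l: "lattice_hom (algebra_of_frame L1) (algebra_of_frame L2) restriction"
    unfolding lattice_hom_restriction_iff by (simp add: meet_def)
  show "coinitial_hom (algebra_of_frame L1) (algebra_of_frame L2) restriction"
    unfolding coinitial_hom_def
  proof (intro conjI l ballI)
    fix k assume "k \<in> carrier (algebra_of_frame L2)"
    then have k: "k \<in> compacts L2" by simp
    then have "k \<sqsubseteq>\<^bsub>L2\<^esub> \<alpha> \<top>\<^bsub>L1\<^esub>" using top by (simp add: L2.compact_in_carrier)
    then obtain l where "l \<in> compacts L1" "k \<sqsubseteq>\<^bsub>L2\<^esub> \<alpha> l"
      using compact_below_image[OF k L1.top_closed] by auto
    then show "\<exists>c\<in>carrier (algebra_of_frame L1). restriction c \<sqsubseteq>\<^bsub>algebra_of_frame L2\<^esub> k" by auto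
  qed
next
  assume *: "coinitial_hom (algebra_of_frame L1) (algebra_of_frame L2) restriction"
  then have meet: "\<alpha> (x \<sqinter>\<^bsub>L1\<^esub> y) = \<alpha> x \<sqinter>\<^bsub>L2\<^esub> \<alpha> y" if "x \<in> compacts L1" "y \<in> compacts L1" for x y
    using that coinitial_hom_lattice[OF *] unfolding lattice_hom_restriction_iff by simp
  have "\<top>\<^bsub>L2\<^esub> \<sqsubseteq>\<^bsub>L2\<^esub> \<alpha> \<top>\<^bsub>L1\<^esub>"
  proof (rule L2.le_if_compacts_le)
    fix k assume k: "k \<in> compacts L2"
    then obtain l where l: "l \<in> compacts L1" "k \<sqsubseteq>\<^bsub>L2\<^esub> \<alpha> l" using * by (auto simp: coinitial_hom_def)
    then have "\<alpha> l \<sqsubseteq>\<^bsub>L2\<^esub> \<alpha> \<top>\<^bsub>L1\<^esub>" by (intro mono) (auto dest: L1.compact_in_carrier)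
    then show "k \<sqsubseteq>\<^bsub>L2\<^esub> \<alpha> \<top>\<^bsub>L1\<^esub>"
      using L2.le_trans[OF l(2), of "\<alpha> \<top>\<^bsub>L1\<^esub>"] k l by (simp add: L1.compact_in_carrier L2.compact_in_carrier)
  qed simp_all
  then have top: "\<alpha> \<top>\<^bsub>L1\<^esub> = \<top>\<^bsub>L2\<^esub>" by (intro L2.le_antisym) simp_all
  have m: "\<alpha> (a \<sqinter>\<^bsub>L1\<^esub> b) = \<alpha> a \<sqinter>\<^bsub>L2\<^esub> \<alpha> b" if a: "a \<in> carrier L1" and b: "b \<in> carrier L1" for a b
  proof (rule L2.le_antisym)
    show "\<alpha> (a \<sqinter>\<^bsub>L1\<^esub> b) \<sqsubseteq>\<^bsub>L2\<^esub> \<alpha> a \<sqinter>\<^bsub>L2\<^esub> \<alpha> b"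
      using a b by (intro L2.meet_le mono) (simp_all add: L1.meet_left L1.meet_right)
    show "\<alpha> a \<sqinter>\<^bsub>L2\<^esub> \<alpha> b \<sqsubseteq>\<^bsub>L2\<^esub> \<alpha> (a \<sqinter>\<^bsub>L1\<^esub> b)"
    proof (rule L2.le_if_compacts_le)
      fix k assume k: "k \<in> compacts L2" "k \<sqsubseteq>\<^bsub>L2\<^esub> \<alpha> a \<sqinter>\<^bsub>L2\<^esub> \<alpha> b"
      have kc: "k \<in> carrier L2" using k by (simp add: L2.compact_in_carrier)
      have "k \<sqsubseteq>\<^bsub>L2\<^esub> \<alpha> a" "k \<sqsubseteq>\<^bsub>L2\<^esub> \<alpha> b"
        using L2.le_trans[OF k(2), of "\<alpha> a"] L2.le_trans[OF k(2), of "\<alpha> b"] a b kc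
        by (simp_all add: L2.meet_left L2.meet_right)
      then obtain l l' where l: "l \<in> compacts L1" "l \<sqsubseteq>\<^bsub>L1\<^esub> a" "k \<sqsubseteq>\<^bsub>L2\<^esub> \<alpha> l"
        and l': "l' \<in> compacts L1" "l' \<sqsubseteq>\<^bsub>L1\<^esub> b" "k \<sqsubseteq>\<^bsub>L2\<^esub> \<alpha> l'"
        by (metis compact_below_image[OF k(1) a] compact_below_image[OF k(1) b])
      have lc: "l \<in> carrier L1" "l' \<in> carrier L1" using l l' by (simp_all add: L1.compact_in_carrier)
      have "l \<sqinter>\<^bsub>L1\<^esub> l' \<sqsubseteq>\<^bsub>L1\<^esub> a \<sqinter>\<^bsub>L1\<^esub> b"
        using L1.le_trans[OF L1.meet_left[OF lc] l(2)] L1.le_trans[OF L1.meet_right[OF lc] l'(2)] a b lc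
        by (simp add: L1.meet_le)
      then have 1: "\<alpha> (l \<sqinter>\<^bsub>L1\<^esub> l') \<sqsubseteq>\<^bsub>L2\<^esub> \<alpha> (a \<sqinter>\<^bsub>L1\<^esub> b)" using a b lc by (simp add: mono)
      have "k \<sqsubseteq>\<^bsub>L2\<^esub> \<alpha> (l \<sqinter>\<^bsub>L1\<^esub> l')"
        unfolding meet[OF l(1) l'(1)] using l l' lc kc by (simp add: L2.meet_le)
      then show "k \<sqsubseteq>\<^bsub>L2\<^esub> \<alpha> (a \<sqinter>\<^bsub>L1\<^esub> b)" using L2.le_trans[OF _ 1] kc lc a b by simp
    qed (use a b in simp_all)
  qed (use a b in simp_all)
  have "\<alpha> (\<Sqinter>\<^bsub>L1\<^esub>A) = \<Sqinter>\<^bsub>L2\<^esub>(\<alpha> ` A)" if "finite A" "A \<subseteq> carrier L1" for A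
    using that
  proof (induction A)
    case empty
    then show ?case using top by (simp add: L1.inf_empty L2.inf_empty)
  next
    case (insert x A)
    then have "\<alpha> ` A \<subseteq> carrier L2" by auto
    then show ?case using insert m by (simp add: L1.inf_insert L2.inf_insert)
  qed
  then show "preserves_finite_meets L1 L2 \<alpha>" unfolding preserves_finite_meets_def by simp
qed

lemma bounded_iff:
  "(compact_frame L1 \<and> compact_frame L2 \<longrightarrow> \<alpha> \<top>\<^bsub>L1\<^esub> = \<top>\<^bsub>L2\<^esub>) \<longleftrightarrow>
   bounded_hom (algebra_of_frame L1) (algebra_of_frame L2) restriction"
  unfolding bounded_hom_def L1.algebra_of_frame_bottom(1) L2.algebra_of_frame_bottom(1)
  using L1.algebra_of_frame_bottom(2) L2.algebra_of_frame_bottom(2)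
  by (auto simp: compact_frame_def)

end

lemma Hom_LStoneFrm_Sup:
  assumes "locally_Stone_frame L1" "locally_Stone_frame L2"
  shows "\<alpha> \<in> Hom LStoneFrm_Sup L1 L2 \<longleftrightarrow> \<alpha> \<in> extensional (carrier L1) \<and> lsf_sup_hom L1 L2 \<alpha>"
  using assms
  by (auto simp: LStoneFrm_Sup_def concrete_def lsf_sup_hom_def lsf_sup_hom_axioms_def lsf_def PiE_def)

text \<open>A finite-join-preserving map on compact elements extends by taking joins of the images of
  the compact elements below; compactness makes the extension preserve all joins.\<close>

lemma extend_from_compacts:
  assumes "lsf L1" "lsf L2"
    and h: "h \<in> carrier (algebra_of_frame L1) \<rightarrow>\<^sub>E carrier (algebra_of_frame L2)"
    and hom: "meet_hom (algebra_of_frame L1) (algebra_of_frame L2) h"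
  obtains \<alpha> where "\<alpha> \<in> extensional (carrier L1)" "lsf_sup_hom L1 L2 \<alpha>" "restrict \<alpha> (compacts L1) = h"
proof -
  interpret L1: lsf L1 by fact
  interpret L2: lsf L2 by fact
  have hk: "k \<in> compacts L1 \<Longrightarrow> h k \<in> compacts L2" for k using h by auto
  then have hc [simp]: "k \<in> compacts L1 \<Longrightarrow> h k \<in> carrier L2" for k by (auto dest: L2.compact_in_carrier)
  have h0: "h \<bottom>\<^bsub>L1\<^esub> = \<bottom>\<^bsub>L2\<^esub>"
    using hom by (simp add: meet_hom_def L1.algebra_of_frame_operations L2.algebra_of_frame_operations)
  have hj: "h (x \<squnion>\<^bsub>L1\<^esub> y) = h x \<squnion>\<^bsub>L2\<^esub> h y" if "x \<in> compacts L1" "y \<in> compacts L1" for x y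
    using hom that hk
    by (simp add: meet_hom_def L1.algebra_of_frame_operations L2.algebra_of_frame_operations)
  have hS: "h (\<Squnion>\<^bsub>L1\<^esub>B) = \<Squnion>\<^bsub>L2\<^esub>(h ` B)" if "finite B" "B \<subseteq> compacts L1" for B
    using that
  proof (induction B)
    case empty
    then show ?case using h0 by (simp add: L1.sup_empty L2.sup_empty)
  next
    case (insert x B)
    have "B \<subseteq> carrier L1" "h ` B \<subseteq> carrier L2" "\<Squnion>\<^bsub>L1\<^esub>B \<in> compacts L1"
      using insert by (auto dest: L1.compact_in_carrier intro: L1.finite_sup_compact)
    then show ?case
      using insert hj by (simp add: L1.sup_insert L2.sup_insert L1.compact_in_carrier)
  qed
  have hm: "h x \<sqsubseteq>\<^bsub>L2\<^esub> h y" if "x \<in> compacts L1" "y \<in> compacts L1" "x \<sqsubseteq>\<^bsub>L1\<^esub> y" for x y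
    using hj[of x y] that L1.le_iff_meet[of x y] L2.join_left[of "h x" "h y"]
    by (simp add: L1.compact_in_carrier)
  define below where "below x = {k \<in> compacts L1. k \<sqsubseteq>\<^bsub>L1\<^esub> x}" for x
  define \<alpha> where "\<alpha> = (\<lambda>x\<in>carrier L1. \<Squnion>\<^bsub>L2\<^esub>(h ` below x))"
  have below: "h ` below x \<subseteq> carrier L2" for x by (auto simp: below_def)
  have \<alpha>: "\<alpha> x = \<Squnion>\<^bsub>L2\<^esub>(h ` below x)" if "x \<in> carrier L1" for x using that by (simp add: \<alpha>_def)
  have \<alpha>c: "\<alpha> x \<in> carrier L2" if "x \<in> carrier L1" for x using below[of x] by (simp add: \<alpha>[OF that])
  have ext: "\<alpha> k = h k" if k: "k \<in> compacts L1" for k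
  proof (rule L2.le_antisym)
    have kc: "k \<in> carrier L1" using k by (rule L1.compact_in_carrier)
    show "\<alpha> k \<sqsubseteq>\<^bsub>L2\<^esub> h k"
      unfolding \<alpha>[OF kc] by (rule L2.sup_least[OF below]) (use k hm in \<open>auto simp: below_def\<close>)
    show "h k \<sqsubseteq>\<^bsub>L2\<^esub> \<alpha> k"
      unfolding \<alpha>[OF kc] by (rule L2.sup_upper[OF below]) (use k kc in \<open>auto simp: below_def\<close>)
  qed (use k \<alpha>c in \<open>auto dest: L1.compact_in_carrier\<close>)
  have mono: "\<alpha> x \<sqsubseteq>\<^bsub>L2\<^esub> \<alpha> y" if xy: "x \<in> carrier L1" "y \<in> carrier L1" "x \<sqsubseteq>\<^bsub>L1\<^esub> y" for x y
  proof -
    have "k \<sqsubseteq>\<^bsub>L1\<^esub> y" if "k \<in> below x" for k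
      using L1.le_trans[OF _ xy(3), of k] that xy by (simp add: below_def L1.compact_in_carrier)
    then have "below x \<subseteq> below y" by (auto simp: below_def)
    then show ?thesis
      unfolding \<alpha>[OF xy(1)] \<alpha>[OF xy(2)] by (intro L2.sup_subset below image_mono)
  qed
  have "\<alpha> (\<Squnion>\<^bsub>L1\<^esub>A) = \<Squnion>\<^bsub>L2\<^esub>(\<alpha> ` A)" if A: "A \<subseteq> carrier L1" for A
  proof (rule L2.le_antisym)
    have sA: "\<Squnion>\<^bsub>L1\<^esub>A \<in> carrier L1" and \<alpha>A: "\<alpha> ` A \<subseteq> carrier L2" using A \<alpha>c by auto
    then show c: "\<alpha> (\<Squnion>\<^bsub>L1\<^esub>A) \<in> carrier L2" "\<Squnion>\<^bsub>L2\<^esub>(\<alpha> ` A) \<in> carrier L2" using \<alpha>c by auto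
    show "\<Squnion>\<^bsub>L2\<^esub>(\<alpha> ` A) \<sqsubseteq>\<^bsub>L2\<^esub> \<alpha> (\<Squnion>\<^bsub>L1\<^esub>A)"
    proof (rule L2.sup_least[OF \<alpha>A c(1)])
      fix y assume "y \<in> \<alpha> ` A"
      then obtain a where "a \<in> A" "y = \<alpha> a" by auto
      then show "y \<sqsubseteq>\<^bsub>L2\<^esub> \<alpha> (\<Squnion>\<^bsub>L1\<^esub>A)" using mono[of a "\<Squnion>\<^bsub>L1\<^esub>A"] A sA L1.sup_upper[OF A] by auto
    qed
    show "\<alpha> (\<Squnion>\<^bsub>L1\<^esub>A) \<sqsubseteq>\<^bsub>L2\<^esub> \<Squnion>\<^bsub>L2\<^esub>(\<alpha> ` A)"
      unfolding \<alpha>[OF sA]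
    proof (rule L2.sup_least[OF below c(2)])
      fix y assume "y \<in> h ` below (\<Squnion>\<^bsub>L1\<^esub>A)"
      then obtain k where k: "k \<in> compacts L1" "k \<sqsubseteq>\<^bsub>L1\<^esub> \<Squnion>\<^bsub>L1\<^esub>A" "y = h k" by (auto simp: below_def)
      let ?K = "\<Union>a\<in>A. below a"
      have K: "?K \<subseteq> compacts L1" and Kc: "?K \<subseteq> carrier L1"
        by (auto simp: below_def dest: L1.compact_in_carrier)
      have "\<Squnion>\<^bsub>L1\<^esub>A \<sqsubseteq>\<^bsub>L1\<^esub> \<Squnion>\<^bsub>L1\<^esub>?K"
      proof (rule L1.sup_least[OF A])
        fix a assume a: "a \<in> A"
        have "\<Squnion>\<^bsub>L1\<^esub>(below a) \<sqsubseteq>\<^bsub>L1\<^esub> \<Squnion>\<^bsub>L1\<^esub>?K" by (rule L1.sup_subset[OF _ Kc]) (use a in auto)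
        then show "a \<sqsubseteq>\<^bsub>L1\<^esub> \<Squnion>\<^bsub>L1\<^esub>?K"
          using L1.sup_compacts_below[of a] a A by (auto simp: below_def)
      qed (use Kc in simp)
      then have "k \<sqsubseteq>\<^bsub>L1\<^esub> \<Squnion>\<^bsub>L1\<^esub>?K"
        using L1.le_trans[OF k(2)] sA Kc k(1) by (simp add: L1.compact_in_carrier)
      then obtain B where B: "B \<subseteq> ?K" "finite B" "\<Squnion>\<^bsub>L1\<^esub>B \<in> compacts L1" "k \<sqsubseteq>\<^bsub>L1\<^esub> \<Squnion>\<^bsub>L1\<^esub>B"
        by (rule L1.compact_sup_compacts[OF k(1) K])
      have BK: "B \<subseteq> compacts L1" using B K by auto
      then have hB: "h ` B \<subseteq> carrier L2" by auto
      have "h k \<sqsubseteq>\<^bsub>L2\<^esub> \<Squnion>\<^bsub>L2\<^esub>(h ` B)" using hm[OF k(1) B(3,4)] hS[OF B(2) BK] by simp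
      moreover have "\<Squnion>\<^bsub>L2\<^esub>(h ` B) \<sqsubseteq>\<^bsub>L2\<^esub> \<Squnion>\<^bsub>L2\<^esub>(\<alpha> ` A)"
      proof (rule L2.sup_mono[OF \<alpha>A])
        fix z assume "z \<in> h ` B"
        then obtain l where l: "l \<in> B" "z = h l" by auto
        then obtain a where a: "a \<in> A" "l \<in> below a" using B by auto
        then have "h l \<sqsubseteq>\<^bsub>L2\<^esub> \<alpha> a"
          using A by (subst \<alpha>) (auto intro: L2.sup_upper[OF below])
        then show "z \<in> carrier L2 \<and> (\<exists>b\<in>\<alpha> ` A. z \<sqsubseteq>\<^bsub>L2\<^esub> b)" using l a BK by auto
      qed
      ultimately show "y \<sqsubseteq>\<^bsub>L2\<^esub> \<Squnion>\<^bsub>L2\<^esub>(\<alpha> ` A)"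
        using L2.le_trans[of "h k" "\<Squnion>\<^bsub>L2\<^esub>(h ` B)"] k hB c by simp
    qed
  qed
  then have "lsf_sup_hom L1 L2 \<alpha>"
    by unfold_locales (use \<alpha>c ext hk in \<open>auto simp: preserves_joins_def preserves_compacts_def\<close>)
  moreover have "restrict \<alpha> (compacts L1) = h"
    using h ext by (auto simp: fun_eq_iff PiE_def extensional_def)
  moreover have "\<alpha> \<in> extensional (carrier L1)" by (simp add: \<alpha>_def)
  ultimately show ?thesis using that by blast
qed

lemma sup_homs_equal:
  assumes "lsf_sup_hom L1 L2 \<alpha>" "lsf_sup_hom L1 L2 \<beta>"
    and eq: "restrict \<alpha> (compacts L1) = restrict \<beta> (compacts L1)" and x: "x \<in> carrier L1"
  shows "\<alpha> x = \<beta> x"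
proof -
  interpret a: lsf_sup_hom L1 L2 \<alpha> by fact
  interpret b: lsf_sup_hom L1 L2 \<beta> by fact
  let ?A = "{k \<in> compacts L1. k \<sqsubseteq>\<^bsub>L1\<^esub> x}"
  have "\<alpha> k = \<beta> k" if "k \<in> compacts L1" for k
    using fun_cong[OF eq, of k] that by simp
  then have "\<alpha> ` ?A = \<beta> ` ?A" by (intro image_cong) auto
  moreover have "?A \<subseteq> carrier L1" by (auto dest: a.L1.compact_in_carrier)
  ultimately have "\<alpha> (\<Squnion>\<^bsub>L1\<^esub>?A) = \<beta> (\<Squnion>\<^bsub>L1\<^esub>?A)" by (simp add: a.map_sup b.map_sup)
  then show ?thesis using a.L1.sup_compacts_below[OF x] by simp
qed

lemma Ob_LStoneFrm_Sup: "Ob LStoneFrm_Sup = {L. locally_Stone_frame L}"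
  by (simp add: LStoneFrm_Sup_def concrete_def)

lemma category_LStoneFrm_Sup: "category LStoneFrm_Sup"
  unfolding LStoneFrm_Sup_def
proof (rule category_concrete)
  fix L :: "'a gorder" assume "L \<in> {L. locally_Stone_frame L}"
  then interpret lsf L by unfold_locales simp
  have "\<Squnion>\<^bsub>L\<^esub>A \<in> carrier L" if "A \<subseteq> carrier L" for A using that by simp
  moreover have "restrict (\<lambda>x. x) (carrier L) ` A = A" if "A \<subseteq> carrier L" for A using that by auto
  ultimately show "preserves_joins L L (\<lambda>x\<in>carrier L. x) \<and> preserves_compacts L L (\<lambda>x\<in>carrier L. x)"
    by (auto simp: preserves_joins_def preserves_compacts_def compact_in_carrier)
next
  fix L1 L2 L3 :: "'a gorder" and f g
  assume "L1 \<in> {L. locally_Stone_frame L}" "L2 \<in> {L. locally_Stone_frame L}" "L3 \<in> {L. locally_Stone_frame L}"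
    and fg: "f \<in> carrier L1 \<rightarrow>\<^sub>E carrier L2" "g \<in> carrier L2 \<rightarrow>\<^sub>E carrier L3"
      "preserves_joins L1 L2 f \<and> preserves_compacts L1 L2 f"
      "preserves_joins L2 L3 g \<and> preserves_compacts L2 L3 g"
  then interpret f: lsf_sup_hom L1 L2 f by unfold_locales auto
  interpret g: lsf_sup_hom L2 L3 g
    by unfold_locales (use \<open>L3 \<in> _\<close> fg in auto)
  have "compose (carrier L1) g f (\<Squnion>\<^bsub>L1\<^esub>A) = \<Squnion>\<^bsub>L3\<^esub>(compose (carrier L1) g f ` A)"
    if A: "A \<subseteq> carrier L1" for A
  proof -
    have "compose (carrier L1) g f ` A = g ` f ` A"
      using A by (auto simp: compose_def image_iff subset_iff)
    moreover have "f ` A \<subseteq> carrier L2" using A by auto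
    ultimately show ?thesis using A by (simp add: compose_def f.map_sup g.map_sup)
  qed
  then show "preserves_joins L1 L3 (compose (carrier L1) g f) \<and>
      preserves_compacts L1 L3 (compose (carrier L1) g f)"
    by (auto simp: preserves_joins_def preserves_compacts_def compose_def f.L1.compact_in_carrier)
qed

abbreviation restrict_to_compacts :: "'f gorder \<Rightarrow> 'f gorder \<Rightarrow> ('f \<Rightarrow> 'f) \<Rightarrow> 'f \<Rightarrow> 'f" where
  "restrict_to_compacts L1 L2 \<alpha> \<equiv> restrict \<alpha> (compacts L1)"

lemma representation_LStoneFrm_Sup:
  "representation (LStoneFrm_Sup :: ('f gorder, 'f \<Rightarrow> 'f) precategory) preserves_finite_meets
    algebra_of_frame restrict_to_compacts"
proof (rule representation.intro)
  fix L1 :: "'f gorder" assume "L1 \<in> Ob LStoneFrm_Sup"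
  then interpret lsf L1 by unfold_locales (simp add: Ob_LStoneFrm_Sup)
  show "gba (algebra_of_frame L1)" by (rule gba_algebra_of_frame)
  show "restrict_to_compacts L1 L1 (Idm LStoneFrm_Sup L1) = (\<lambda>x\<in>carrier (algebra_of_frame L1). x)"
    by (auto simp: fun_eq_iff LStoneFrm_Sup_def concrete_def restrict_def compact_in_carrier)
next
  fix L1 L2 :: "'f gorder" and \<alpha>
  assume "L1 \<in> Ob LStoneFrm_Sup" "L2 \<in> Ob LStoneFrm_Sup" "\<alpha> \<in> Hom LStoneFrm_Sup L1 L2"
  then interpret lsf_sup_hom L1 L2 \<alpha> by (simp add: Ob_LStoneFrm_Sup Hom_LStoneFrm_Sup)
  show "restrict_to_compacts L1 L2 \<alpha> \<in> carrier (algebra_of_frame L1) \<rightarrow>\<^sub>E carrier (algebra_of_frame L2)"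
    by (rule restriction_in)
  then have "gba_map (algebra_of_frame L1) (algebra_of_frame L2) restriction"
    by (simp add: gba_map_def gba_map_axioms_def L1.gba_algebra_of_frame L2.gba_algebra_of_frame)
  then show "preserves_finite_meets (algebra_of_frame L1) (algebra_of_frame L2) (restrict_to_compacts L1 L2 \<alpha>)"
    using meet_hom_restriction by (simp add: gba_map.preserves_finite_meets_iff)
next
  fix L1 L2 :: "'f gorder" and h
  assume L: "L1 \<in> Ob LStoneFrm_Sup" "L2 \<in> Ob LStoneFrm_Sup"
    and h: "h \<in> carrier (algebra_of_frame L1) \<rightarrow>\<^sub>E carrier (algebra_of_frame L2)"
      "preserves_finite_meets (algebra_of_frame L1) (algebra_of_frame L2) h"
  have l: "lsf L1" "lsf L2" using L by (simp_all add: lsf_def Ob_LStoneFrm_Sup)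
  have "gba_map (algebra_of_frame L1) (algebra_of_frame L2) h"
    using l h(1) by (simp add: gba_map_def gba_map_axioms_def lsf.gba_algebra_of_frame PiE_def
        del: carrier_algebra_of_frame)
  then have "meet_hom (algebra_of_frame L1) (algebra_of_frame L2) h"
    using h(2) by (simp add: gba_map.preserves_finite_meets_iff)
  then obtain \<alpha> where "\<alpha> \<in> extensional (carrier L1)" "lsf_sup_hom L1 L2 \<alpha>" "restrict \<alpha> (compacts L1) = h"
    by (rule extend_from_compacts[OF l h(1)])
  then show "\<exists>\<alpha>\<in>Hom LStoneFrm_Sup L1 L2. restrict_to_compacts L1 L2 \<alpha> = h"
    using L by (intro bexI[of _ \<alpha>]) (simp_all add: Ob_LStoneFrm_Sup Hom_LStoneFrm_Sup)
next
  fix L1 L2 :: "'f gorder" and \<alpha> \<beta>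
  assume L: "L1 \<in> Ob LStoneFrm_Sup" "L2 \<in> Ob LStoneFrm_Sup"
    and *: "\<alpha> \<in> Hom LStoneFrm_Sup L1 L2" "\<beta> \<in> Hom LStoneFrm_Sup L1 L2"
    and eq: "restrict_to_compacts L1 L2 \<alpha> = restrict_to_compacts L1 L2 \<beta>"
  show "\<alpha> = \<beta>"
    by (rule extensionalityI[of _ "carrier L1"])
      (use L * sup_homs_equal[of L1 L2 \<alpha> \<beta>, OF _ _ eq] in \<open>simp_all add: Ob_LStoneFrm_Sup Hom_LStoneFrm_Sup\<close>)
next
  fix L1 L2 L3 :: "'f gorder" and \<alpha> \<beta>
  assume "L1 \<in> Ob LStoneFrm_Sup" "L2 \<in> Ob LStoneFrm_Sup" "L3 \<in> Ob LStoneFrm_Sup"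
    "\<alpha> \<in> Hom LStoneFrm_Sup L1 L2" "\<beta> \<in> Hom LStoneFrm_Sup L2 L3"
  then interpret lsf_sup_hom L1 L2 \<alpha> by (simp add: Ob_LStoneFrm_Sup Hom_LStoneFrm_Sup)
  show "restrict_to_compacts L1 L3 (Comp LStoneFrm_Sup L1 L2 L3 \<beta> \<alpha>) =
      compose (carrier (algebra_of_frame L1)) (restrict_to_compacts L2 L3 \<beta>) (restrict_to_compacts L1 L2 \<alpha>)"
    by (auto simp: fun_eq_iff LStoneFrm_Sup_def concrete_def compose_def restrict_def L1.compact_in_carrier)
qed


section \<open>Pointed Stone spaces and their admissible clopen sets\<close>

text \<open>The form in which compactness of spaces is used: an inclusion of a filtered intersection of
  closed sets in a directed union of open sets is witnessed by single members.\<close>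

lemma compact_interpolation:
  assumes T: "compact_space T" and sub: "\<Inter>\<F> \<subseteq> \<Union>\<N>"
    and F: "\<F> \<noteq> {}" "\<And>V. V \<in> \<F> \<Longrightarrow> closedin T V" "\<And>V V'. \<lbrakk>V \<in> \<F>; V' \<in> \<F>\<rbrakk> \<Longrightarrow> V \<inter> V' \<in> \<F>"
    and N: "\<N> \<noteq> {}" "\<And>U. U \<in> \<N> \<Longrightarrow> openin T U" "\<And>U U'. \<lbrakk>U \<in> \<N>; U' \<in> \<N>\<rbrakk> \<Longrightarrow> U \<union> U' \<in> \<N>"
  obtains V U where "V \<in> \<F>" "U \<in> \<N>" "V \<subseteq> U"
proof -
  let ?c = "\<lambda>V. topspace T - V"
  have Int: "\<Inter>\<F>' \<in> \<F>" if "finite \<F>'" "\<F>' \<noteq> {}" "\<F>' \<subseteq> \<F>" for \<F>'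
    using that by (induction \<F>' rule: finite_ne_induct) (auto intro: F(3))
  have Un: "\<Union>\<N>' \<in> \<N>" if "finite \<N>'" "\<N>' \<noteq> {}" "\<N>' \<subseteq> \<N>" for \<N>'
    using that by (induction \<N>' rule: finite_ne_induct) (auto intro: N(3))
  obtain V0 U0 where VU: "V0 \<in> \<F>" "U0 \<in> \<N>" using F(1) N(1) by auto
  have "topspace T \<subseteq> \<Union>(?c ` \<F> \<union> \<N>)" using sub by auto
  moreover have "openin T W" if "W \<in> ?c ` \<F> \<union> \<N>" for W using that F(2) N(2) by auto
  ultimately obtain \<G> where G: "finite \<G>" "\<G> \<subseteq> ?c ` \<F> \<union> \<N>" "topspace T \<subseteq> \<Union>\<G>"
    using T unfolding compact_space_alt by meson
  have "finite (\<G> - \<N>)" "\<G> - \<N> \<subseteq> ?c ` \<F>" using G by auto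
  then obtain \<F>' where F': "finite \<F>'" "\<F>' \<subseteq> \<F>" "\<G> - \<N> = ?c ` \<F>'" by (meson finite_subset_image)
  have V: "\<Inter>(insert V0 \<F>') \<in> \<F>" by (rule Int) (use VU F' in auto)
  have U: "\<Union>(insert U0 (\<G> \<inter> \<N>)) \<in> \<N>" by (rule Un) (use VU G in auto)
  have "topspace T \<subseteq> \<Union>(?c ` \<F>' \<union> (\<G> \<inter> \<N>))" unfolding F'(3)[symmetric] using G(3) by auto
  moreover have "\<Inter>(insert V0 \<F>') \<subseteq> topspace T" by (rule closedin_subset[OF F(2)[OF V]])
  ultimately have "\<Inter>(insert V0 \<F>') \<subseteq> \<Union>(insert U0 (\<G> \<inter> \<N>))" by auto
  then show ?thesis by (rule that[OF V U])
qed

locale stone =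
  fixes X :: "'x pointed_ospace"
  assumes stone: "pointed_Stone_space X"
begin

lemma compact: "compact_space (topo X)"
  and pt_in [simp]: "pt X \<in> pts X"
  and core_eq: "core X = pts X - {pt X}"
  using stone
  by (simp_all add: pointed_Stone_space_def pointed_Priestley_space_def
      pointed_generalized_Priestley_space_def Priestley_space_def)

lemma leq_iff: "(x, y) \<in> leq X \<longleftrightarrow> x \<in> pts X \<and> y \<in> pts X \<and> (x = y \<or> y = pt X)"
proof -
  have po: "partial_order_on (pts X) (leq X)"
    using stone
    unfolding pointed_Stone_space_def pointed_Priestley_space_def
      pointed_generalized_Priestley_space_def Priestley_space_def
    by (elim conjE)
  have max: "\<forall>x\<in>pts X. (x, pt X) \<in> leq X"
    using stone
    unfolding pointed_Stone_space_def pointed_Priestley_space_def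
      pointed_generalized_Priestley_space_def Priestley_space_def
    by (elim conjE)
  have triv: "\<forall>x\<in>pts X - {pt X}. \<forall>y\<in>pts X - {pt X}. (x, y) \<in> leq X \<longleftrightarrow> x = y"
    using stone
    unfolding pointed_Stone_space_def pointed_Priestley_space_def
      pointed_generalized_Priestley_space_def Priestley_space_def
    by (elim conjE)
  have sub: "leq X \<subseteq> pts X \<times> pts X" and anti: "antisym (leq X)" and refl: "refl_on (pts X) (leq X)"
    using po by (simp_all add: partial_order_on_def preorder_on_def)
  show ?thesis
  proof
    assume xy: "(x, y) \<in> leq X"
    then have c: "x \<in> pts X" "y \<in> pts X" using sub by auto
    have "x = y" if "y \<noteq> pt X"
    proof (cases "x = pt X")
      case True
      then show ?thesis using antisymD[OF anti xy] max c(2) by simp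
    next
      case False
      then show ?thesis using triv c False that xy by simp
    qed
    then show "x \<in> pts X \<and> y \<in> pts X \<and> (x = y \<or> y = pt X)" using c by auto
  next
    assume "x \<in> pts X \<and> y \<in> pts X \<and> (x = y \<or> y = pt X)"
    then show "(x, y) \<in> leq X" using max refl_onD[OF refl] by auto
  qed
qed

text \<open>If a clopen upset misses the point at infinity, it is empty, and then that point is the
  maximal point of its complement.\<close>

lemma admissible_iff: "U \<in> admissible X \<longleftrightarrow> openin (topo X) U \<and> closedin (topo X) U \<and> pt X \<in> U"
proof
  assume U: "U \<in> admissible X"
  have "pt X \<in> U"
  proof (rule ccontr)
    assume "pt X \<notin> U"
    then have "pt X \<in> maximal_points (leq X) (pts X - U)"
      by (auto simp: maximal_points_def leq_iff)
    then show False using U by (auto simp: admissible_def core_eq)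
  qed
  then show "openin (topo X) U \<and> closedin (topo X) U \<and> pt X \<in> U"
    using U by (simp add: admissible_def clopen_upsets_def)
next
  assume "openin (topo X) U \<and> closedin (topo X) U \<and> pt X \<in> U"
  then show "U \<in> admissible X"
    by (auto simp: admissible_def clopen_upsets_def maximal_points_def leq_iff core_eq)
qed

lemma admissible_subset: "U \<in> admissible X \<Longrightarrow> U \<subseteq> pts X"
  by (auto simp: admissible_iff dest: openin_subset)

lemma pts_admissible [simp]: "pts X \<in> admissible X"
  by (simp add: admissible_iff)

lemma Int_admissible [simp]: "\<lbrakk>U \<in> admissible X; V \<in> admissible X\<rbrakk> \<Longrightarrow> U \<inter> V \<in> admissible X"
  by (simp add: admissible_iff openin_Int closedin_Int)

lemma Un_admissible [simp]: "\<lbrakk>U \<in> admissible X; V \<in> admissible X\<rbrakk> \<Longrightarrow> U \<union> V \<in> admissible X"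
  by (simp add: admissible_iff openin_Un closedin_Un)

lemma separation:
  assumes "x \<in> pts X" "y \<in> pts X" "x \<noteq> pt X" "y \<noteq> x"
  obtains U where "U \<in> admissible X" "y \<in> U" "x \<notin> U"
proof -
  have "\<forall>x\<in>pts X. \<forall>y\<in>pts X. (x, y) \<notin> leq X \<longrightarrow> (\<exists>U\<in>clopen_upsets (topo X) (leq X). x \<in> U \<and> y \<notin> U)"
    using stone
    by (simp add: pointed_Stone_space_def pointed_Priestley_space_def
        pointed_generalized_Priestley_space_def Priestley_space_def)
  moreover have "(y, x) \<notin> leq X" using assms by (simp add: leq_iff)
  ultimately obtain U where U: "U \<in> clopen_upsets (topo X) (leq X)" "y \<in> U" "x \<notin> U"
    using assms by blast
  then have "pt X \<in> U" using assms by (auto simp: clopen_upsets_def leq_iff)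
  then show ?thesis using that[of U] U by (simp add: admissible_iff clopen_upsets_def)
qed

lemma points_equal:
  assumes "x \<in> pts X" "y \<in> pts X" "\<And>U. U \<in> admissible X \<Longrightarrow> x \<in> U \<longleftrightarrow> y \<in> U"
  shows "x = y"
proof (rule ccontr)
  assume ne: "x \<noteq> y"
  show False
  proof (cases "x = pt X")
    case True
    then obtain U where "U \<in> admissible X" "x \<in> U" "y \<notin> U"
      using separation[of y x] assms ne by auto
    then show False using assms(3) by simp
  next
    case False
    then obtain U where "U \<in> admissible X" "y \<in> U" "x \<notin> U"
      using separation[of x y] assms ne by auto
    then show False using assms(3) by simp
  qed
qed

lemma Inter_admissible: "\<Inter>(admissible X) = {pt X}"
proof (intro equalityI subsetI)
  fix x assume x: "x \<in> \<Inter>(admissible X)"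
  then have "x \<in> pts X" by (rule InterD) simp
  then show "x \<in> {pt X}" using separation[of x "pt X"] x by auto
qed (auto simp: admissible_iff)

lemma closedin_pt: "closedin (topo X) {pt X}"
proof -
  have "admissible X \<noteq> {}" using pts_admissible by blast
  then show ?thesis
    unfolding Inter_admissible[symmetric] by (intro closedin_Inter) (auto simp: admissible_iff)
qed

end

definition algebra_of_space :: "'x pointed_ospace \<Rightarrow> 'x set gorder" where
  "algebra_of_space X = \<lparr>carrier = admissible X, eq = (=), le = (\<subseteq>)\<rparr>"

lemma carrier_algebra_of_space [simp]: "carrier (algebra_of_space X) = admissible X"
  by (simp add: algebra_of_space_def)

lemma le_algebra_of_space [simp]: "U \<sqsubseteq>\<^bsub>algebra_of_space X\<^esub> V \<longleftrightarrow> U \<subseteq> V"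
  by (simp add: algebra_of_space_def)

context stone
begin

lemma gba_operations_algebra_of_space: "gba_operations (algebra_of_space X) (\<inter>) (\<union>) (pts X)"
proof -
  have "partial_order (algebra_of_space X)"
    by (rule partial_orderI) (auto simp: algebra_of_space_def)
  then interpret A: partial_order "algebra_of_space X" .
  show ?thesis
  proof unfold_locales
    fix U V
    assume "U \<in> carrier (algebra_of_space X)" "V \<in> carrier (algebra_of_space X)" "U \<sqsubseteq>\<^bsub>algebra_of_space X\<^esub> V"
    then have UV: "U \<in> admissible X" "V \<in> admissible X" "U \<subseteq> V" by simp_all
    show "\<exists>W\<in>carrier (algebra_of_space X). V \<inter> W = U \<and> V \<union> W = pts X"
    proof
      show "U \<union> (pts X - V) \<in> carrier (algebra_of_space X)"
        using UV by (simp add: admissible_iff openin_Un closedin_Un openin_diff closedin_diff)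
      show "V \<inter> (U \<union> (pts X - V)) = U \<and> V \<union> (U \<union> (pts X - V)) = pts X"
        using UV admissible_subset by auto
    qed
  qed (simp_all add: Int_Un_distrib admissible_subset)
qed

lemma gba_algebra_of_space: "gba (algebra_of_space X)"
  by (rule gba_operations.gba_axioms[OF gba_operations_algebra_of_space])

lemma algebra_of_space_operations:
  "\<top>\<^bsub>algebra_of_space X\<^esub> = pts X"
  "\<lbrakk>U \<in> admissible X; V \<in> admissible X\<rbrakk> \<Longrightarrow> U \<sqinter>\<^bsub>algebra_of_space X\<^esub> V = U \<inter> V"
  "\<lbrakk>U \<in> admissible X; V \<in> admissible X\<rbrakk> \<Longrightarrow> U \<squnion>\<^bsub>algebra_of_space X\<^esub> V = U \<union> V"
proof -
  interpret A: gba_operations "algebra_of_space X" "(\<inter>)" "(\<union>)" "pts X"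
    by (rule gba_operations_algebra_of_space)
  show "\<top>\<^bsub>algebra_of_space X\<^esub> = pts X" by (rule A.top_eq)
  show "U \<sqinter>\<^bsub>algebra_of_space X\<^esub> V = U \<inter> V" "U \<squnion>\<^bsub>algebra_of_space X\<^esub> V = U \<union> V"
    if "U \<in> admissible X" "V \<in> admissible X"
    using that A.meet_eq[of U V] A.join_eq[of U V] by simp_all
qed

text \<open>The admissible sets intersect in the point at infinity, so a least one can only be its
  singleton.\<close>

lemma algebra_of_space_bottom:
  "weak_partial_order_bottom (algebra_of_space X) \<longleftrightarrow> openin (topo X) {pt X}"
  "openin (topo X) {pt X} \<Longrightarrow> \<bottom>\<^bsub>algebra_of_space X\<^esub> = {pt X}"
proof -
  interpret A: gba "algebra_of_space X" by (rule gba_algebra_of_space)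
  have adm: "{pt X} \<in> admissible X" if "openin (topo X) {pt X}"
    using that closedin_pt by (simp add: admissible_iff)
  show "\<bottom>\<^bsub>algebra_of_space X\<^esub> = {pt X}" if "openin (topo X) {pt X}"
    by (rule A.bottom_eqI) (use adm[OF that] in \<open>auto simp: admissible_iff\<close>)
  show "weak_partial_order_bottom (algebra_of_space X) \<longleftrightarrow> openin (topo X) {pt X}"
    unfolding A.has_bottom_iff
  proof
    assume "\<exists>b\<in>carrier (algebra_of_space X). \<forall>U\<in>carrier (algebra_of_space X). b \<sqsubseteq>\<^bsub>algebra_of_space X\<^esub> U"
    then obtain B where B: "B \<in> admissible X" "\<And>U. U \<in> admissible X \<Longrightarrow> B \<subseteq> U" by auto
    then have "B \<subseteq> \<Inter>(admissible X)" by auto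
    then have "B = {pt X}" using B(1) unfolding Inter_admissible by (auto simp: admissible_iff)
    then show "openin (topo X) {pt X}" using B(1) by (simp add: admissible_iff)
  next
    assume "openin (topo X) {pt X}"
    then show "\<exists>b\<in>carrier (algebra_of_space X). \<forall>U\<in>carrier (algebra_of_space X). b \<sqsubseteq>\<^bsub>algebra_of_space X\<^esub> U"
      using adm by (intro bexI[of _ "{pt X}"]) (auto simp: admissible_iff)
  qed
qed

end

text \<open>Homomorphisms of the algebras of two spaces, in the direction opposite to maps of spaces.\<close>

locale space_hom = X: stone X + Y: stone Y for X Y :: "'x pointed_ospace" +
  fixes h :: "'x set \<Rightarrow> 'x set"
  assumes in_admissible: "U \<in> admissible Y \<Longrightarrow> h U \<in> admissible X"
    and meet_hom: "meet_hom (algebra_of_space Y) (algebra_of_space X) h"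
begin

lemma map_pts: "h (pts Y) = pts X"
  using meet_hom by (simp add: meet_hom_def X.algebra_of_space_operations Y.algebra_of_space_operations)

lemma map_Int: "\<lbrakk>U \<in> admissible Y; V \<in> admissible Y\<rbrakk> \<Longrightarrow> h (U \<inter> V) = h U \<inter> h V"
  using meet_hom
  by (simp add: meet_hom_def X.algebra_of_space_operations Y.algebra_of_space_operations in_admissible)

lemma map_mono:
  assumes "U \<in> admissible Y" "V \<in> admissible Y" "U \<subseteq> V"
  shows "h U \<subseteq> h V"
  using map_Int[OF assms(1,2)] assms(3) by (auto simp: Int_absorb2)

text \<open>The filter of the admissible sets whose image contains a given point is the object to which
  compactness of \<open>Y\<close> is applied.\<close>

lemma filter_at:
  assumes "x \<in> pts X"
  shows "{V \<in> admissible Y. x \<in> h V} \<noteq> {}"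
    "\<And>V. V \<in> {V \<in> admissible Y. x \<in> h V} \<Longrightarrow> closedin (topo Y) V"
    "\<And>V V'. \<lbrakk>V \<in> {V \<in> admissible Y. x \<in> h V}; V' \<in> {V \<in> admissible Y. x \<in> h V}\<rbrakk>
      \<Longrightarrow> V \<inter> V' \<in> {V \<in> admissible Y. x \<in> h V}"
proof -
  have "pts Y \<in> {V \<in> admissible Y. x \<in> h V}" using assms by (simp add: map_pts)
  then show "{V \<in> admissible Y. x \<in> h V} \<noteq> {}" by blast
qed (auto simp: map_Int dest: Y.admissible_iff[THEN iffD1])

end

lemma space_homI:
  assumes "stone X" "stone Y" "\<And>U. U \<in> admissible Y \<Longrightarrow> h U \<in> admissible X" "h (pts Y) = pts X"
    and "\<And>U V. \<lbrakk>U \<in> admissible Y; V \<in> admissible Y\<rbrakk> \<Longrightarrow> h (U \<inter> V) = h U \<inter> h V"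
  shows "space_hom X Y h"
  using assms
  by (simp add: space_hom_def space_hom_axioms_def meet_hom_def stone.algebra_of_space_operations)

lemma preserves_finite_meets_iff_space_hom:
  assumes "stone X" "stone Y" "\<And>U. U \<in> admissible Y \<Longrightarrow> h U \<in> admissible X"
  shows "preserves_finite_meets (algebra_of_space Y) (algebra_of_space X) h \<longleftrightarrow> space_hom X Y h"
proof -
  have "gba_map (algebra_of_space Y) (algebra_of_space X) h"
    using assms by (simp add: gba_map_def gba_map_axioms_def stone.gba_algebra_of_space)
  then show ?thesis
    using assms by (simp add: gba_map.preserves_finite_meets_iff space_hom_def space_hom_axioms_def)
qed


section \<open>Generalized Priestley morphisms\<close>

definition relation_of_hom ::
  "'x pointed_ospace \<Rightarrow> 'x pointed_ospace \<Rightarrow> ('x set \<Rightarrow> 'x set) \<Rightarrow> ('x \<times> 'x) set"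
where
  "relation_of_hom X Y h = {(x, y) \<in> pts X \<times> pts Y. \<forall>U\<in>admissible Y. x \<in> h U \<longrightarrow> y \<in> U}"

context space_hom
begin

text \<open>If every \<open>y\<close> related to \<open>x\<close> lies in \<open>U\<close>, then the intersection of the admissible sets \<open>V\<close> with
  \<open>x \<in> h V\<close> is contained in \<open>U\<close>, and by compactness already one of these sets is.\<close>

lemma box_relation_of_hom:
  assumes U: "U \<in> admissible Y"
  shows "box X (relation_of_hom X Y h) U = h U"
proof (intro equalityI subsetI)
  fix x assume "x \<in> h U"
  moreover have "h U \<subseteq> pts X" using U by (intro X.admissible_subset in_admissible)
  ultimately show "x \<in> box X (relation_of_hom X Y h) U"
    using U by (auto simp: box_def relation_of_hom_def)
next
  fix x assume x: "x \<in> box X (relation_of_hom X Y h) U"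
  then have xX: "x \<in> pts X" by (simp add: box_def)
  have "y \<in> U" if y: "y \<in> \<Inter>{V \<in> admissible Y. x \<in> h V}" for y
  proof -
    have "y \<in> pts Y" by (rule InterD[OF y]) (use xX in \<open>simp add: map_pts\<close>)
    then have "(x, y) \<in> relation_of_hom X Y h" using xX y by (auto simp: relation_of_hom_def)
    then show ?thesis using x by (auto simp: box_def)
  qed
  then have "\<Inter>{V \<in> admissible Y. x \<in> h V} \<subseteq> \<Union>{U}" by auto
  then obtain V W where "V \<in> {V \<in> admissible Y. x \<in> h V}" "W \<in> {U}" "V \<subseteq> W"
    by (rule compact_interpolation[OF Y.compact _ filter_at[OF xX]]) (use U in \<open>auto simp: Y.admissible_iff\<close>)
  then show "x \<in> h U" using map_mono[of V U] U by auto
qed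

lemma relation_of_hom_morphism: "generalized_Priestley_morphism X Y (relation_of_hom X Y h)"
  unfolding generalized_Priestley_morphism_def
proof (intro conjI ballI impI)
  fix x y assume *: "x \<in> pts X" "y \<in> pts Y" "(x, y) \<notin> relation_of_hom X Y h"
  then obtain U where "U \<in> admissible Y" "x \<in> h U" "y \<notin> U" by (auto simp: relation_of_hom_def)
  then show "\<exists>U\<in>admissible Y. relation_of_hom X Y h `` {x} \<subseteq> U \<and> y \<notin> U"
    by (intro bexI[of _ U]) (auto simp: relation_of_hom_def)
qed (simp_all add: box_relation_of_hom in_admissible, auto simp: relation_of_hom_def)

end

lemma morphism_eq_relation_of_box:
  assumes R: "generalized_Priestley_morphism X Y R"
  shows "R = relation_of_hom X Y (box X R)"
proof -
  have "(x, y) \<in> R \<longleftrightarrow> (x, y) \<in> relation_of_hom X Y (box X R)" for x y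
  proof
    assume "(x, y) \<in> R"
    then show "(x, y) \<in> relation_of_hom X Y (box X R)"
      using R by (auto simp: generalized_Priestley_morphism_def relation_of_hom_def box_def)
  next
    assume *: "(x, y) \<in> relation_of_hom X Y (box X R)"
    show "(x, y) \<in> R"
    proof (rule ccontr)
      assume "(x, y) \<notin> R"
      moreover have xy: "x \<in> pts X" "y \<in> pts Y" using * by (auto simp: relation_of_hom_def)
      ultimately obtain U where "U \<in> admissible Y" "R `` {x} \<subseteq> U" "y \<notin> U"
        using R unfolding generalized_Priestley_morphism_def by blast
      then show False using * xy by (auto simp: relation_of_hom_def box_def)
    qed
  qed
  then show ?thesis by auto
qed

lemma space_hom_box:
  assumes "stone X" "stone Y" "generalized_Priestley_morphism X Y R"
  shows "space_hom X Y (box X R)"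
  by (rule space_homI) (use assms in \<open>auto simp: generalized_Priestley_morphism_def box_def\<close>)

text \<open>The composite is the relation of the composite of the box operators, which determines it.\<close>

lemma
  assumes "stone X" "stone Y" "stone Z"
    and R: "generalized_Priestley_morphism X Y R" and S: "generalized_Priestley_morphism Y Z S"
  shows star_comp_morphism: "generalized_Priestley_morphism X Z (star_comp X Y Z S R)"
    and box_star_comp: "U \<in> admissible Z \<Longrightarrow> box X (star_comp X Y Z S R) U = box X R (box Y S U)"
proof -
  interpret R: space_hom X Y "box X R" by (rule space_hom_box) fact+
  interpret S: space_hom Y Z "box Y S" by (rule space_hom_box) fact+
  interpret space_hom X Z "\<lambda>U. box X R (box Y S U)"
    by (rule space_homI[OF assms(1,3)])
      (simp_all add: R.in_admissible S.in_admissible R.map_pts S.map_pts R.map_Int S.map_Int)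
  have "star_comp X Y Z S R = relation_of_hom X Z (\<lambda>U. box X R (box Y S U))"
    by (simp add: star_comp_def relation_of_hom_def)
  then show "generalized_Priestley_morphism X Z (star_comp X Y Z S R)"
    and "U \<in> admissible Z \<Longrightarrow> box X (star_comp X Y Z S R) U = box X R (box Y S U)"
    using relation_of_hom_morphism box_relation_of_hom by simp_all
qed

lemma (in stone) box_leq: "U \<in> admissible X \<Longrightarrow> box X (leq X) U = U"
  using admissible_subset[of U] by (auto simp: box_def leq_iff admissible_iff)

lemma (in stone) leq_morphism: "generalized_Priestley_morphism X X (leq X)"
  unfolding generalized_Priestley_morphism_def
proof (intro conjI ballI impI)
  fix x y assume *: "x \<in> pts X" "y \<in> pts X" "(x, y) \<notin> leq X"
  then obtain U where "U \<in> admissible X" "x \<in> U" "y \<notin> U"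
    using separation[of y x] by (auto simp: leq_iff)
  then show "\<exists>U\<in>admissible X. leq X `` {x} \<subseteq> U \<and> y \<notin> U"
    by (intro bexI[of _ U]) (auto simp: leq_iff admissible_iff)
qed (auto simp: leq_iff box_leq)

abbreviation box_map :: "'x pointed_ospace \<Rightarrow> 'x pointed_ospace \<Rightarrow> ('x \<times> 'x) set \<Rightarrow> 'x set \<Rightarrow> 'x set" where
  "box_map Y X R \<equiv> \<lambda>U\<in>admissible Y. box X R U"

lemma representation_PStone:
  "representation (opposite (PStone :: ('x pointed_ospace, ('x \<times> 'x) set) precategory))
     preserves_finite_meets algebra_of_space box_map"
proof (rule representation.intro)
  let ?C = "opposite (PStone :: ('x pointed_ospace, ('x \<times> 'x) set) precategory)"
  note [simp] = opposite_def PStone_def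
  fix X :: "'x pointed_ospace" assume "X \<in> Ob ?C"
  then interpret stone X by unfold_locales simp
  show "gba (algebra_of_space X)" by (rule gba_algebra_of_space)
  show "box_map X X (Idm ?C X) = (\<lambda>U\<in>carrier (algebra_of_space X). U)"
    by (auto simp: fun_eq_iff restrict_def box_leq)
next
  let ?C = "opposite (PStone :: ('x pointed_ospace, ('x \<times> 'x) set) precategory)"
  note [simp] = opposite_def PStone_def
  fix Y X :: "'x pointed_ospace"
  assume ob: "Y \<in> Ob ?C" "X \<in> Ob ?C"
  then interpret X: stone X + Y: stone Y by unfold_locales simp_all
  {
    fix R assume "R \<in> Hom ?C Y X"
    then have R: "generalized_Priestley_morphism X Y R" by simp
    interpret space_hom X Y "box X R" by (rule space_hom_box) (unfold_locales, rule R)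
    show "box_map Y X R \<in> carrier (algebra_of_space Y) \<rightarrow>\<^sub>E carrier (algebra_of_space X)"
      using in_admissible by simp
    have "space_hom X Y (box_map Y X R)"
      by (rule space_homI) (unfold_locales, simp_all add: in_admissible map_pts map_Int)
    then show "preserves_finite_meets (algebra_of_space Y) (algebra_of_space X) (box_map Y X R)"
      using preserves_finite_meets_iff_space_hom[OF X.stone_axioms Y.stone_axioms, of "box_map Y X R"]
      by (simp add: in_admissible)
  }
  {
    fix h assume h: "h \<in> carrier (algebra_of_space Y) \<rightarrow>\<^sub>E carrier (algebra_of_space X)"
      "preserves_finite_meets (algebra_of_space Y) (algebra_of_space X) h"
    have hA: "h U \<in> admissible X" if "U \<in> admissible Y" for U using h(1) that by auto
    interpret space_hom X Y h
      using h(2) preserves_finite_meets_iff_space_hom[OF X.stone_axioms Y.stone_axioms, of h] hA by simp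
    have "box_map Y X (relation_of_hom X Y h) = h"
      by (rule extensionalityI[of _ "admissible Y"]) (use h(1) in \<open>simp_all add: PiE_def box_relation_of_hom\<close>)
    then show "\<exists>R\<in>Hom ?C Y X. box_map Y X R = h"
      using relation_of_hom_morphism by (intro bexI[of _ "relation_of_hom X Y h"]) simp_all
  }
  fix R R' assume *: "R \<in> Hom ?C Y X" "R' \<in> Hom ?C Y X" and eq: "box_map Y X R = box_map Y X R'"
  have "box X R U = box X R' U" if "U \<in> admissible Y" for U using fun_cong[OF eq, of U] that by simp
  then have "relation_of_hom X Y (box X R) = relation_of_hom X Y (box X R')"
    unfolding relation_of_hom_def by auto
  then show "R = R'"
    using morphism_eq_relation_of_box[of X Y R] morphism_eq_relation_of_box[of X Y R'] * by simp
next
  let ?C = "opposite (PStone :: ('x pointed_ospace, ('x \<times> 'x) set) precategory)"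
  fix Z Y X :: "'x pointed_ospace" and S R
  assume "Z \<in> Ob ?C" "Y \<in> Ob ?C" "X \<in> Ob ?C" "S \<in> Hom ?C Z Y" "R \<in> Hom ?C Y X"
  then have *: "stone X" "stone Y" "stone Z" "generalized_Priestley_morphism X Y R"
      "generalized_Priestley_morphism Y Z S"
    by (simp_all add: opposite_def PStone_def stone_def)
  then have "box Y S U \<in> admissible Y" if "U \<in> admissible Z" for U
    using that by (simp add: generalized_Priestley_morphism_def)
  then show "box_map Z X (Comp ?C Z Y X R S) =
      compose (carrier (algebra_of_space Z)) (box_map Y X R) (box_map Z Y S)"
    by (auto simp: fun_eq_iff opposite_def PStone_def compose_def restrict_def box_star_comp[OF *])
qed

lemma category_PStone: "category (PStone :: ('x pointed_ospace, ('x \<times> 'x) set) precategory)"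
proof -
  let ?C = "opposite (PStone :: ('x pointed_ospace, ('x \<times> 'x) set) precategory)"
  interpret representation ?C preserves_finite_meets algebra_of_space box_map by (rule representation_PStone)
  have "category ?C"
    by (rule category)
      (simp_all add: opposite_def PStone_def stone.leq_morphism star_comp_morphism stone_def)
  then show ?thesis using category_opposite by fastforce
qed


section \<open>Maps of pointed Stone spaces\<close>

text \<open>If every point lying in all \<open>V\<close> with \<open>x \<in> h V\<close> also lies in some \<open>U\<close> with \<open>x \<notin> h U\<close>, then
  compactness yields such \<open>V \<subseteq> U\<close>, which monotonicity forbids. When there is no \<open>U\<close> at all, the
  point at infinity is the one looked for.\<close>

lemma (in space_hom) point_of_lattice_hom:
  assumes l: "lattice_hom (algebra_of_space Y) (algebra_of_space X) h" and x: "x \<in> pts X"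
  shows "\<exists>y\<in>pts Y. \<forall>U\<in>admissible Y. y \<in> U \<longleftrightarrow> x \<in> h U"
proof (cases "\<forall>U\<in>admissible Y. x \<in> h U")
  case True
  then have "\<forall>U\<in>admissible Y. pt Y \<in> U \<longleftrightarrow> x \<in> h U" by (simp add: Y.admissible_iff)
  then show ?thesis using Y.pt_in by blast
next
  case False
  let ?F = "{V \<in> admissible Y. x \<in> h V}" and ?N = "{U \<in> admissible Y. x \<notin> h U}"
  have un: "h (U \<union> V) = h U \<union> h V" if "U \<in> admissible Y" "V \<in> admissible Y" for U V
    using l that
    by (simp add: lattice_hom_def X.algebra_of_space_operations Y.algebra_of_space_operations in_admissible)
  have "\<not> \<Inter>?F \<subseteq> \<Union>?N"
  proof
    assume "\<Inter>?F \<subseteq> \<Union>?N"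
    then obtain V U where "V \<in> ?F" "U \<in> ?N" "V \<subseteq> U"
      by (rule compact_interpolation[OF Y.compact _ filter_at[OF x]])
        (use False un in \<open>auto dest: Y.admissible_iff[THEN iffD1]\<close>)
    then show False using map_mono[of V U] by auto
  qed
  then obtain y where y: "y \<in> \<Inter>?F" "y \<notin> \<Union>?N" by auto
  have "y \<in> pts Y" by (rule InterD[OF y(1)]) (use x in \<open>simp add: map_pts\<close>)
  then show ?thesis using y by (intro bexI[of _ y]) auto
qed

locale stone_map = X: stone X + Y: stone Y for X Y :: "'x pointed_ospace" +
  fixes f :: "'x \<Rightarrow> 'x"
  assumes closed: "f \<in> pts X \<rightarrow> pts Y"
    and preimage: "U \<in> admissible Y \<Longrightarrow> {x \<in> pts X. f x \<in> U} \<in> admissible X"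
begin

lemma map_in [simp]: "x \<in> pts X \<Longrightarrow> f x \<in> pts Y"
  using closed by (rule funcset_mem)

lemma map_pt: "f (pt X) = pt Y"
proof (rule Y.points_equal)
  fix U assume U: "U \<in> admissible Y"
  have "pt X \<in> {x \<in> pts X. f x \<in> U}" using preimage[OF U] by (simp add: X.admissible_iff)
  then show "f (pt X) \<in> U \<longleftrightarrow> pt Y \<in> U" using U by (simp add: Y.admissible_iff)
qed simp_all

lemma order_preserving: "(x, y) \<in> leq X \<Longrightarrow> (f x, f y) \<in> leq Y"
  by (auto simp: X.leq_iff Y.leq_iff map_pt)

abbreviation preimage_fun :: "'x set \<Rightarrow> 'x set" where
  "preimage_fun \<equiv> \<lambda>U\<in>admissible Y. {x \<in> pts X. f x \<in> U}"

lemma preimage_fun_in: "preimage_fun \<in> carrier (algebra_of_space Y) \<rightarrow>\<^sub>E carrier (algebra_of_space X)"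
  using preimage by simp

lemma lattice_hom_preimage: "lattice_hom (algebra_of_space Y) (algebra_of_space X) preimage_fun"
  unfolding lattice_hom_def meet_hom_def
  by (auto simp: X.algebra_of_space_operations Y.algebra_of_space_operations preimage)

lemma preserves_core_iff:
  "f ` core X \<subseteq> core Y \<longleftrightarrow> coinitial_hom (algebra_of_space Y) (algebra_of_space X) preimage_fun"
proof
  assume f: "f ` core X \<subseteq> core Y"
  let ?g = "\<lambda>C. {x \<in> pts X. f x \<in> C}"
  have "\<exists>C\<in>admissible Y. ?g C \<subseteq> W" if W: "W \<in> admissible X" for W
  proof -
    (* The intersection of the preimages of the admissible sets is the fibre over infinity. *)
    have "x \<in> W" if "x \<in> \<Inter>(?g ` admissible Y)" for x
    proof -
      have x: "x \<in> ?g C" if "C \<in> admissible Y" for C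
        by (rule InterD[OF \<open>x \<in> _\<close>]) (rule imageI[OF that])
      have "f x \<in> \<Inter>(admissible Y)" using x by simp
      then have "x \<notin> core X" using f unfolding Y.Inter_admissible by (auto simp: Y.core_eq)
      then show ?thesis using x[OF Y.pts_admissible] W by (auto simp: X.core_eq X.admissible_iff)
    qed
    then have "\<Inter>(?g ` admissible Y) \<subseteq> \<Union>{W}" by auto
    then obtain V U where "V \<in> ?g ` admissible Y" "U \<in> {W}" "V \<subseteq> U"
    proof (rule compact_interpolation[OF X.compact])
      show "?g ` admissible Y \<noteq> {}" using Y.pts_admissible by blast
      show "closedin (topo X) V" if "V \<in> ?g ` admissible Y" for V
        using that preimage by (auto simp: X.admissible_iff)
      fix V V' assume "V \<in> ?g ` admissible Y" "V' \<in> ?g ` admissible Y"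
      then obtain C C' where C: "C \<in> admissible Y" "C' \<in> admissible Y" "V = ?g C" "V' = ?g C'" by auto
      show "V \<inter> V' \<in> ?g ` admissible Y"
        by (rule image_eqI[of _ _ "C \<inter> C'"]) (use C in auto)
    qed (use W in \<open>auto simp: X.admissible_iff\<close>)
    then show ?thesis by auto
  qed
  then show "coinitial_hom (algebra_of_space Y) (algebra_of_space X) preimage_fun"
    unfolding coinitial_hom_def using lattice_hom_preimage by simp
next
  assume co: "coinitial_hom (algebra_of_space Y) (algebra_of_space X) preimage_fun"
  show "f ` core X \<subseteq> core Y"
  proof (rule image_subsetI)
    fix x assume "x \<in> core X"
    then have x: "x \<in> pts X" "x \<noteq> pt X" by (auto simp: X.core_eq)
    obtain W where W: "W \<in> admissible X" "pt X \<in> W" "x \<notin> W"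
      by (rule X.separation[of x "pt X"]) (use x in auto)
    have "\<exists>C\<in>admissible Y. {x \<in> pts X. f x \<in> C} \<subseteq> W" using co W(1) by (simp add: coinitial_hom_def)
    then obtain C where "C \<in> admissible Y" "f x \<notin> C" using x W by blast
    then show "f x \<in> core Y" using x by (auto simp: Y.core_eq Y.admissible_iff)
  qed
qed

lemma bounded_iff:
  "(openin (topo X) {pt X} \<and> openin (topo Y) {pt Y} \<longrightarrow> f ` (pts X - {pt X}) \<subseteq> pts Y - {pt Y}) \<longleftrightarrow>
   bounded_hom (algebra_of_space Y) (algebra_of_space X) preimage_fun"
proof (cases "openin (topo X) {pt X} \<and> openin (topo Y) {pt Y}")
  case True
  interpret AY: gba "algebra_of_space Y" by (rule Y.gba_algebra_of_space)
  interpret AY: weak_partial_order_bottom "algebra_of_space Y"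
    using True Y.algebra_of_space_bottom(1) by simp
  have "{pt Y} \<in> admissible Y" using AY.bottom_closed Y.algebra_of_space_bottom(2) True by simp
  then have "bounded_hom (algebra_of_space Y) (algebra_of_space X) preimage_fun \<longleftrightarrow>
      {x \<in> pts X. f x = pt Y} = {pt X}"
    unfolding bounded_hom_def
    using True X.algebra_of_space_bottom Y.algebra_of_space_bottom by simp
  also have "\<dots> \<longleftrightarrow> f ` (pts X - {pt X}) \<subseteq> pts Y - {pt Y}"
    using map_pt X.pt_in by (auto simp: image_subset_iff set_eq_iff)
  finally show ?thesis using True by simp
next
  case False
  then show ?thesis
    unfolding bounded_hom_def X.algebra_of_space_bottom(1) Y.algebra_of_space_bottom(1) by auto
qed

end

lemma Hom_PStone_S:
  assumes "stone X" "stone Y"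
  shows "f \<in> Hom PStone_S X Y \<longleftrightarrow> f \<in> extensional (pts X) \<and> stone_map X Y f"
proof
  assume "f \<in> Hom PStone_S X Y"
  then show "f \<in> extensional (pts X) \<and> stone_map X Y f"
    using assms
    by (auto simp: PStone_S_def concrete_def stone_map_def stone_map_axioms_def PiE_def)
next
  assume f: "f \<in> extensional (pts X) \<and> stone_map X Y f"
  then interpret stone_map X Y f by simp
  show "f \<in> Hom PStone_S X Y"
    using f closed preimage order_preserving by (simp add: PStone_S_def concrete_def PiE_def)
qed

abbreviation preimage_map :: "'x pointed_ospace \<Rightarrow> 'x pointed_ospace \<Rightarrow> ('x \<Rightarrow> 'x) \<Rightarrow> 'x set \<Rightarrow> 'x set" where
  "preimage_map Y X f \<equiv> \<lambda>U\<in>admissible Y. {x \<in> pts X. f x \<in> U}"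

lemma map_of_lattice_hom:
  assumes "stone X" "stone Y"
    and h: "h \<in> carrier (algebra_of_space Y) \<rightarrow>\<^sub>E carrier (algebra_of_space X)"
    and hom: "lattice_hom (algebra_of_space Y) (algebra_of_space X) h"
  obtains f where "f \<in> extensional (pts X)" "stone_map X Y f" "preimage_map Y X f = h"
proof -
  have hA: "h U \<in> admissible X" if "U \<in> admissible Y" for U using h that by auto
  interpret space_hom X Y h
    using assms(1,2) lattice_hom_meet[OF hom] hA by (simp add: space_hom_def space_hom_axioms_def)
  have "\<exists>y. y \<in> pts Y \<and> (\<forall>U\<in>admissible Y. y \<in> U \<longleftrightarrow> x \<in> h U)" if "x \<in> pts X" for x
    using point_of_lattice_hom[OF hom that] by blast
  then obtain g where g: "\<And>x. x \<in> pts X \<Longrightarrow> g x \<in> pts Y \<and> (\<forall>U\<in>admissible Y. g x \<in> U \<longleftrightarrow> x \<in> h U)"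
    by metis
  define f where "f = restrict g (pts X)"
  have pre: "{x \<in> pts X. f x \<in> U} = h U" if "U \<in> admissible Y" for U
    using g that X.admissible_subset[OF hA[OF that]] by (auto simp: f_def)
  have "stone_map X Y f"
    by unfold_locales (use g pre hA in \<open>auto simp: f_def\<close>)
  moreover have "preimage_map Y X f = h"
    by (rule extensionalityI[of _ "admissible Y"]) (use pre h in \<open>auto simp: PiE_def\<close>)
  moreover have "f \<in> extensional (pts X)" by (simp add: f_def)
  ultimately show ?thesis using that by blast
qed

lemma stone_maps_equal:
  assumes "stone_map X Y f" "stone_map X Y g"
    and eq: "preimage_map Y X f = preimage_map Y X g" and x: "x \<in> pts X"
  shows "f x = g x"
proof -
  interpret f: stone_map X Y f by fact
  interpret g: stone_map X Y g by fact
  show ?thesis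
  proof (rule f.Y.points_equal)
    fix U assume "U \<in> admissible Y"
    then have "{x \<in> pts X. f x \<in> U} = {x \<in> pts X. g x \<in> U}" using fun_cong[OF eq, of U] by simp
    then show "f x \<in> U \<longleftrightarrow> g x \<in> U" using x by blast
  qed (use x in simp_all)
qed

lemma Ob_PStone_S: "Ob PStone_S = {X. stone X}"
  by (simp add: PStone_S_def concrete_def stone_def)

lemma representation_PStone_S:
  "representation (opposite (PStone_S :: ('x pointed_ospace, 'x \<Rightarrow> 'x) precategory))
     lattice_hom algebra_of_space preimage_map"
proof (rule representation.intro)
  let ?C = "opposite (PStone_S :: ('x pointed_ospace, 'x \<Rightarrow> 'x) precategory)"
  fix X :: "'x pointed_ospace" assume "X \<in> Ob ?C"
  then interpret stone X by (simp add: opposite_def Ob_PStone_S)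
  show "gba (algebra_of_space X)" by (rule gba_algebra_of_space)
  show "preimage_map X X (Idm ?C X) = (\<lambda>U\<in>carrier (algebra_of_space X). U)"
    using admissible_subset by (auto simp: fun_eq_iff opposite_def PStone_S_def concrete_def restrict_def)
next
  let ?C = "opposite (PStone_S :: ('x pointed_ospace, 'x \<Rightarrow> 'x) precategory)"
  fix Y X :: "'x pointed_ospace"
  assume "Y \<in> Ob ?C" "X \<in> Ob ?C"
  then have XY: "stone X" "stone Y" by (simp_all add: opposite_def Ob_PStone_S)
  have Hom: "f \<in> Hom ?C Y X \<longleftrightarrow> f \<in> extensional (pts X) \<and> stone_map X Y f" for f
    using Hom_PStone_S[OF XY] by (simp add: opposite_def)
  show "preimage_map Y X f \<in> carrier (algebra_of_space Y) \<rightarrow>\<^sub>E carrier (algebra_of_space X)"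
    "lattice_hom (algebra_of_space Y) (algebra_of_space X) (preimage_map Y X f)" if "f \<in> Hom ?C Y X" for f
    using that stone_map.preimage_fun_in[of X Y f] stone_map.lattice_hom_preimage[of X Y f]
    by (simp_all add: Hom)
  show "\<exists>f\<in>Hom ?C Y X. preimage_map Y X f = h"
    if h: "h \<in> carrier (algebra_of_space Y) \<rightarrow>\<^sub>E carrier (algebra_of_space X)"
      "lattice_hom (algebra_of_space Y) (algebra_of_space X) h" for h
  proof -
    obtain f where "f \<in> extensional (pts X)" "stone_map X Y f" "preimage_map Y X f = h"
      by (rule map_of_lattice_hom[OF XY h])
    then show ?thesis by (intro bexI[of _ f]) (simp_all add: Hom)
  qed
  fix f g assume *: "f \<in> Hom ?C Y X" "g \<in> Hom ?C Y X" and eq: "preimage_map Y X f = preimage_map Y X g"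
  show "f = g"
    by (rule extensionalityI[of _ "pts X"])
      (use * stone_maps_equal[of X Y f g, OF _ _ eq] in \<open>simp_all add: Hom\<close>)
next
  let ?C = "opposite (PStone_S :: ('x pointed_ospace, 'x \<Rightarrow> 'x) precategory)"
  fix Z Y X :: "'x pointed_ospace" and g f
  assume "Z \<in> Ob ?C" "Y \<in> Ob ?C" "X \<in> Ob ?C" "g \<in> Hom ?C Z Y" "f \<in> Hom ?C Y X"
  then interpret g: stone_map Y Z g + f: stone_map X Y f
    by (simp_all add: opposite_def Ob_PStone_S Hom_PStone_S)
  show "preimage_map Z X (Comp ?C Z Y X f g) =
      compose (carrier (algebra_of_space Z)) (preimage_map Y X f) (preimage_map Z Y g)"
    using g.preimage
    by (auto simp: fun_eq_iff opposite_def PStone_S_def concrete_def compose_def restrict_def)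
qed


section \<open>The frame of open sets avoiding the point at infinity\<close>

context stone
begin

text \<open>The admissible sets avoiding \<open>x\<close> cover the complement of \<open>G\<close> and are directed, so one of them
  contains it.\<close>

lemma open_contains_complement:
  assumes G: "openin (topo X) G" "pt X \<notin> G" and x: "x \<in> G"
  shows "\<exists>U\<in>admissible X. x \<notin> U \<and> pts X - U \<subseteq> G"
proof -
  have xX: "x \<in> pts X" "x \<noteq> pt X" using assms openin_subset by blast+
  have ex: "\<exists>U\<in>admissible X. y \<in> U \<and> x \<notin> U" if "y \<in> pts X" "y \<noteq> x" for y
    using separation[OF xX(1) that(1) xX(2) that(2)] by blast
  have "\<Inter>{pts X - G} \<subseteq> \<Union>{U \<in> admissible X. x \<notin> U}" using ex x by auto
  then obtain V U where "V \<in> {pts X - G}" "U \<in> {U \<in> admissible X. x \<notin> U}" "V \<subseteq> U"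
  proof (rule compact_interpolation[OF compact])
    show "{U \<in> admissible X. x \<notin> U} \<noteq> {}" using ex[of "pt X"] xX by auto
  qed (use G in \<open>auto dest: admissible_iff[THEN iffD1]\<close>)
  then show ?thesis by auto
qed

definition opens :: "'x set set" where
  "opens = {G. openin (topo X) G \<and> pt X \<notin> G}"

lemma complement_in_opens: "U \<in> admissible X \<Longrightarrow> pts X - U \<in> opens"
  by (auto simp: opens_def admissible_iff)

lemma Union_complements:
  assumes "G \<in> opens"
  shows "\<Union>{pts X - U |U. U \<in> admissible X \<and> pts X - U \<subseteq> G} = G" (is "\<Union>?A = G")
proof (intro equalityI subsetI)
  fix x assume x: "x \<in> G"
  have G: "openin (topo X) G" "pt X \<notin> G" using assms by (simp_all add: opens_def)
  obtain U where U: "U \<in> admissible X" "x \<notin> U" "pts X - U \<subseteq> G"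
    using open_contains_complement[OF G x] by blast
  then have "pts X - U \<in> ?A" "x \<in> pts X - U" using openin_subset[OF G(1)] x by auto
  then show "x \<in> \<Union>?A" by (rule UnionI)
qed auto

text \<open>An open set is determined by the admissible sets whose complements it contains.\<close>

lemma opens_lepoll: "opens \<lesssim> Pow (admissible X)"
  unfolding lepoll_def
proof (intro exI conjI)
  let ?s = "\<lambda>G. {U \<in> admissible X. pts X - U \<subseteq> G}"
  show "inj_on ?s opens"
  proof (rule inj_onI)
    fix G G' assume *: "G \<in> opens" "G' \<in> opens" "?s G = ?s G'"
    have img: "{pts X - U |U. U \<in> admissible X \<and> pts X - U \<subseteq> Z} = (\<lambda>U. pts X - U) ` ?s Z" for Z
      by blast
    have "G = \<Union>((\<lambda>U. pts X - U) ` ?s G)"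
      using Union_complements[OF *(1)] unfolding img by (rule sym)
    also have "\<dots> = \<Union>((\<lambda>U. pts X - U) ` ?s G')" by (simp only: *(3))
    also have "\<dots> = G'"
      using Union_complements[OF *(2)] unfolding img .
    finally show "G = G'" .
  qed
qed auto

end

text \<open>The open sets are encoded by an injection \<open>j\<close> into the carrier type of frames, with inverse \<open>d\<close>.\<close>

locale stone_frame = stone X for X :: "'x pointed_ospace" +
  fixes j :: "'x set \<Rightarrow> 'f"
  assumes inj: "inj_on j opens"
begin

definition d :: "'f \<Rightarrow> 'x set" where "d = inv_into opens j"

lemma d_j [simp]: "G \<in> opens \<Longrightarrow> d (j G) = G"
  unfolding d_def using inj by simp

definition L :: "'f gorder" where
  "L = \<lparr>carrier = j ` opens, eq = (=), le = (\<lambda>u v. d u \<subseteq> d v)\<rparr>"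

lemma carrier_L: "carrier L = j ` opens"
  by (simp add: L_def)

lemma le_L [simp]: "u \<sqsubseteq>\<^bsub>L\<^esub> v \<longleftrightarrow> d u \<subseteq> d v"
  by (simp add: L_def)

lemma j_in [simp]: "G \<in> opens \<Longrightarrow> j G \<in> carrier L"
  by (simp add: carrier_L)

lemma d_in: "u \<in> carrier L \<Longrightarrow> d u \<in> opens"
  by (auto simp: carrier_L)

lemma j_d [simp]: "u \<in> carrier L \<Longrightarrow> j (d u) = u"
  by (auto simp: carrier_L)

lemma Union_opens: "\<A> \<subseteq> opens \<Longrightarrow> \<Union>\<A> \<in> opens"
  by (auto simp: opens_def)

lemma Int_opens: "\<lbrakk>A \<in> opens; B \<in> opens\<rbrakk> \<Longrightarrow> A \<inter> B \<in> opens"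
  by (auto simp: opens_def)

lemma partial_order_L: "partial_order L"
proof (rule partial_orderI)
  fix u v assume *: "u \<in> carrier L" "v \<in> carrier L" "u \<sqsubseteq>\<^bsub>L\<^esub> v" "v \<sqsubseteq>\<^bsub>L\<^esub> u"
  have "j (d u) = u" "j (d v) = v" by (rule j_d[OF *(1)], rule j_d[OF *(2)])
  moreover have "d u = d v" using *(3,4) by simp
  ultimately show "u = v" by metis
qed (auto simp: L_def)

sublocale partial_order L by (rule partial_order_L)

lemma Union_d: "A \<subseteq> carrier L \<Longrightarrow> \<Union>(d ` A) \<in> opens"
  by (intro Union_opens) (auto dest: d_in)

lemma is_lub_L: "A \<subseteq> carrier L \<Longrightarrow> is_lub L (j (\<Union>(d ` A))) A"
  using Union_d[of A] by (auto simp: least_def Upper_def)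

sublocale complete_lattice L
proof
  fix A assume A: "A \<subseteq> carrier L"
  show "\<exists>s. is_lub L s A" using is_lub_L[OF A] by (rule exI)
  let ?B = "{u \<in> carrier L. \<forall>a\<in>A. d u \<subseteq> d a}"
  have "\<Union>(d ` ?B) \<in> opens" by (rule Union_d) auto
  then have "is_glb L (j (\<Union>(d ` ?B))) A"
    using A by (auto simp: greatest_def Lower_def)
  then show "\<exists>s. is_glb L s A" by (rule exI)
qed

lemma sup_L: "A \<subseteq> carrier L \<Longrightarrow> \<Squnion>\<^bsub>L\<^esub>A = j (\<Union>(d ` A))"
  using least_unique[OF sup_lub is_lub_L] by simp

lemma d_sup: "A \<subseteq> carrier L \<Longrightarrow> d (\<Squnion>\<^bsub>L\<^esub>A) = \<Union>(d ` A)"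
  using Union_d[of A] by (simp add: sup_L)

lemma meet_L:
  assumes "u \<in> carrier L" "v \<in> carrier L"
  shows "u \<sqinter>\<^bsub>L\<^esub> v = j (d u \<inter> d v)"
proof (rule greatest_unique)
  have "d u \<inter> d v \<in> opens" by (intro Int_opens d_in assms)
  then show "is_glb L (j (d u \<inter> d v)) {u, v}"
    using assms by (auto simp: greatest_def Lower_def)
  show "is_glb L (u \<sqinter>\<^bsub>L\<^esub> v) {u, v}"
    unfolding meet_def by (rule inf_of_two_greatest[OF assms])
qed

lemma frame_L: "frame L"
  unfolding frame_def
proof (intro conjI ballI allI impI)
  show "complete_lattice L" by unfold_locales
  fix a A assume a: "a \<in> carrier L" and A: "A \<subseteq> carrier L"
  have A': "x \<in> carrier L" if "x \<in> A" for x using A that by auto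
  have 1: "(\<lambda>x. a \<sqinter>\<^bsub>L\<^esub> x) ` A \<subseteq> carrier L" using a A' by auto
  have "d ` (\<lambda>x. a \<sqinter>\<^bsub>L\<^esub> x) ` A = (\<lambda>x. d a \<inter> d x) ` A"
    unfolding image_image
    by (rule image_cong) (simp_all add: meet_L a A' d_in Int_opens)
  then show "a \<sqinter>\<^bsub>L\<^esub> (\<Squnion>\<^bsub>L\<^esub>A) = \<Squnion>\<^bsub>L\<^esub>((\<lambda>x. a \<sqinter>\<^bsub>L\<^esub> x) ` A)"
    unfolding sup_L[OF 1] using a A by (simp add: meet_L d_sup)
qed

lemma sup_complements:
  assumes "u \<in> carrier L"
  defines "A \<equiv> j ` {pts X - U |U. U \<in> admissible X \<and> pts X - U \<subseteq> d u}"
  shows "A \<subseteq> carrier L" "\<Squnion>\<^bsub>L\<^esub>A = u"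
proof -
  let ?A = "{pts X - U |U. U \<in> admissible X \<and> pts X - U \<subseteq> d u}"
  have sub: "?A \<subseteq> opens" using complement_in_opens by blast
  then show A: "A \<subseteq> carrier L" unfolding A_def by (auto simp: carrier_L)
  have "d ` A = ?A"
    unfolding A_def image_image using sub by (simp add: subset_iff cong: image_cong_simp)
  then show "\<Squnion>\<^bsub>L\<^esub>A = u"
    using sup_L[OF A] Union_complements[OF d_in[OF assms(1)]] assms(1) by simp
qed

lemma finite_Union_complements:
  assumes "finite \<B>" "\<B> \<subseteq> {pts X - U |U. U \<in> admissible X}"
  shows "\<exists>U\<in>admissible X. \<Union>\<B> = pts X - U"
  using assms
proof (induction \<B>)
  case empty
  then show ?case using pts_admissible by (intro bexI[of _ "pts X"]) auto
next
  case (insert B \<B>)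
  then have "\<exists>U\<in>admissible X. \<Union>\<B> = pts X - U" "\<exists>V\<in>admissible X. B = pts X - V" by auto
  then obtain U V where "U \<in> admissible X" "\<Union>\<B> = pts X - U" "V \<in> admissible X" "B = pts X - V" by blast
  then show ?case by (intro bexI[of _ "U \<inter> V"]) auto
qed

lemma complement_compact:
  assumes U: "U \<in> admissible X"
  shows "j (pts X - U) \<in> compacts L"
  unfolding compacts_def
proof (intro CollectI conjI allI impI)
  show "j (pts X - U) \<in> carrier L" using complement_in_opens[OF U] by simp
  fix A assume A: "A \<subseteq> carrier L" "j (pts X - U) \<sqsubseteq>\<^bsub>L\<^esub> \<Squnion>\<^bsub>L\<^esub>A"
  then have "pts X - U \<subseteq> \<Union>(d ` A)" using complement_in_opens[OF U] by (simp add: d_sup)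
  moreover have "compactin (topo X) (pts X - U)"
    by (rule closedin_compact_space[OF compact]) (use U in \<open>simp add: admissible_iff closedin_diff\<close>)
  moreover have "openin (topo X) V" if "V \<in> d ` A" for V
    using that A(1) d_in by (auto simp: opens_def)
  ultimately obtain \<F> where F: "finite \<F>" "\<F> \<subseteq> d ` A" "pts X - U \<subseteq> \<Union>\<F>"
    using compactinD[of "topo X" "pts X - U" "d ` A"] by blast
  then obtain B where B: "B \<subseteq> A" "finite B" "\<F> = d ` B" by (meson finite_subset_image)
  then have "j (pts X - U) \<sqsubseteq>\<^bsub>L\<^esub> \<Squnion>\<^bsub>L\<^esub>B"
    using F A(1) complement_in_opens[OF U] by (simp add: d_sup)
  then show "\<exists>B\<subseteq>A. finite B \<and> j (pts X - U) \<sqsubseteq>\<^bsub>L\<^esub> \<Squnion>\<^bsub>L\<^esub>B" using B by blast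
qed

text \<open>The complements of admissible sets are compact, form a basis, and are closed under finite
  unions.\<close>

lemma compacts_L: "compacts L = (\<lambda>U. j (pts X - U)) ` admissible X"
proof (intro equalityI subsetI)
  fix k assume k: "k \<in> compacts L"
  then have kc: "k \<in> carrier L" by (simp add: compacts_def)
  let ?A = "{pts X - U |U. U \<in> admissible X \<and> pts X - U \<subseteq> d k}"
  note A = sup_complements[OF kc]
  have "k \<sqsubseteq>\<^bsub>L\<^esub> \<Squnion>\<^bsub>L\<^esub>(j ` ?A)" using A(2) by simp
  then have "\<exists>B\<subseteq>j ` ?A. finite B \<and> k \<sqsubseteq>\<^bsub>L\<^esub> \<Squnion>\<^bsub>L\<^esub>B" using k A(1) by (simp add: compacts_def)
  then obtain B where B: "B \<subseteq> j ` ?A" "finite B" "k \<sqsubseteq>\<^bsub>L\<^esub> \<Squnion>\<^bsub>L\<^esub>B" by blast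
  then obtain \<D> where D: "\<D> \<subseteq> ?A" "finite \<D>" "B = j ` \<D>" by (meson finite_subset_image)
  have "\<D> \<subseteq> opens" using D(1) complement_in_opens by blast
  then have "d ` B = \<D>" unfolding D(3) image_image by (simp add: subset_iff cong: image_cong_simp)
  moreover have "B \<subseteq> carrier L" using B(1) A(1) by (rule subset_trans)
  ultimately have "d k \<subseteq> \<Union>\<D>" using B(3) by (simp add: d_sup)
  moreover have "\<Union>\<D> \<subseteq> d k" using D(1) by blast
  moreover have "\<D> \<subseteq> {pts X - U |U. U \<in> admissible X}" using D(1) by blast
  then obtain U where "U \<in> admissible X" "\<Union>\<D> = pts X - U"
    using finite_Union_complements[OF D(2)] by blast
  ultimately have "U \<in> admissible X" "k = j (pts X - U)" using j_d[OF kc] by auto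
  then show "k \<in> (\<lambda>U. j (pts X - U)) ` admissible X" by simp
qed (auto intro: complement_compact)

text \<open>The complement in the frame is \<open>U - {pt X}\<close>, which is open because points are closed.\<close>

lemma complement_complemented:
  assumes U: "U \<in> admissible X"
  shows "j (pts X - U) \<in> complementeds L"
proof -
  let ?a = "j (pts X - U)" and ?b = "j (U - {pt X})"
  have a: "pts X - U \<in> opens" by (rule complement_in_opens[OF U])
  have b: "U - {pt X} \<in> opens"
    using U closedin_pt by (simp add: opens_def admissible_iff openin_diff)
  let ?P = "{x \<in> carrier L. ?a \<sqinter>\<^bsub>L\<^esub> x = \<bottom>\<^bsub>L\<^esub>}"
  have e: "{} \<in> opens" by (simp add: opens_def)
  have "\<bottom>\<^bsub>L\<^esub> = j {}" using sup_L[of "{}"] by (simp add: sup_def bottom_def)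
  moreover have "(pts X - U) \<inter> (U - {pt X}) = {}" by auto
  then have "?a \<sqinter>\<^bsub>L\<^esub> ?b = j {}" using a b by (simp add: meet_L)
  ultimately have "?b \<in> ?P" using b by simp
  then have 1: "U - {pt X} \<subseteq> d (\<Squnion>\<^bsub>L\<^esub>?P)" using sup_upper[of ?P ?b] b by simp
  have P: "\<Squnion>\<^bsub>L\<^esub>?P \<in> carrier L" by (rule sup_closed) auto
  have "d (?a \<squnion>\<^bsub>L\<^esub> \<Squnion>\<^bsub>L\<^esub>?P) = (pts X - U) \<union> d (\<Squnion>\<^bsub>L\<^esub>?P)"
    unfolding join_def using a P by (simp add: d_sup)
  then have "pts X - {pt X} \<subseteq> d (?a \<squnion>\<^bsub>L\<^esub> \<Squnion>\<^bsub>L\<^esub>?P)" using 1 by auto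
  moreover have "d \<top>\<^bsub>L\<^esub> \<subseteq> pts X - {pt X}"
    using d_in[OF top_closed] openin_subset by (auto simp: opens_def)
  ultimately have "\<top>\<^bsub>L\<^esub> \<sqsubseteq>\<^bsub>L\<^esub> ?a \<squnion>\<^bsub>L\<^esub> \<Squnion>\<^bsub>L\<^esub>?P" by auto
  then have "?a \<squnion>\<^bsub>L\<^esub> \<Squnion>\<^bsub>L\<^esub>?P = \<top>\<^bsub>L\<^esub>" using a P by (intro le_antisym top_higher) auto
  then show ?thesis using a by (simp add: complementeds_def pseudocomplement_def)
qed

lemma locally_Stone_L: "locally_Stone_frame L"
proof -
  have "\<exists>A\<subseteq>compacts L \<inter> complementeds L. u = \<Squnion>\<^bsub>L\<^esub>A" if u: "u \<in> carrier L" for u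
    using sup_complements[OF u] complement_compact complement_complemented
    by (intro exI[of _ "j ` {pts X - U |U. U \<in> admissible X \<and> pts X - U \<subseteq> d u}"]) auto
  then show ?thesis
    using frame_L unfolding locally_Stone_frame_def algebraic_def zero_dimensional_def
    by (meson le_inf_iff)
qed

lemma order_iso_L: "order_iso (algebra_of_space X) (algebra_of_frame L) (\<lambda>U. j (pts X - U))"
  unfolding order_iso_def bij_betw_def
proof (intro conjI ballI)
  have eq: "pts X - U \<subseteq> pts X - V \<longleftrightarrow> V \<subseteq> U" if "U \<in> admissible X" "V \<in> admissible X" for U V
    using admissible_subset[OF that(1)] admissible_subset[OF that(2)] by blast
  show "inj_on (\<lambda>U. j (pts X - U)) (carrier (algebra_of_space X))"
  proof (rule inj_onI)
    fix U V assume *: "U \<in> carrier (algebra_of_space X)" "V \<in> carrier (algebra_of_space X)"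
      "j (pts X - U) = j (pts X - V)"
    then have "pts X - U = pts X - V" using complement_in_opens inj by (auto dest: inj_onD)
    then show "U = V" using eq[of U V] eq[of V U] * by auto
  qed
  show "(\<lambda>U. j (pts X - U)) ` carrier (algebra_of_space X) = carrier (algebra_of_frame L)"
    by (simp add: compacts_L)
  fix U V assume "U \<in> carrier (algebra_of_space X)" "V \<in> carrier (algebra_of_space X)"
  then show "j (pts X - U) \<sqsubseteq>\<^bsub>algebra_of_frame L\<^esub> j (pts X - V) \<longleftrightarrow> U \<sqsubseteq>\<^bsub>algebra_of_space X\<^esub> V"
    using eq[of V U] by (simp add: complement_in_opens)
qed

end

lemma frame_of_space_exists:
  fixes X :: "'x pointed_ospace"
  assumes X: "pointed_Stone_space X" and size: "Pow (admissible X) \<lesssim> (UNIV :: 'f set)"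
  shows "\<exists>L :: 'f gorder. locally_Stone_frame L \<and>
    (\<exists>w. order_iso (algebra_of_space X) (algebra_of_frame L) w)"
proof -
  interpret stone X by unfold_locales (rule X)
  have "opens \<lesssim> (UNIV :: 'f set)" by (rule lepoll_trans[OF opens_lepoll size])
  then obtain j :: "'x set \<Rightarrow> 'f" where "inj_on j opens" by (auto simp: lepoll_def)
  then interpret stone_frame X j by unfold_locales
  show ?thesis using locally_Stone_L order_iso_L by blast
qed


section \<open>The space of a generalized boolean algebra\<close>

text \<open>Besides the prime filters, \<open>spectral\<close> admits the whole algebra; it becomes the point at
  infinity.\<close>

definition filter_of :: "'a gorder \<Rightarrow> 'a set \<Rightarrow> bool" where
  "filter_of M F \<longleftrightarrow> F \<subseteq> carrier M \<and> \<top>\<^bsub>M\<^esub> \<in> F \<and>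
     (\<forall>a\<in>carrier M. \<forall>b\<in>carrier M. a \<sqinter>\<^bsub>M\<^esub> b \<in> F \<longleftrightarrow> a \<in> F \<and> b \<in> F)"

definition spectral :: "'a gorder \<Rightarrow> 'a set \<Rightarrow> bool" where
  "spectral M F \<longleftrightarrow> filter_of M F \<and>
     (\<forall>a\<in>carrier M. \<forall>b\<in>carrier M. a \<squnion>\<^bsub>M\<^esub> b \<in> F \<longleftrightarrow> a \<in> F \<or> b \<in> F)"

context gba
begin

lemma filter_up:
  "\<lbrakk>filter_of M F; a \<in> F; b \<in> carrier M; a \<sqsubseteq> b\<rbrakk> \<Longrightarrow> b \<in> F"
proof -
  assume F: "filter_of M F" and a: "a \<in> F" and b: "b \<in> carrier M" "a \<sqsubseteq> b"
  have ac: "a \<in> carrier M" using F a by (auto simp: filter_of_def)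
  then have "a \<sqinter> b = a" using le_iff_meet_eq b by simp
  then have "a \<sqinter> b \<in> F" using a by simp
  then show "b \<in> F" using F ac b(1) by (simp add: filter_of_def)
qed

lemma filter_ofI:
  assumes "F \<subseteq> carrier M" "\<top> \<in> F"
    and "\<And>a b. \<lbrakk>a \<in> F; b \<in> F\<rbrakk> \<Longrightarrow> a \<sqinter> b \<in> F"
    and up: "\<And>a b. \<lbrakk>a \<in> F; b \<in> carrier M; a \<sqsubseteq> b\<rbrakk> \<Longrightarrow> b \<in> F"
  shows "filter_of M F"
  unfolding filter_of_def
proof (intro conjI ballI iffI)
  fix a b assume "a \<in> carrier M" "b \<in> carrier M" "a \<sqinter> b \<in> F"
  then show "a \<in> F" "b \<in> F"
    using up[of "a \<sqinter> b" a] up[of "a \<sqinter> b" b] meet_left[of a b] meet_right[of a b] by simp_all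
qed (use assms(1-3) in auto)

text \<open>The filter generated by \<open>F\<close> and \<open>a\<close>.\<close>

definition adjoin :: "'a set \<Rightarrow> 'a \<Rightarrow> 'a set" where
  "adjoin F a = {z \<in> carrier M. \<exists>f\<in>F. f \<sqinter> a \<sqsubseteq> z}"

lemma filter_adjoin:
  assumes F: "filter_of M F" and a: "a \<in> carrier M"
  shows "filter_of M (adjoin F a)" "F \<subseteq> adjoin F a" "a \<in> adjoin F a"
proof -
  have Fc: "F \<subseteq> carrier M" and t: "\<top> \<in> F" using F by (simp_all add: filter_of_def)
  then have c: "x \<in> F \<Longrightarrow> x \<in> carrier M" for x by auto
  show "F \<subseteq> adjoin F a"
  proof
    fix x assume x: "x \<in> F"
    then have "x \<sqinter> a \<sqsubseteq> x" using c a by (simp add: meet_left)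
    then show "x \<in> adjoin F a" using x c unfolding adjoin_def by blast
  qed
  then have "\<top> \<in> adjoin F a" using t by auto
  then show "filter_of M (adjoin F a)"
  proof (intro filter_ofI)
    fix x y assume "x \<in> adjoin F a" "y \<in> adjoin F a"
    then obtain f g where fg: "f \<in> F" "g \<in> F" "f \<sqinter> a \<sqsubseteq> x" "g \<sqinter> a \<sqsubseteq> y"
      and xy: "x \<in> carrier M" "y \<in> carrier M" by (auto simp: adjoin_def)
    have "f \<sqinter> g \<in> F" using F fg c by (simp add: filter_of_def)
    have fgc: "f \<in> carrier M" "g \<in> carrier M" using fg c by auto
    have "(f \<sqinter> g) \<sqinter> a \<sqsubseteq> f \<sqinter> a" "(f \<sqinter> g) \<sqinter> a \<sqsubseteq> g \<sqinter> a"
      using fgc a by (simp_all add: meet_mono meet_left meet_right)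
    then have "(f \<sqinter> g) \<sqinter> a \<sqsubseteq> x" "(f \<sqinter> g) \<sqinter> a \<sqsubseteq> y"
      using le_trans[OF _ fg(3)] le_trans[OF _ fg(4)] fgc a xy by simp_all
    then have "(f \<sqinter> g) \<sqinter> a \<sqsubseteq> x \<sqinter> y" using fgc a xy by (simp add: meet_le)
    then show "x \<sqinter> y \<in> adjoin F a"
      using \<open>f \<sqinter> g \<in> F\<close> xy by (auto simp: adjoin_def)
  next
    fix x y assume "x \<in> adjoin F a" and y: "y \<in> carrier M" "x \<sqsubseteq> y"
    then obtain f where f: "f \<in> F" "f \<sqinter> a \<sqsubseteq> x" and x: "x \<in> carrier M" by (auto simp: adjoin_def)
    have "f \<sqinter> a \<sqsubseteq> y" using le_trans[OF f(2) y(2)] f(1) x y c a by simp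
    then show "y \<in> adjoin F a" using f y by (auto simp: adjoin_def)
  qed (auto simp: adjoin_def)
  show "a \<in> adjoin F a"
    unfolding adjoin_def using a t meet_right[OF top_closed a] by auto
qed

text \<open>A filter that is maximal among those avoiding \<open>I\<close> is prime: if it contained \<open>a \<squnion> b\<close> but neither
  \<open>a\<close> nor \<open>b\<close>, adjoining either would produce elements \<open>i\<close> and \<open>k\<close> of \<open>I\<close>, and distributivity puts
  their join into the filter.\<close>

lemma spectral_extension:
  assumes F0: "filter_of M F0" and I: "I \<subseteq> carrier M" "F0 \<inter> I = {}"
    and Ij: "\<And>i k. \<lbrakk>i \<in> I; k \<in> I\<rbrakk> \<Longrightarrow> i \<squnion> k \<in> I"
  obtains F where "spectral M F" "F0 \<subseteq> F" "F \<inter> I = {}"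
proof -
  define \<S> where "\<S> = {F. filter_of M F \<and> F0 \<subseteq> F \<and> F \<inter> I = {}}"
  have "F0 \<in> \<S>" using assms by (simp add: \<S>_def)
  then have ne: "\<S> \<noteq> {}" by blast
  have "\<exists>F\<in>\<S>. \<forall>X\<in>\<S>. F \<subseteq> X \<longrightarrow> X = F"
  proof (rule subset_Zorn_nonempty[OF ne])
    fix \<C> assume C: "\<C> \<noteq> {}" "subset.chain \<S> \<C>"
    then have CS: "\<And>F. F \<in> \<C> \<Longrightarrow> filter_of M F \<and> F0 \<subseteq> F \<and> F \<inter> I = {}"
      and lin: "\<And>F G. \<lbrakk>F \<in> \<C>; G \<in> \<C>\<rbrakk> \<Longrightarrow> F \<subseteq> G \<or> G \<subseteq> F"
      by (auto simp: subset_chain_def \<S>_def)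
    obtain F1 where F1: "F1 \<in> \<C>" using C(1) by blast
    have "filter_of M (\<Union>\<C>)"
    proof (rule filter_ofI)
      have "F \<subseteq> carrier M" if "F \<in> \<C>" for F using CS[OF that] by (simp add: filter_of_def)
      then show "\<Union>\<C> \<subseteq> carrier M" by blast
      show "\<top> \<in> \<Union>\<C>" using CS[OF F1] F1 by (auto simp: filter_of_def)
      fix a b assume "a \<in> \<Union>\<C>" "b \<in> \<Union>\<C>"
      then obtain F G where FG: "F \<in> \<C>" "G \<in> \<C>" "a \<in> F" "b \<in> G" by blast
      then have "\<exists>H\<in>\<C>. a \<in> H \<and> b \<in> H" using lin[of F G] by blast
      then obtain H where H: "H \<in> \<C>" "a \<in> H" "b \<in> H" by blast
      then have "filter_of M H" "a \<in> carrier M" "b \<in> carrier M" using CS[OF H(1)] by (auto simp: filter_of_def)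
      then have "a \<sqinter> b \<in> H" using H by (simp add: filter_of_def)
      then show "a \<sqinter> b \<in> \<Union>\<C>" using H(1) by blast
    next
      fix a b assume "a \<in> \<Union>\<C>" and b: "b \<in> carrier M" "a \<sqsubseteq> b"
      then obtain F where F: "F \<in> \<C>" "a \<in> F" by blast
      then have "b \<in> F" using CS[OF F(1)] filter_up[of F a b] b by simp
      then show "b \<in> \<Union>\<C>" using F(1) by blast
    qed
    moreover have "F0 \<subseteq> \<Union>\<C>" using CS[OF F1] F1 by blast
    moreover have "\<Union>\<C> \<inter> I = {}" using CS by blast
    ultimately show "\<Union>\<C> \<in> \<S>" by (simp add: \<S>_def)
  qed
  then obtain F where FS: "F \<in> \<S>" and maxS: "\<forall>X\<in>\<S>. F \<subseteq> X \<longrightarrow> X = F" by (rule bexE)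
  then have F: "filter_of M F" "F0 \<subseteq> F" "F \<inter> I = {}" by (simp_all add: \<S>_def)
  have max: "G = F" if "filter_of M G" "F0 \<subseteq> G" "G \<inter> I = {}" "F \<subseteq> G" for G
    using maxS that by (simp add: \<S>_def)
  have Fc: "x \<in> F \<Longrightarrow> x \<in> carrier M" for x using F(1) by (auto simp: filter_of_def)
  have meetsI: "\<exists>f\<in>F. \<exists>i\<in>I. f \<sqinter> a \<sqsubseteq> i" if a: "a \<in> carrier M" "a \<notin> F" for a
  proof (rule ccontr)
    assume "\<not> ?thesis"
    then have "adjoin F a \<inter> I = {}" by (auto simp: adjoin_def)
    then have "adjoin F a = F"
      using max[of "adjoin F a"] filter_adjoin[OF F(1) a(1)] F(2) by (simp add: subset_trans)
    then show False using filter_adjoin(3)[OF F(1) a(1)] a(2) by simp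
  qed
  have "spectral M F"
    unfolding spectral_def
  proof (intro conjI ballI iffI)
    fix a b assume a: "a \<in> carrier M" and b: "b \<in> carrier M"
    {
      assume "a \<in> F \<or> b \<in> F"
      then show "a \<squnion> b \<in> F"
        using filter_up[OF F(1), of a "a \<squnion> b"] filter_up[OF F(1), of b "a \<squnion> b"] a b
        by (auto simp: join_left join_right)
    }
    assume ab: "a \<squnion> b \<in> F"
    show "a \<in> F \<or> b \<in> F"
    proof (rule ccontr)
      assume "\<not> (a \<in> F \<or> b \<in> F)"
      then have "\<exists>f\<in>F. \<exists>i\<in>I. f \<sqinter> a \<sqsubseteq> i" "\<exists>g\<in>F. \<exists>k\<in>I. g \<sqinter> b \<sqsubseteq> k" using meetsI a b by simp_all
      then obtain f i g k where fi: "f \<in> F" "i \<in> I" "f \<sqinter> a \<sqsubseteq> i" and gk: "g \<in> F" "k \<in> I" "g \<sqinter> b \<sqsubseteq> k"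
        by blast
      have c: "f \<in> carrier M" "g \<in> carrier M" "i \<in> carrier M" "k \<in> carrier M" using fi gk Fc I by auto
      let ?h = "f \<sqinter> g"
      have hF: "?h \<in> F" using F(1) fi gk c by (simp add: filter_of_def)
      have ik: "i \<sqsubseteq> i \<squnion> k" "k \<sqsubseteq> i \<squnion> k" using c by (simp_all add: join_left join_right)
      have "?h \<sqinter> a \<sqsubseteq> f \<sqinter> a" "?h \<sqinter> b \<sqsubseteq> g \<sqinter> b"
        using a b c by (simp_all add: meet_mono meet_left meet_right)
      then have "?h \<sqinter> a \<sqsubseteq> i" "?h \<sqinter> b \<sqsubseteq> k"
        using le_trans[OF _ fi(3), of "?h \<sqinter> a"] le_trans[OF _ gk(3), of "?h \<sqinter> b"] a b c by simp_all
      then have "?h \<sqinter> a \<sqsubseteq> i \<squnion> k" "?h \<sqinter> b \<sqsubseteq> i \<squnion> k"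
        using le_trans[OF _ ik(1), of "?h \<sqinter> a"] le_trans[OF _ ik(2), of "?h \<sqinter> b"] a b c by simp_all
      then have "?h \<sqinter> (a \<squnion> b) \<sqsubseteq> i \<squnion> k" using a b c by (simp add: distrib join_le)
      moreover have "?h \<sqinter> (a \<squnion> b) \<in> F" using F(1) hF ab a b c by (simp add: filter_of_def)
      ultimately have "i \<squnion> k \<in> F" using filter_up[OF F(1)] c by simp
      then show False using Ij[OF fi(2) gk(2)] F(3) by blast
    qed
  qed (rule F(1))
  then show ?thesis using that F by blast
qed

lemma spectral_carrier: "spectral M (carrier M)"
  by (simp add: spectral_def filter_of_def)

lemma principal_filter: "a \<in> carrier M \<Longrightarrow> filter_of M {b \<in> carrier M. a \<sqsubseteq> b}"
proof (rule filter_ofI)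
  fix b c assume "a \<in> carrier M" "b \<in> {b \<in> carrier M. a \<sqsubseteq> b}" "c \<in> carrier M" "b \<sqsubseteq> c"
  then show "c \<in> {b \<in> carrier M. a \<sqsubseteq> b}" using le_trans[of a b c] by simp
qed (auto simp: meet_le)

lemma spectral_separates:
  assumes "a \<in> carrier M" "b \<in> carrier M" "\<not> a \<sqsubseteq> b"
  obtains F where "spectral M F" "a \<in> F" "b \<notin> F"
proof -
  have "{b \<in> carrier M. a \<sqsubseteq> b} \<inter> {b} = {}" using assms by auto
  moreover have "b \<squnion> b = b" using assms(2) by (intro join_eqI) auto
  ultimately obtain F where "spectral M F" "{b \<in> carrier M. a \<sqsubseteq> b} \<subseteq> F" "F \<inter> {b} = {}"
    using spectral_extension[OF principal_filter[OF assms(1)], of "{b}"] assms(2) by auto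
  then show ?thesis using that[of F] assms(1) by auto
qed

text \<open>If \<open>F \<subset> G\<close>, pick \<open>b \<in> G - F\<close>. For any \<open>c\<close>, the complement of \<open>b\<close> in the interval above
  \<open>b \<sqinter> c\<close> lies in \<open>F\<close> because \<open>F\<close> is prime, so \<open>G\<close> contains its meet with \<open>b\<close>, and thus \<open>c\<close>.\<close>

lemma spectral_incomparable:
  assumes F: "spectral M F" and G: "spectral M G" and FG: "F \<subseteq> G" "F \<noteq> G"
  shows "G = carrier M"
proof -
  have Gc: "G \<subseteq> carrier M" using G by (simp add: spectral_def filter_of_def)
  obtain b where b: "b \<in> G" "b \<notin> F" "b \<in> carrier M" using FG Gc by blast
  have "c \<in> G" if c: "c \<in> carrier M" for c
  proof -
    have "b \<sqinter> c \<in> carrier M" "b \<sqinter> c \<sqsubseteq> b" using b c by (simp_all add: meet_left)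
    then obtain y where y: "y \<in> carrier M" "b \<sqinter> y = b \<sqinter> c" "b \<squnion> y = \<top>"
      by (rule relative_complement[OF _ b(3)])
    have "\<top> \<in> F" using F by (simp add: spectral_def filter_of_def)
    then have "b \<squnion> y \<in> F" using y by simp
    moreover have "b \<squnion> y \<in> F \<longleftrightarrow> b \<in> F \<or> y \<in> F" using F b y(1) by (simp add: spectral_def)
    ultimately have "y \<in> F" using b by simp
    then have "y \<in> G" using FG by blast
    then have "b \<sqinter> y \<in> G" using G b y(1) by (simp add: spectral_def filter_of_def)
    then have "b \<sqinter> c \<in> G" using y(2) by simp
    then show "c \<in> G" using G b c by (simp add: spectral_def filter_of_def)
  qed
  then show ?thesis using Gc by blast
qed

end

text \<open>The order and the core are determined by the point at infinity, and the axioms on them follow from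
  the separation of points by clopen sets.\<close>

lemma pointed_Stone_spaceI:
  fixes T :: "'x topology"
  assumes T: "compact_space T" and m: "m \<in> topspace T"
    and sep: "\<And>x y. \<lbrakk>x \<in> topspace T; y \<in> topspace T; x \<noteq> m; y \<noteq> x\<rbrakk>
      \<Longrightarrow> \<exists>U. openin T U \<and> closedin T U \<and> m \<in> U \<and> y \<in> U \<and> x \<notin> U"
  shows "pointed_Stone_space \<lparr>topo = T, leq = {(x, y) \<in> topspace T \<times> topspace T. x = y \<or> y = m},
    core = topspace T - {m}, pt = m\<rparr>"
proof -
  define r where "r = {(x, y) \<in> topspace T \<times> topspace T. x = y \<or> y = m}"
  define X where "X = \<lparr>topo = T, leq = r, core = topspace T - {m}, pt = m\<rparr>"
  have r: "(x, y) \<in> r \<longleftrightarrow> x \<in> topspace T \<and> y \<in> topspace T \<and> (x = y \<or> y = m)" for x y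
    by (simp add: r_def)
  have [simp]: "topo X = T" "leq X = r" "core X = topspace T - {m}" "pt X = m"
    by (simp_all add: X_def)
  have up: "U \<in> clopen_upsets T r \<longleftrightarrow> openin T U \<and> closedin T U \<and> (U \<noteq> {} \<longrightarrow> m \<in> U)" for U
    using m openin_subset[of T U] by (auto simp: clopen_upsets_def r)
  have adm: "U \<in> admissible X \<longleftrightarrow> openin T U \<and> closedin T U \<and> m \<in> U" for U
    using m openin_subset[of T U] by (auto simp: admissible_def clopen_upsets_def maximal_points_def r)
  have sep': "\<exists>U\<in>admissible X. y \<in> U \<and> x \<notin> U"
    if "x \<in> topspace T" "y \<in> topspace T" "x \<noteq> m" "y \<noteq> x" for x y
    using sep[OF that] by (auto simp: adm)
  have "Priestley_space T r"
    unfolding Priestley_space_def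
  proof (intro conjI ballI impI)
    show "partial_order_on (topspace T) r"
      by (auto simp: partial_order_on_def preorder_on_def refl_on_def trans_def antisym_def r)
    fix x y assume "x \<in> topspace T" "y \<in> topspace T" "(x, y) \<notin> r"
    then have "\<exists>U. openin T U \<and> closedin T U \<and> m \<in> U \<and> x \<in> U \<and> y \<notin> U" by (intro sep) (auto simp: r)
    then show "\<exists>U\<in>clopen_upsets T r. x \<in> U \<and> y \<notin> U" by (auto simp: up)
  qed (rule T)
  moreover have "subtopology T (topspace T - {m}) closure_of (topspace T - {m}) = topspace T - {m}"
  proof -
    have e: "topspace (subtopology T (topspace T - {m})) = topspace T - {m}" by auto
    show ?thesis using closure_of_topspace[of "subtopology T (topspace T - {m})"] unfolding e .
  qed
  moreover have "x \<in> topspace T - {m} \<longleftrightarrow>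
      admissible_missing X x \<noteq> {} \<and> directed (admissible_missing X x)" if x: "x \<in> topspace T" for x
  proof
    assume "x \<in> topspace T - {m}"
    then have "\<exists>U\<in>admissible X. m \<in> U \<and> x \<notin> U" using m by (intro sep') auto
    moreover have "U \<union> V \<in> admissible_missing X x"
      if "U \<in> admissible_missing X x" "V \<in> admissible_missing X x" for U V
      using that by (auto simp: admissible_missing_def adm closedin_Un)
    then have "directed (admissible_missing X x)"
      unfolding directed_def by (meson Un_upper1 Un_upper2)
    ultimately show "admissible_missing X x \<noteq> {} \<and> directed (admissible_missing X x)"
      by (auto simp: admissible_missing_def)
  next
    assume "admissible_missing X x \<noteq> {} \<and> directed (admissible_missing X x)"
    then have "x \<noteq> m" by (auto simp: admissible_missing_def adm)
    then show "x \<in> topspace T - {m}" using x by simp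
  qed
  moreover have "(x, y) \<in> r \<longleftrightarrow> (\<forall>U\<in>admissible X. x \<in> U \<longrightarrow> y \<in> U)"
    if "x \<in> topspace T" "y \<in> topspace T" for x y
  proof
    assume "(x, y) \<in> r"
    then show "\<forall>U\<in>admissible X. x \<in> U \<longrightarrow> y \<in> U" by (auto simp: adm r)
  next
    assume *: "\<forall>U\<in>admissible X. x \<in> U \<longrightarrow> y \<in> U"
    show "(x, y) \<in> r"
    proof (rule ccontr)
      assume "(x, y) \<notin> r"
      then have "\<exists>U\<in>admissible X. x \<in> U \<and> y \<notin> U" using that by (intro sep') (auto simp: r)
      then show False using * by blast
    qed
  qed
  ultimately have "pointed_generalized_Priestley_space X"
    unfolding pointed_generalized_Priestley_space_def using m by (auto simp: r)
  then have "pointed_Stone_space X"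
    unfolding pointed_Stone_space_def pointed_Priestley_space_def by (auto simp: r)
  then show ?thesis unfolding X_def r_def .
qed

text \<open>This shows that the spectrum of an algebra has no more admissible sets than the algebra has
  elements. Compactness is used twice: for each point outside \<open>U\<close> it yields a member of \<open>\<S>\<close> that contains
  \<open>U\<close> and avoids the point, and then a member contained in \<open>U\<close>.\<close>

lemma (in stone) separating_sublattice:
  assumes S: "\<S> \<subseteq> admissible X" and top: "pts X \<in> \<S>"
    and int: "\<And>U V. \<lbrakk>U \<in> \<S>; V \<in> \<S>\<rbrakk> \<Longrightarrow> U \<inter> V \<in> \<S>"
    and un: "\<And>U V. \<lbrakk>U \<in> \<S>; V \<in> \<S>\<rbrakk> \<Longrightarrow> U \<union> V \<in> \<S>"
    and sep: "\<And>x y. \<lbrakk>x \<in> pts X; y \<in> pts X; x \<noteq> pt X; y \<noteq> x\<rbrakk> \<Longrightarrow> \<exists>U\<in>\<S>. y \<in> U \<and> x \<notin> U"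
  shows "\<S> = admissible X"
proof (intro equalityI S subsetI)
  fix U assume "U \<in> admissible X"
  then have U: "openin (topo X) U" "closedin (topo X) U" "pt X \<in> U" "U \<subseteq> pts X"
    using admissible_subset by (simp_all add: admissible_iff)
  have SA: "openin (topo X) V" "closedin (topo X) V" if "V \<in> \<S>" for V
    using S that by (auto dest: admissible_iff[THEN iffD1])
  have step: "\<exists>V\<in>\<S>. U \<subseteq> V \<and> x \<notin> V" if x: "x \<in> pts X" "x \<notin> U" for x
  proof -
    have ex: "\<exists>V\<in>\<S>. y \<in> V \<and> x \<notin> V" if "y \<in> U" for y
      by (rule sep) (use x U that in auto)
    then have "\<Inter>{U} \<subseteq> \<Union>{V \<in> \<S>. x \<notin> V}" by auto
    then obtain W V where "W \<in> {U}" "V \<in> {V \<in> \<S>. x \<notin> V}" "W \<subseteq> V"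
    proof (rule compact_interpolation[OF compact])
      show "{V \<in> \<S>. x \<notin> V} \<noteq> {}" using ex[OF U(3)] by auto
    qed (use U SA un in auto)
    then show ?thesis by auto
  qed
  have "x \<in> U" if x: "x \<in> \<Inter>{V \<in> \<S>. U \<subseteq> V}" for x
  proof (rule ccontr)
    assume "x \<notin> U"
    moreover have "x \<in> pts X" by (rule InterD[OF x]) (use top U in simp)
    ultimately obtain V where "V \<in> \<S>" "U \<subseteq> V" "x \<notin> V" using step by blast
    then show False using x by blast
  qed
  then have "\<Inter>{V \<in> \<S>. U \<subseteq> V} \<subseteq> \<Union>{U}" by auto
  then obtain V W where "V \<in> {V \<in> \<S>. U \<subseteq> V}" "W \<in> {U}" "V \<subseteq> W"
  proof (rule compact_interpolation[OF compact])
    show "{V \<in> \<S>. U \<subseteq> V} \<noteq> {}" using top U by auto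
  qed (use U SA int in auto)
  then show "U \<in> \<S>" by auto
qed

text \<open>The points of the spectrum are encoded by an injection \<open>j\<close>, because the carrier type of
  spaces need not be the type of sets over the algebra.\<close>

locale spectrum = gba M for M :: "'u gorder" +
  fixes j :: "'u set \<Rightarrow> 'x"
  assumes inj: "inj_on j (Pow (carrier M))"
begin

definition points :: "'x set" where "points = j ` {F. spectral M F}"

definition \<phi> :: "'u \<Rightarrow> 'x set" where "\<phi> a = j ` {F. spectral M F \<and> a \<in> F}"

definition subbase :: "'x set set" where
  "subbase = \<phi> ` carrier M \<union> (\<lambda>a. points - \<phi> a) ` carrier M"

definition T :: "'x topology" where
  "T = topology (arbitrary union_of (finite intersection_of (\<lambda>x. x \<in> subbase) relative_to points))"

lemma spectral_subset: "spectral M F \<Longrightarrow> F \<subseteq> carrier M"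
  by (simp add: spectral_def filter_of_def)

lemma j_eq: "\<lbrakk>spectral M F; spectral M G\<rbrakk> \<Longrightarrow> j F = j G \<longleftrightarrow> F = G"
  using inj_onD[OF inj, of F G] spectral_subset[of F] spectral_subset[of G] by auto

lemma j_in_\<phi>: "spectral M F \<Longrightarrow> j F \<in> \<phi> a \<longleftrightarrow> a \<in> F"
  unfolding \<phi>_def by (auto simp: j_eq)

lemma points_cases:
  assumes "x \<in> points"
  obtains F where "spectral M F" "x = j F"
  using assms by (auto simp: points_def)

lemma j_in_points: "spectral M F \<Longrightarrow> j F \<in> points"
  by (simp add: points_def)

lemma \<phi>_subset: "\<phi> a \<subseteq> points"
  by (auto simp: \<phi>_def points_def)

lemma \<phi>_top: "\<phi> \<top>\<^bsub>M\<^esub> = points"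
  by (auto simp: \<phi>_def points_def spectral_def filter_of_def)

lemma \<phi>_eqI:
  assumes "S \<subseteq> points" "\<And>F. spectral M F \<Longrightarrow> a \<in> F \<longleftrightarrow> j F \<in> S"
  shows "\<phi> a = S"
proof (intro equalityI subsetI)
  fix x assume "x \<in> \<phi> a"
  then obtain F where "spectral M F" "x = j F" "a \<in> F" by (auto simp: \<phi>_def)
  then show "x \<in> S" using assms(2) by simp
next
  fix x assume x: "x \<in> S"
  then obtain F where "spectral M F" "x = j F" using points_cases assms(1) by blast
  then show "x \<in> \<phi> a" using assms(2) x by (simp add: j_in_\<phi>)
qed

lemma \<phi>_meet:
  assumes "a \<in> carrier M" "b \<in> carrier M"
  shows "\<phi> (a \<sqinter>\<^bsub>M\<^esub> b) = \<phi> a \<inter> \<phi> b"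
proof (rule \<phi>_eqI)
  fix F assume F: "spectral M F"
  then have "a \<sqinter>\<^bsub>M\<^esub> b \<in> F \<longleftrightarrow> a \<in> F \<and> b \<in> F" using assms by (simp add: spectral_def filter_of_def)
  then show "a \<sqinter>\<^bsub>M\<^esub> b \<in> F \<longleftrightarrow> j F \<in> \<phi> a \<inter> \<phi> b" using F by (simp add: j_in_\<phi>)
qed (use \<phi>_subset in blast)

lemma \<phi>_join:
  assumes "a \<in> carrier M" "b \<in> carrier M"
  shows "\<phi> (a \<squnion>\<^bsub>M\<^esub> b) = \<phi> a \<union> \<phi> b"
proof (rule \<phi>_eqI)
  fix F assume F: "spectral M F"
  then have "a \<squnion>\<^bsub>M\<^esub> b \<in> F \<longleftrightarrow> a \<in> F \<or> b \<in> F" using assms by (simp add: spectral_def)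
  then show "a \<squnion>\<^bsub>M\<^esub> b \<in> F \<longleftrightarrow> j F \<in> \<phi> a \<union> \<phi> b" using F by (simp add: j_in_\<phi>)
qed (use \<phi>_subset in blast)

lemma \<phi>_le_iff:
  assumes "a \<in> carrier M" "b \<in> carrier M"
  shows "\<phi> a \<subseteq> \<phi> b \<longleftrightarrow> a \<sqsubseteq>\<^bsub>M\<^esub> b"
proof
  assume *: "\<phi> a \<subseteq> \<phi> b"
  show "a \<sqsubseteq>\<^bsub>M\<^esub> b"
  proof (rule ccontr)
    assume "\<not> a \<sqsubseteq>\<^bsub>M\<^esub> b"
    then obtain F where F: "spectral M F" "a \<in> F" "b \<notin> F" by (rule spectral_separates[OF assms])
    then have "j F \<in> \<phi> a" "j F \<notin> \<phi> b" by (simp_all add: j_in_\<phi>)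
    then show False using * by blast
  qed
next
  assume "a \<sqsubseteq>\<^bsub>M\<^esub> b"
  then have "b \<in> F" if "spectral M F" "a \<in> F" for F
    using filter_up[of F a b] that assms by (simp add: spectral_def)
  then show "\<phi> a \<subseteq> \<phi> b" by (auto simp: \<phi>_def)
qed

lemma topspace_T [simp]: "topspace T = points"
  by (simp add: T_def)

lemma openin_subbase_T:
  assumes "S \<in> subbase"
  shows "openin T S"
proof -
  have "S \<subseteq> points" using assms \<phi>_subset by (auto simp: subbase_def)
  then show ?thesis
    unfolding T_def openin_subbase using assms
    by (intro arbitrary_union_of_inc relative_to_subset_inc finite_intersection_of_inc)
qed

lemma \<phi>_clopen:
  assumes "a \<in> carrier M"
  shows "openin T (\<phi> a)" "closedin T (\<phi> a)"
proof -
  show "openin T (\<phi> a)" by (rule openin_subbase_T) (use assms in \<open>simp add: subbase_def\<close>)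
  have "openin T (points - \<phi> a)" by (rule openin_subbase_T) (use assms in \<open>simp add: subbase_def\<close>)
  then show "closedin T (\<phi> a)" by (simp add: closedin_def \<phi>_subset)
qed

text \<open>By the Alexander subbase lemma only covers by subbasic sets matter: by \<open>\<phi> a\<close> for \<open>a \<in> A\<close> and the
  complements of \<open>\<phi> b\<close> for \<open>b \<in> B\<close>. That they cover says that every spectral filter containing \<open>B\<close> meets
  \<open>A\<close>. The elements above finite meets from \<open>B\<close> form a filter \<open>F0\<close> and those below finite joins from
  \<open>A\<close> form an ideal \<open>I\<close>; both are described through \<open>\<phi>\<close>, which also makes sense for empty joins. If
  they were disjoint, a spectral filter would separate them. A common element yields a finite
  subcover.\<close>

lemma compact_T: "compact_space T"
proof (rule Alexander_subbase_alt)
  have "\<phi> \<top>\<^bsub>M\<^esub> \<in> subbase" by (simp add: subbase_def)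
  then show "points \<subseteq> \<Union>subbase" unfolding \<phi>_top by blast
  show "topology (arbitrary union_of (finite intersection_of (\<lambda>x. x \<in> subbase) relative_to points)) = T"
    by (simp add: T_def)
  fix \<C> assume C: "\<C> \<subseteq> subbase" "points \<subseteq> \<Union>\<C>"
  let ?A = "{a \<in> carrier M. \<phi> a \<in> \<C>}" and ?B = "{b \<in> carrier M. points - \<phi> b \<in> \<C>}"
  have none: "?A \<inter> F \<noteq> {}" if F: "spectral M F" "?B \<subseteq> F" for F
  proof -
    have "j F \<in> points" using F(1) by (rule j_in_points)
    then obtain c where c: "c \<in> \<C>" "j F \<in> c" using C(2) by blast
    then have "c \<in> subbase" using C(1) by blast
    then consider a where "a \<in> carrier M" "c = \<phi> a" | b where "b \<in> carrier M" "c = points - \<phi> b"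
      by (auto simp: subbase_def)
    then show ?thesis
    proof cases
      case 1
      then have "a \<in> F" using c F(1) by (simp add: j_in_\<phi>)
      then show ?thesis using 1 c by auto
    next
      case 2
      then have "b \<notin> F" using c F(1) by (simp add: j_in_\<phi>)
      moreover have "b \<in> ?B" using 2 c by simp
      ultimately show ?thesis using F(2) by blast
    qed
  qed
  define F0 where "F0 = {z \<in> carrier M. \<exists>B0. finite B0 \<and> B0 \<subseteq> ?B \<and> points \<inter> \<Inter>(\<phi> ` B0) \<subseteq> \<phi> z}"
  define I where "I = {z \<in> carrier M. \<exists>A0. finite A0 \<and> A0 \<subseteq> ?A \<and> \<phi> z \<subseteq> \<Union>(\<phi> ` A0)}"
  have "filter_of M F0"
  proof (rule filter_ofI)
    show "\<top>\<^bsub>M\<^esub> \<in> F0" by (auto simp: F0_def \<phi>_top)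
    fix a b assume "a \<in> F0" "b \<in> F0"
    then obtain B1 B2 where *: "finite B1" "B1 \<subseteq> ?B" "points \<inter> \<Inter>(\<phi> ` B1) \<subseteq> \<phi> a"
      "finite B2" "B2 \<subseteq> ?B" "points \<inter> \<Inter>(\<phi> ` B2) \<subseteq> \<phi> b"
      and ab: "a \<in> carrier M" "b \<in> carrier M" unfolding F0_def by blast
    have "finite (B1 \<union> B2)" "B1 \<union> B2 \<subseteq> ?B" "points \<inter> \<Inter>(\<phi> ` (B1 \<union> B2)) \<subseteq> \<phi> (a \<sqinter>\<^bsub>M\<^esub> b)"
      unfolding \<phi>_meet[OF ab] using * by auto
    then show "a \<sqinter>\<^bsub>M\<^esub> b \<in> F0"
      unfolding F0_def using ab by (intro CollectI conjI exI[of _ "B1 \<union> B2"]) (assumption | simp)+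
  next
    fix a b assume "a \<in> F0" and b: "b \<in> carrier M" "a \<sqsubseteq>\<^bsub>M\<^esub> b"
    then obtain B0 where B0: "finite B0" "B0 \<subseteq> ?B" "points \<inter> \<Inter>(\<phi> ` B0) \<subseteq> \<phi> a" and a: "a \<in> carrier M"
      unfolding F0_def by blast
    have "points \<inter> \<Inter>(\<phi> ` B0) \<subseteq> \<phi> b"
      by (rule subset_trans[OF B0(3) iffD2[OF \<phi>_le_iff[OF a b(1)] b(2)]])
    with B0(1,2) b(1) show "b \<in> F0"
      unfolding F0_def by (intro CollectI conjI exI[of _ B0])
  qed (auto simp: F0_def)
  moreover have "i \<squnion>\<^bsub>M\<^esub> k \<in> I" if I2: "i \<in> I" "k \<in> I" for i k
  proof -
    obtain A1 A2 where *: "finite A1" "A1 \<subseteq> ?A" "\<phi> i \<subseteq> \<Union>(\<phi> ` A1)"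
      "finite A2" "A2 \<subseteq> ?A" "\<phi> k \<subseteq> \<Union>(\<phi> ` A2)" and ik: "i \<in> carrier M" "k \<in> carrier M"
      using I2 unfolding I_def by blast
    have "finite (A1 \<union> A2)" "A1 \<union> A2 \<subseteq> ?A" "\<phi> (i \<squnion>\<^bsub>M\<^esub> k) \<subseteq> \<Union>(\<phi> ` (A1 \<union> A2))"
      unfolding \<phi>_join[OF ik] using * by auto
    then show ?thesis
      unfolding I_def using ik by (intro CollectI conjI exI[of _ "A1 \<union> A2"]) (assumption | simp)+
  qed
  moreover have "I \<subseteq> carrier M" by (auto simp: I_def)
  moreover have "b \<in> F0" if "b \<in> ?B" for b
    using that unfolding F0_def by (auto intro!: exI[of _ "{b}"])
  moreover have "a \<in> I" if "a \<in> ?A" for a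
    using that unfolding I_def by (auto intro!: exI[of _ "{a}"])
  ultimately have F0I: "filter_of M F0" "I \<subseteq> carrier M" "\<And>i k. \<lbrakk>i \<in> I; k \<in> I\<rbrakk> \<Longrightarrow> i \<squnion>\<^bsub>M\<^esub> k \<in> I"
    "?B \<subseteq> F0" "?A \<subseteq> I" by auto
  have "F0 \<inter> I \<noteq> {}"
  proof
    assume "F0 \<inter> I = {}"
    then obtain F where F: "spectral M F" "F0 \<subseteq> F" "F \<inter> I = {}"
      by (rule spectral_extension[OF F0I(1,2) _ F0I(3)])
    then show False using none[OF F(1)] F0I(4,5) by auto
  qed
  then obtain z A0 B0 where AB: "finite A0" "A0 \<subseteq> ?A" "\<phi> z \<subseteq> \<Union>(\<phi> ` A0)"
    "finite B0" "B0 \<subseteq> ?B" "points \<inter> \<Inter>(\<phi> ` B0) \<subseteq> \<phi> z"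
    by (auto simp: F0_def I_def)
  let ?C = "\<phi> ` A0 \<union> (\<lambda>b. points - \<phi> b) ` B0"
  have "finite ?C" "?C \<subseteq> \<C>" "points \<subseteq> \<Union>?C" using AB by auto
  then show "\<exists>C'. finite C' \<and> C' \<subseteq> \<C> \<and> points \<subseteq> \<Union>C'" by blast
qed

lemma separation_T:
  assumes "x \<in> points" "y \<in> points" "x \<noteq> j (carrier M)" "y \<noteq> x"
  shows "\<exists>a\<in>carrier M. y \<in> \<phi> a \<and> x \<notin> \<phi> a"
proof -
  obtain F where F: "spectral M F" "x = j F" using assms(1) by (rule points_cases)
  obtain G where G: "spectral M G" "y = j G" using assms(2) by (rule points_cases)
  have ne: "G \<noteq> F" "F \<noteq> carrier M" using assms F G by auto
  have "\<not> G \<subseteq> F" using spectral_incomparable[OF G(1) F(1)] ne by auto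
  then obtain a where a: "a \<in> G" "a \<notin> F" by blast
  then have "a \<in> carrier M" using spectral_subset[OF G(1)] by blast
  then show ?thesis using a F G by (auto simp: j_in_\<phi>)
qed

definition space :: "'x pointed_ospace" where
  "space = \<lparr>topo = T, leq = {(x, y) \<in> topspace T \<times> topspace T. x = y \<or> y = j (carrier M)},
    core = topspace T - {j (carrier M)}, pt = j (carrier M)\<rparr>"

lemma infinity_in_\<phi>: "a \<in> carrier M \<Longrightarrow> j (carrier M) \<in> \<phi> a"
  by (simp add: j_in_\<phi> spectral_carrier)

lemma pointed_Stone_space_space: "pointed_Stone_space space"
  unfolding space_def
proof (rule pointed_Stone_spaceI[OF compact_T])
  show "j (carrier M) \<in> topspace T" by (simp add: j_in_points spectral_carrier)
  fix x y assume "x \<in> topspace T" "y \<in> topspace T" "x \<noteq> j (carrier M)" "y \<noteq> x"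
  then obtain a where "a \<in> carrier M" "y \<in> \<phi> a" "x \<notin> \<phi> a" using separation_T[of x y] by auto
  then show "\<exists>U. openin T U \<and> closedin T U \<and> j (carrier M) \<in> U \<and> y \<in> U \<and> x \<notin> U"
    using \<phi>_clopen infinity_in_\<phi> by blast
qed

lemma order_iso_\<phi>: "order_iso M (algebra_of_space space) \<phi>"
proof -
  interpret X: stone space by unfold_locales (rule pointed_Stone_space_space)
  have s: "topo space = T" "pt space = j (carrier M)" by (simp_all add: space_def)
  have "\<phi> ` carrier M = admissible space"
  proof (rule X.separating_sublattice)
    show "\<phi> ` carrier M \<subseteq> admissible space"
      using \<phi>_clopen infinity_in_\<phi> by (auto simp: X.admissible_iff s)
    have "\<phi> \<top>\<^bsub>M\<^esub> \<in> \<phi> ` carrier M" by simp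
    then show "pts space \<in> \<phi> ` carrier M" by (simp add: s \<phi>_top)
    fix U V assume "U \<in> \<phi> ` carrier M" "V \<in> \<phi> ` carrier M"
    then obtain a b where ab: "a \<in> carrier M" "b \<in> carrier M" "U = \<phi> a" "V = \<phi> b" by auto
    have "\<phi> (a \<sqinter>\<^bsub>M\<^esub> b) \<in> \<phi> ` carrier M" "\<phi> (a \<squnion>\<^bsub>M\<^esub> b) \<in> \<phi> ` carrier M" using ab by simp_all
    then show "U \<inter> V \<in> \<phi> ` carrier M" "U \<union> V \<in> \<phi> ` carrier M"
      using ab by (simp_all add: \<phi>_meet \<phi>_join)
  next
    fix x y assume "x \<in> pts space" "y \<in> pts space" "x \<noteq> pt space" "y \<noteq> x"
    then have "\<exists>a\<in>carrier M. y \<in> \<phi> a \<and> x \<notin> \<phi> a" by (intro separation_T) (simp_all add: s)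
    then show "\<exists>U\<in>\<phi> ` carrier M. y \<in> U \<and> x \<notin> U" by blast
  qed
  moreover have "inj_on \<phi> (carrier M)"
  proof (rule inj_onI)
    fix a b assume *: "a \<in> carrier M" "b \<in> carrier M" "\<phi> a = \<phi> b"
    then have "a \<sqsubseteq>\<^bsub>M\<^esub> b" "b \<sqsubseteq>\<^bsub>M\<^esub> a" using \<phi>_le_iff[of a b] \<phi>_le_iff[of b a] by simp_all
    then show "a = b" using * by (intro le_antisym)
  qed
  ultimately show ?thesis by (simp add: order_iso_def bij_betw_def \<phi>_le_iff)
qed

end

lemma space_of_algebra_exists:
  fixes M :: "'u gorder"
  assumes M: "gba M" and size: "Pow (carrier M) \<lesssim> (UNIV :: 'x set)"
  shows "\<exists>X :: 'x pointed_ospace. pointed_Stone_space X \<and> (\<exists>w. order_iso M (algebra_of_space X) w)"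
proof -
  obtain j :: "'u set \<Rightarrow> 'x" where j: "inj_on j (Pow (carrier M))"
    using size by (auto simp: lepoll_def)
  interpret spectrum M j using M j by (simp add: spectrum_def spectrum_axioms_def)
  show ?thesis using pointed_Stone_space_space order_iso_\<phi> by blast
qed


section \<open>The remaining categories over algebras\<close>

lemma opposite_full_sub: "opposite (full_sub C P) = full_sub (opposite C) P"
  by (simp add: opposite_def full_sub_def)

lemma wide_sub_full_sub: "full_sub (wide_sub C R) P = wide_sub (full_sub C P) R"
  by (simp add: wide_sub_def full_sub_def)

lemma opposite_wide_sub: "opposite (wide_sub C R) = wide_sub (opposite C) (\<lambda>a b. R b a)"
  by (simp add: wide_sub_def opposite_def)

abbreviation identity_map :: "'a gorder \<Rightarrow> 'a gorder \<Rightarrow> ('a \<Rightarrow> 'a) \<Rightarrow> 'a \<Rightarrow> 'a" where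
  "identity_map M N h \<equiv> h"

lemma gba_map_Hom:
  "\<lbrakk>gba M; gba N; h \<in> carrier M \<rightarrow>\<^sub>E carrier N\<rbrakk> \<Longrightarrow> gba_map M N h"
  by (simp add: gba_map_def gba_map_axioms_def PiE_def)

lemma representation_GBA_M:
  "representation (GBA_M :: ('a gorder, 'a \<Rightarrow> 'a) precategory) preserves_finite_meets (\<lambda>M. M) identity_map"
  by (rule representation.intro) (simp_all add: GBA_M_def concrete_def gba_def)

lemma category_GBA_M: "category (GBA_M :: ('a gorder, 'a \<Rightarrow> 'a) precategory)"
proof -
  interpret representation "GBA_M :: ('a gorder, 'a \<Rightarrow> 'a) precategory" preserves_finite_meets "\<lambda>M. M" identity_map
    by (rule representation_GBA_M)
  show ?thesis
  proof (rule category)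
    fix M :: "'a gorder" assume "M \<in> Ob GBA_M"
    then interpret gba M by (simp add: GBA_M_def concrete_def gba_def)
    have "gba_map M M (\<lambda>x\<in>carrier M. x)" by unfold_locales simp
    then show "Idm GBA_M M \<in> Hom GBA_M M M"
      using meet_hom_id by (simp add: GBA_M_def concrete_def gba_map.preserves_finite_meets_iff)
  next
    fix M1 M2 M3 :: "'a gorder" and f g
    assume *: "M1 \<in> Ob GBA_M" "M2 \<in> Ob GBA_M" "M3 \<in> Ob GBA_M" "f \<in> Hom GBA_M M1 M2" "g \<in> Hom GBA_M M2 M3"
    interpret f: gba_map M1 M2 f by (rule gba_map[OF *(1,2,4)])
    interpret g: gba_map M2 M3 g by (rule gba_map[OF *(2,3,5)])
    have fg: "compose (carrier M1) g f \<in> carrier M1 \<rightarrow>\<^sub>E carrier M3" by (simp add: compose_def)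
    interpret gf: gba_map M1 M3 "compose (carrier M1) g f"
      by (rule gba_map_Hom[OF _ _ fg]) (unfold_locales)
    have "meet_hom M1 M2 f" "meet_hom M2 M3 g"
      using hom[OF *(1,2,4)] hom[OF *(2,3,5)]
      by (simp_all add: f.preserves_finite_meets_iff g.preserves_finite_meets_iff)
    then have "preserves_finite_meets M1 M3 (compose (carrier M1) g f)"
      unfolding gf.preserves_finite_meets_iff
      by (rule meet_hom_compose[OF f.gba_map_axioms g.gba_map_axioms])
    then show "Comp GBA_M M1 M2 M3 g f \<in> Hom GBA_M M1 M3"
      using fg by (simp add: GBA_M_def concrete_def)
  qed
qed

lemma representation_GBA:
  "category (GBA :: ('a gorder, 'a \<Rightarrow> 'a) precategory) \<and>
   representation (GBA :: ('a gorder, 'a \<Rightarrow> 'a) precategory) lattice_hom (\<lambda>M. M) identity_map"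
proof (rule representation_sub[OF representation_GBA_M category_GBA_M hom_class_lattice_hom, where P = lattice_hom])
  fix M N :: "'a gorder" and h
  assume "M \<in> Ob GBA_M" "N \<in> Ob GBA_M"
  then show "h \<in> Hom GBA M N \<longleftrightarrow> h \<in> Hom GBA_M M N \<and> lattice_hom M N h"
    using gba_map.GBA_hom_iff[OF gba_map_Hom[of M N h]]
    by (auto simp: GBA_def GBA_M_def concrete_def gba_def)
qed (simp_all add: GBA_def GBA_M_def concrete_def lattice_hom_meet gba_map.preserves_finite_meets_iff)

lemma representation_GBA_P:
  "category (GBA_P :: ('a gorder, 'a \<Rightarrow> 'a) precategory) \<and>
   representation (GBA_P :: ('a gorder, 'a \<Rightarrow> 'a) precategory) coinitial_hom (\<lambda>M. M) identity_map"
proof (rule representation_sub[OF representation_GBA_M category_GBA_M hom_class_coinitial_hom, where P = coinitial_hom])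
  fix M N :: "'a gorder" and h
  assume "M \<in> Ob GBA_M" "N \<in> Ob GBA_M"
  then show "h \<in> Hom GBA_P M N \<longleftrightarrow> h \<in> Hom GBA_M M N \<and> coinitial_hom M N h"
    using gba_map.GBA_P_hom_iff[OF gba_map_Hom[of M N h]]
    by (auto simp: GBA_P_def GBA_M_def concrete_def gba_def)
qed (simp_all add: GBA_P_def GBA_M_def concrete_def coinitial_hom_lattice lattice_hom_meet
    gba_map.preserves_finite_meets_iff)

lemma representation_LStoneFrm_FInf:
  "category (LStoneFrm_FInf :: ('f gorder, 'f \<Rightarrow> 'f) precategory) \<and>
   representation (LStoneFrm_FInf :: ('f gorder, 'f \<Rightarrow> 'f) precategory)
     lattice_hom algebra_of_frame restrict_to_compacts"
proof (rule representation_sub[OF representation_LStoneFrm_Sup category_LStoneFrm_Sup hom_class_lattice_hom])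
  fix L1 L2 :: "'f gorder" and \<alpha>
  assume "L1 \<in> Ob LStoneFrm_Sup" "L2 \<in> Ob LStoneFrm_Sup" "\<alpha> \<in> Hom LStoneFrm_Sup L1 L2"
  then interpret lsf_sup_hom L1 L2 \<alpha> by (simp add: Ob_LStoneFrm_Sup Hom_LStoneFrm_Sup)
  show "(\<forall>S\<subseteq>compacts L1. finite S \<and> S \<noteq> {} \<and> \<Sqinter>\<^bsub>L1\<^esub>S \<in> compacts L1 \<longrightarrow>
        \<alpha> (\<Sqinter>\<^bsub>L1\<^esub>S) = \<Sqinter>\<^bsub>L2\<^esub>(\<alpha> ` S)) \<longleftrightarrow>
      lattice_hom (algebra_of_frame L1) (algebra_of_frame L2) (restrict_to_compacts L1 L2 \<alpha>)"
    by (rule preserves_compact_meets_iff)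
qed (simp_all add: LStoneFrm_FInf_def wide_sub_def lattice_hom_meet gba_map.preserves_finite_meets_iff)

lemma representation_LStoneFrm:
  "category (LStoneFrm :: ('f gorder, 'f \<Rightarrow> 'f) precategory) \<and>
   representation (LStoneFrm :: ('f gorder, 'f \<Rightarrow> 'f) precategory)
     coinitial_hom algebra_of_frame restrict_to_compacts"
proof (rule representation_sub[OF representation_LStoneFrm_Sup category_LStoneFrm_Sup hom_class_coinitial_hom])
  fix L1 L2 :: "'f gorder" and \<alpha>
  assume "L1 \<in> Ob LStoneFrm_Sup" "L2 \<in> Ob LStoneFrm_Sup" "\<alpha> \<in> Hom LStoneFrm_Sup L1 L2"
  then interpret lsf_sup_hom L1 L2 \<alpha> by (simp add: Ob_LStoneFrm_Sup Hom_LStoneFrm_Sup)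
  show "preserves_finite_meets L1 L2 \<alpha> \<longleftrightarrow>
      coinitial_hom (algebra_of_frame L1) (algebra_of_frame L2) (restrict_to_compacts L1 L2 \<alpha>)"
    by (rule preserves_finite_meets_iff)
qed (auto simp: LStoneFrm_def LStoneFrm_Sup_def concrete_def coinitial_hom_lattice lattice_hom_meet
    gba_map.preserves_finite_meets_iff)

lemma stone_map_of_Hom:
  "\<lbrakk>Y \<in> Ob (opposite PStone_S); X \<in> Ob (opposite PStone_S); f \<in> Hom (opposite PStone_S) Y X\<rbrakk>
   \<Longrightarrow> stone_map X Y f"
  using Hom_PStone_S[of X Y f] by (simp add: opposite_def Ob_PStone_S)

lemma category_PStone_S: "category (PStone_S :: ('x pointed_ospace, 'x \<Rightarrow> 'x) precategory)"
proof -
  let ?C = "opposite (PStone_S :: ('x pointed_ospace, 'x \<Rightarrow> 'x) precategory)"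
  interpret representation ?C lattice_hom algebra_of_space preimage_map by (rule representation_PStone_S)
  have "category ?C"
  proof (rule category)
    fix X :: "'x pointed_ospace" assume "X \<in> Ob ?C"
    then interpret stone X by (simp add: opposite_def Ob_PStone_S)
    have "{x \<in> pts X. (\<lambda>x\<in>pts X. x) x \<in> U} = U" if "U \<in> admissible X" for U
      using admissible_subset[OF that] by auto
    then have "stone_map X X (\<lambda>x\<in>pts X. x)" by unfold_locales auto
    then show "Idm ?C X \<in> Hom ?C X X"
      using Hom_PStone_S[OF stone_axioms stone_axioms] by (simp add: opposite_def PStone_S_def concrete_def)
  next
    fix Z Y X :: "'x pointed_ospace" and g f
    assume *: "Z \<in> Ob ?C" "Y \<in> Ob ?C" "X \<in> Ob ?C" "g \<in> Hom ?C Z Y" "f \<in> Hom ?C Y X"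
    interpret g: stone_map Y Z g by (rule stone_map_of_Hom[OF *(1,2,4)])
    interpret f: stone_map X Y f by (rule stone_map_of_Hom[OF *(2,3,5)])
    have "{x \<in> pts X. compose (pts X) g f x \<in> U} \<in> admissible X" if "U \<in> admissible Z" for U
    proof -
      have "{x \<in> pts X. compose (pts X) g f x \<in> U} = {x \<in> pts X. f x \<in> {y \<in> pts Y. g y \<in> U}}"
        by (auto simp: compose_def)
      then show ?thesis using f.preimage[OF g.preimage[OF that]] by simp
    qed
    then have "stone_map X Z (compose (pts X) g f)" by unfold_locales (auto simp: compose_def)
    then show "Comp ?C Z Y X f g \<in> Hom ?C Z X"
      using Hom_PStone_S[OF f.X.stone_axioms g.Y.stone_axioms]
      by (simp add: opposite_def PStone_S_def concrete_def)
  qed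
  then show ?thesis using category_opposite by fastforce
qed

lemma representation_PStone_P:
  "category (opposite (PStone_P :: ('x pointed_ospace, 'x \<Rightarrow> 'x) precategory)) \<and>
   representation (opposite (PStone_P :: ('x pointed_ospace, 'x \<Rightarrow> 'x) precategory))
     coinitial_hom algebra_of_space preimage_map"
proof (rule representation_sub[OF representation_PStone_S category_opposite[OF category_PStone_S]
      hom_class_coinitial_hom, where P = "\<lambda>Y X f. f ` core X \<subseteq> core Y"])
  fix Y X :: "'x pointed_ospace" and f
  assume *: "Y \<in> Ob (opposite PStone_S)" "X \<in> Ob (opposite PStone_S)" "f \<in> Hom (opposite PStone_S) Y X"
  interpret stone_map X Y f by (rule stone_map_of_Hom[OF *])
  show "f ` core X \<subseteq> core Y \<longleftrightarrow>
      coinitial_hom (algebra_of_space Y) (algebra_of_space X) (preimage_map Y X f)"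
    by (rule preserves_core_iff)
qed (auto simp: opposite_def PStone_P_def wide_sub_def coinitial_hom_lattice)


section \<open>Size bounds and the equivalences\<close>

lemma order_iso_lepoll:
  assumes "order_iso M N \<phi>"
  shows "carrier M \<lesssim> carrier N" "carrier N \<lesssim> carrier M"
proof -
  have "carrier M \<approx> carrier N" using assms unfolding order_iso_def eqpoll_def by blast
  then show "carrier M \<lesssim> carrier N" "carrier N \<lesssim> carrier M"
    by (rule eqpoll_imp_lepoll, rule eqpoll_imp_lepoll[OF eqpoll_sym])
qed

lemma Pow_lepoll_Pow:
  assumes "B \<lesssim> A"
  shows "Pow B \<lesssim> Pow A"
proof -
  obtain f where f: "inj_on f B" "f ` B \<subseteq> A" using assms by (auto simp: lepoll_def)
  have "inj_on ((`) f) (Pow B)" using f(1) by (rule inj_on_image_Pow)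
  moreover have "(`) f ` Pow B \<subseteq> Pow A" using f(2) by blast
  ultimately show ?thesis unfolding lepoll_def by blast
qed

lemma embeds_into_member_lepoll:
  "\<lbrakk>embeds_into_member B S; D \<lesssim> B\<rbrakk> \<Longrightarrow> embeds_into_member D S"
  unfolding embeds_into_member_def by (meson lepoll_trans)

lemma embeds_into_member_Pow:
  assumes "embeds_into_member B S" "\<forall>A\<in>S. Pow A \<lesssim> (UNIV :: 'x set)"
  shows "Pow B \<lesssim> (UNIV :: 'x set)"
  using assms unfolding embeds_into_member_def by (meson Pow_lepoll_Pow lepoll_trans)

lemma frame_of_algebra_exists:
  fixes M :: "'u gorder"
  assumes M: "gba M" and size: "Pow (carrier M) \<lesssim> (UNIV :: 'f set)"
  shows "\<exists>L :: 'f gorder. locally_Stone_frame L \<and> (\<exists>w. order_iso M (algebra_of_frame L) w)"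
proof -
  (* The points of the spectrum of M can be sets of elements, so only the frame needs room. *)
  have "Pow (carrier M) \<lesssim> (UNIV :: 'u set set)" by (rule subset_imp_lepoll) simp
  then obtain X :: "'u set pointed_ospace" and w where X: "pointed_Stone_space X"
      "order_iso M (algebra_of_space X) w"
    using space_of_algebra_exists[OF M] by blast
  have "admissible X \<lesssim> carrier M" using order_iso_lepoll(2)[OF X(2)] by simp
  then have "Pow (admissible X) \<lesssim> (UNIV :: 'f set)" using Pow_lepoll_Pow size lepoll_trans by blast
  then obtain L :: "'f gorder" and v where "locally_Stone_frame L"
      "order_iso (algebra_of_space X) (algebra_of_frame L) v"
    using frame_of_space_exists[OF X(1)] by blast
  then show ?thesis using order_iso_comp[OF X(2)] by blast
qed

text \<open>An algebra of admissible size is that of a frame, so a represented structure only has to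
  realize the algebras of admissible size in order to match the frames.\<close>

lemma equivalent_small_frames:
  fixes S :: "'a set set" and C :: "('f gorder, 'f \<Rightarrow> 'f) precategory" and E :: "('p, 'n) precategory"
    and Ho :: "'p \<Rightarrow> 'e gorder"
  assumes size: "\<forall>A\<in>S. Pow A \<lesssim> (UNIV :: 'f set)"
    and C: "category C" "representation C Q algebra_of_frame restrict_to_compacts"
      "Ob C = {L. locally_Stone_frame L}"
    and E: "category E" "representation E Q' Ho Hm"
    and realize: "\<And>M :: 'f gorder. \<lbrakk>gba M; embeds_into_member (carrier M) S\<rbrakk>
      \<Longrightarrow> \<exists>x\<in>Ob E. \<exists>w. order_iso M (Ho x) w"
    and Q: "\<And>M1 M2 N1 N2 w v h g. iso_square M1 M2 N1 N2 w v h g \<Longrightarrow> Q M1 M2 h \<longleftrightarrow> Q' N1 N2 g"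
    and P: "\<And>a b f. \<lbrakk>a \<in> Ob C; b \<in> Ob C; f \<in> Hom C a b\<rbrakk>
      \<Longrightarrow> P a b f \<longleftrightarrow> B (algebra_of_frame a) (algebra_of_frame b) (restrict_to_compacts a b f)"
    and R: "\<And>x y g. \<lbrakk>x \<in> Ob E; y \<in> Ob E; g \<in> Hom E x y\<rbrakk> \<Longrightarrow> R x y g \<longleftrightarrow> B' (Ho x) (Ho y) (Hm x y g)"
    and B: "\<And>M1 M2 N1 N2 w v h g. iso_square M1 M2 N1 N2 w v h g \<Longrightarrow> B M1 M2 h \<longleftrightarrow> B' N1 N2 g"
    and BI: "\<And>N. gba N \<Longrightarrow> B' N N (\<lambda>x\<in>carrier N. x)"
  shows "equivalent (wide_sub (small_frames S C) P)
    (wide_sub (full_sub E (\<lambda>x. embeds_into_member (carrier (Ho x)) S)) R)"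
  unfolding small_frames_def
proof (rule equivalent_over_algebras[where Q = Q and Q' = Q' and B = B and B' = B',
      OF category_full_sub[OF C(1)] category_full_sub[OF E(1)]
        representation.full_sub[OF C(2)] representation.full_sub[OF E(2)]])
  fix L assume "L \<in> Ob (full_sub C (\<lambda>L. embeds_into_member (compacts L) S))"
  then have L: "lsf L" and small: "embeds_into_member (carrier (algebra_of_frame L)) S"
    by (simp_all add: full_sub_def C(3) lsf_def)
  obtain x w where x: "x \<in> Ob E" "order_iso (algebra_of_frame L) (Ho x) w"
    using realize[OF lsf.gba_algebra_of_frame[OF L] small] by blast
  then have "embeds_into_member (carrier (Ho x)) S"
    using embeds_into_member_lepoll[OF small order_iso_lepoll(2)] by blast
  then show "\<exists>x\<in>Ob (full_sub E (\<lambda>x. embeds_into_member (carrier (Ho x)) S)).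
      \<exists>w. order_iso (algebra_of_frame L) (Ho x) w"
    using x by (auto simp: full_sub_def)
next
  fix x assume "x \<in> Ob (full_sub E (\<lambda>x. embeds_into_member (carrier (Ho x)) S))"
  then have x: "x \<in> Ob E" and small: "embeds_into_member (carrier (Ho x)) S"
    by (simp_all add: full_sub_def)
  obtain L :: "'f gorder" and w where L: "locally_Stone_frame L" "order_iso (Ho x) (algebra_of_frame L) w"
    using frame_of_algebra_exists[OF representation.gba[OF E(2) x] embeds_into_member_Pow[OF small size]]
    by blast
  have "embeds_into_member (compacts L) S"
    using embeds_into_member_lepoll[OF small order_iso_lepoll(2)[OF L(2)]] by simp
  then show "\<exists>L\<in>Ob (full_sub C (\<lambda>L. embeds_into_member (compacts L) S)).
      \<exists>w. order_iso (algebra_of_frame L) (Ho x) w"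
    using L order_iso_inv[OF L(2)] by (auto simp: full_sub_def C(3))
next
  show "Q M1 M2 h \<longleftrightarrow> Q' N1 N2 g" if "iso_square M1 M2 N1 N2 w v h g" for M1 M2 N1 N2 w v h g
    by (rule Q[OF that])
  show "B M1 M2 h \<longleftrightarrow> B' N1 N2 g" if "iso_square M1 M2 N1 N2 w v h g" for M1 M2 N1 N2 w v h g
    by (rule B[OF that])
qed (simp_all add: full_sub_def P R BI)

lemma small_algebra_exists:
  fixes M :: "'u gorder" and S :: "'a set set"
  assumes M: "gba M" and small: "embeds_into_member (carrier M) S"
  shows "\<exists>N :: 'a gorder. generalized_boolean_algebra N \<and> (\<exists>w. order_iso M N w)"
proof -
  obtain e :: "'u \<Rightarrow> 'a" where "inj_on e (carrier M)"
    using small by (auto simp: embeds_into_member_def lepoll_def)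
  then obtain N :: "'a gorder" where "gba N" "order_iso M N e" by (rule gba_copy[OF M])
  then show ?thesis by (auto simp: gba_def)
qed

lemma opposite_small_spaces: "opposite (small_spaces S C) = small_spaces S (opposite C)"
  by (simp add: small_spaces_def opposite_full_sub)

theorem theorem7p13:
  fixes S :: "'a set set"
  assumes "\<forall>A\<in>S. Pow A \<lesssim> (UNIV :: 'f set)"
    and "\<forall>A\<in>S. Pow A \<lesssim> (UNIV :: 'x set)"
  shows
    "(category (small_frames S (LStoneFrm_Sup :: ('f gorder, 'f \<Rightarrow> 'f) precategory)) \<and>
      category (small_algebras S (GBA_M :: ('a gorder, 'a \<Rightarrow> 'a) precategory)) \<and>
      category (small_spaces S (PStone :: ('x pointed_ospace, ('x \<times> 'x) set) precategory)) \<and>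
      equivalent (small_frames S (LStoneFrm_Sup :: ('f gorder, 'f \<Rightarrow> 'f) precategory))
        (small_algebras S (GBA_M :: ('a gorder, 'a \<Rightarrow> 'a) precategory)) \<and>
      dually_equivalent (small_frames S (LStoneFrm_Sup :: ('f gorder, 'f \<Rightarrow> 'f) precategory))
        (small_spaces S (PStone :: ('x pointed_ospace, ('x \<times> 'x) set) precategory)))
     \<and>
     (category (small_frames S (LStoneFrm_FInf :: ('f gorder, 'f \<Rightarrow> 'f) precategory)) \<and>
      category (small_algebras S (GBA :: ('a gorder, 'a \<Rightarrow> 'a) precategory)) \<and>
      category (small_spaces S (PStone_S :: ('x pointed_ospace, 'x \<Rightarrow> 'x) precategory)) \<and>
      equivalent (small_frames S (LStoneFrm_FInf :: ('f gorder, 'f \<Rightarrow> 'f) precategory))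
        (small_algebras S (GBA :: ('a gorder, 'a \<Rightarrow> 'a) precategory)) \<and>
      dually_equivalent (small_frames S (LStoneFrm_FInf :: ('f gorder, 'f \<Rightarrow> 'f) precategory))
        (small_spaces S (PStone_S :: ('x pointed_ospace, 'x \<Rightarrow> 'x) precategory)))
     \<and>
     (equivalent (small_frames S (LStoneFrm_FInfB :: ('f gorder, 'f \<Rightarrow> 'f) precategory))
        (small_algebras S (GBA_B :: ('a gorder, 'a \<Rightarrow> 'a) precategory)) \<and>
      dually_equivalent (small_frames S (LStoneFrm_FInfB :: ('f gorder, 'f \<Rightarrow> 'f) precategory))
        (small_spaces S (PStone_ST :: ('x pointed_ospace, 'x \<Rightarrow> 'x) precategory)))
     \<and>
     (category (small_frames S (LStoneFrm :: ('f gorder, 'f \<Rightarrow> 'f) precategory)) \<and>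
      category (small_algebras S (GBA_P :: ('a gorder, 'a \<Rightarrow> 'a) precategory)) \<and>
      category (small_spaces S (PStone_P :: ('x pointed_ospace, 'x \<Rightarrow> 'x) precategory)) \<and>
      equivalent (small_frames S (LStoneFrm :: ('f gorder, 'f \<Rightarrow> 'f) precategory))
        (small_algebras S (GBA_P :: ('a gorder, 'a \<Rightarrow> 'a) precategory)) \<and>
      dually_equivalent (small_frames S (LStoneFrm :: ('f gorder, 'f \<Rightarrow> 'f) precategory))
        (small_spaces S (PStone_P :: ('x pointed_ospace, 'x \<Rightarrow> 'x) precategory)))"
proof -
  let ?Sup = "LStoneFrm_Sup :: ('f gorder, 'f \<Rightarrow> 'f) precategory"
  let ?FInf = "LStoneFrm_FInf :: ('f gorder, 'f \<Rightarrow> 'f) precategory"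
  let ?FInfB = "LStoneFrm_FInfB :: ('f gorder, 'f \<Rightarrow> 'f) precategory"
  let ?Frm = "LStoneFrm :: ('f gorder, 'f \<Rightarrow> 'f) precategory"
  let ?M = "GBA_M :: ('a gorder, 'a \<Rightarrow> 'a) precategory"
  let ?GBA = "GBA :: ('a gorder, 'a \<Rightarrow> 'a) precategory"
  let ?GBA_B = "GBA_B :: ('a gorder, 'a \<Rightarrow> 'a) precategory"
  let ?GBA_P = "GBA_P :: ('a gorder, 'a \<Rightarrow> 'a) precategory"
  let ?PStone = "PStone :: ('x pointed_ospace, ('x \<times> 'x) set) precategory"
  let ?PStone_S = "PStone_S :: ('x pointed_ospace, 'x \<Rightarrow> 'x) precategory"
  let ?PStone_ST = "PStone_ST :: ('x pointed_ospace, 'x \<Rightarrow> 'x) precategory"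
  let ?PStone_P = "PStone_P :: ('x pointed_ospace, 'x \<Rightarrow> 'x) precategory"
  have ObF: "Ob ?Sup = {L. locally_Stone_frame L}" "Ob ?FInf = {L. locally_Stone_frame L}"
      "Ob ?Frm = {L. locally_Stone_frame L}"
    by (simp_all add: LStoneFrm_FInf_def wide_sub_def LStoneFrm_Sup_def LStoneFrm_def concrete_def)
  note Sup = category_LStoneFrm_Sup representation_LStoneFrm_Sup ObF(1)
  note FInf = representation_LStoneFrm_FInf[THEN conjunct1] representation_LStoneFrm_FInf[THEN conjunct2] ObF(2)
  note Frm = representation_LStoneFrm[THEN conjunct1] representation_LStoneFrm[THEN conjunct2] ObF(3)
  note M = category_GBA_M representation_GBA_M
  note GBA = representation_GBA[THEN conjunct1] representation_GBA[THEN conjunct2]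
  note GBA_P = representation_GBA_P[THEN conjunct1] representation_GBA_P[THEN conjunct2]
  note PStone = category_opposite[OF category_PStone] representation_PStone
  note PStone_S = category_opposite[OF category_PStone_S] representation_PStone_S
  note PStone_P = representation_PStone_P[THEN conjunct1] representation_PStone_P[THEN conjunct2]
  have 1: "category (small_frames S ?Sup)" "category (small_frames S ?FInf)" "category (small_frames S ?Frm)"
      "category (small_algebras S ?M)" "category (small_algebras S ?GBA)" "category (small_algebras S ?GBA_P)"
    by (simp_all add: small_frames_def small_algebras_def category_full_sub Sup(1) FInf(1) Frm(1)
        M(1) GBA(1) GBA_P(1))
  have "category ?PStone_P" using category_opposite[OF PStone_P(1)] by simp
  then have 2: "category (small_spaces S ?PStone)" "category (small_spaces S ?PStone_S)"
      "category (small_spaces S ?PStone_P)"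
    by (simp_all add: small_spaces_def category_full_sub category_PStone category_PStone_S)
  have ObA: "Ob ?M = {M. generalized_boolean_algebra M}" "Ob ?GBA = {M. generalized_boolean_algebra M}"
      "Ob ?GBA_P = {M. generalized_boolean_algebra M}"
    by (simp_all add: GBA_M_def GBA_def GBA_P_def concrete_def)
  have ObX: "Ob (opposite ?PStone) = {X. pointed_Stone_space X}"
      "Ob (opposite ?PStone_S) = {X. pointed_Stone_space X}"
      "Ob (opposite ?PStone_P) = {X. pointed_Stone_space X}"
    by (simp_all add: opposite_def PStone_def PStone_S_def PStone_P_def wide_sub_def concrete_def)
  have rA: "\<exists>N\<in>{N. generalized_boolean_algebra N}. \<exists>w. order_iso M (N :: 'a gorder) w"
    if "gba M" "embeds_into_member (carrier M) S" for M :: "'f gorder"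
    using small_algebra_exists[OF that] by blast
  have rX: "\<exists>X\<in>{X. pointed_Stone_space X}. \<exists>w. order_iso M (algebra_of_space (X :: 'x pointed_ospace)) w"
    if "gba M" "embeds_into_member (carrier M) S" for M :: "'f gorder"
    using space_of_algebra_exists[OF that(1) embeds_into_member_Pow[OF that(2) assms(2)]] by blast
  (* The trivial predicate leaves the categories as they are. *)
  let ?T = "\<lambda>_ _ _. True"
  have a1: "equivalent (small_frames S ?Sup) (small_algebras S ?M)"
    using equivalent_small_frames[OF assms(1) Sup M rA[folded ObA(1)] iso_square.preserves_finite_meets_iff,
        where P = ?T and R = ?T and B = ?T and B' = ?T]
    by (simp add: wide_sub_True small_algebras_def)
  have a2: "equivalent (small_frames S ?FInf) (small_algebras S ?GBA)"
    using equivalent_small_frames[OF assms(1) FInf GBA rA[folded ObA(2)] iso_square.lattice_hom_iff,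
        where P = ?T and R = ?T and B = ?T and B' = ?T]
    by (simp add: wide_sub_True small_algebras_def)
  have a4: "equivalent (small_frames S ?Frm) (small_algebras S ?GBA_P)"
    using equivalent_small_frames[OF assms(1) Frm GBA_P rA[folded ObA(3)] iso_square.coinitial_hom_iff,
        where P = ?T and R = ?T and B = ?T and B' = ?T]
    by (simp add: wide_sub_True small_algebras_def)
  have s1: "dually_equivalent (small_frames S ?Sup) (small_spaces S ?PStone)"
    using equivalent_small_frames[OF assms(1) Sup PStone rX[folded ObX(1)] iso_square.preserves_finite_meets_iff,
        where P = ?T and R = ?T and B = ?T and B' = ?T]
    by (simp add: wide_sub_True dually_equivalent_def opposite_small_spaces) (simp add: small_spaces_def)
  have s2: "dually_equivalent (small_frames S ?FInf) (small_spaces S ?PStone_S)"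
    using equivalent_small_frames[OF assms(1) FInf PStone_S rX[folded ObX(2)] iso_square.lattice_hom_iff,
        where P = ?T and R = ?T and B = ?T and B' = ?T]
    by (simp add: wide_sub_True dually_equivalent_def opposite_small_spaces) (simp add: small_spaces_def)
  have s4: "dually_equivalent (small_frames S ?Frm) (small_spaces S ?PStone_P)"
    using equivalent_small_frames[OF assms(1) Frm PStone_P rX[folded ObX(3)] iso_square.coinitial_hom_iff,
        where P = ?T and R = ?T and B = ?T and B' = ?T]
    by (simp add: wide_sub_True dually_equivalent_def opposite_small_spaces) (simp add: small_spaces_def)
  let ?PF = "\<lambda>L1 L2 (\<alpha> :: 'f \<Rightarrow> 'f). compact_frame L1 \<and> compact_frame L2 \<longrightarrow> \<alpha> \<top>\<^bsub>L1\<^esub> = \<top>\<^bsub>L2\<^esub>"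
  let ?PX = "\<lambda>Y X (f :: 'x \<Rightarrow> 'x). openin (topo X) {pt X} \<and> openin (topo Y) {pt Y} \<longrightarrow>
        f ` (pts X - {pt X}) \<subseteq> pts Y - {pt Y}"
  have PF: "?PF L1 L2 \<alpha> \<longleftrightarrow>
      bounded_hom (algebra_of_frame L1) (algebra_of_frame L2) (restrict_to_compacts L1 L2 \<alpha>)"
    if "L1 \<in> Ob ?FInf" "L2 \<in> Ob ?FInf" "\<alpha> \<in> Hom ?FInf L1 L2" for L1 L2 \<alpha>
  proof -
    have "locally_Stone_frame L1" "locally_Stone_frame L2" "\<alpha> \<in> Hom ?Sup L1 L2"
      using that ObF(2) by (simp_all add: LStoneFrm_FInf_def wide_sub_def)
    then interpret lsf_sup_hom L1 L2 \<alpha> by (simp add: Hom_LStoneFrm_Sup)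
    show ?thesis by (rule bounded_iff)
  qed
  have PX: "?PX Y X f \<longleftrightarrow> bounded_hom (algebra_of_space Y) (algebra_of_space X) (preimage_map Y X f)"
    if "Y \<in> Ob (opposite ?PStone_S)" "X \<in> Ob (opposite ?PStone_S)" "f \<in> Hom (opposite ?PStone_S) Y X"
    for Y X f
    by (rule stone_map.bounded_iff[OF stone_map_of_Hom[OF that]])
  have a3: "equivalent (small_frames S ?FInfB) (small_algebras S ?GBA_B)"
  proof -
    have "equivalent (wide_sub (small_frames S ?FInf) ?PF)
        (wide_sub (full_sub ?GBA (\<lambda>M. embeds_into_member (carrier M) S)) bounded_hom)"
      by (rule equivalent_small_frames[where B = bounded_hom and B' = bounded_hom,
            OF assms(1) FInf GBA rA[folded ObA(2)] iso_square.lattice_hom_iff PF _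
              iso_square.bounded_hom_iff gba.bounded_hom_id])
        simp_all
    then show ?thesis
      unfolding LStoneFrm_FInfB_def GBA_B_def small_frames_def small_algebras_def wide_sub_full_sub
        bounded_hom_def .
  qed
  have s3: "dually_equivalent (small_frames S ?FInfB) (small_spaces S ?PStone_ST)"
  proof -
    have "equivalent (wide_sub (small_frames S ?FInf) ?PF)
        (wide_sub (full_sub (opposite ?PStone_S) (\<lambda>X. embeds_into_member (carrier (algebra_of_space X)) S)) ?PX)"
      by (rule equivalent_small_frames[where B = bounded_hom and B' = bounded_hom,
            OF assms(1) FInf PStone_S rX[folded ObX(2)] iso_square.lattice_hom_iff PF PX
              iso_square.bounded_hom_iff gba.bounded_hom_id])
    then show ?thesis
      unfolding dually_equivalent_def opposite_small_spaces LStoneFrm_FInfB_def PStone_ST_def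
        opposite_wide_sub small_frames_def small_spaces_def opposite_full_sub wide_sub_full_sub
        carrier_algebra_of_space .
  qed
  show ?thesis
    using 1 2 a1 a2 a3 a4 s1 s2 s3 s4 by simp
qed

end
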